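(* Let $X=\nu_4(\mathbb{P}^2)\subset\mathbb{P}^{14}$ be the Veronese surface of plane quartics over $\mathbb{C}$, and let $W_7$ be the maximal $X$-rank locus. Then $$W_7+X\subsetneq W_6=\sigma_6(X)=\mathbb{P}^{14}.$$
   Context: We work over $\mathbb{C}$. Here $\nu_4:\mathbb{P}^2\to\mathbb{P}^{14}$ is the degree $4$ Veronese embedding. For a non-degenerate projective variety $X\subset\mathbb{P}^N$ and a point $p\in\mathbb{P}^N$, the $X$-rank $\mathrm{rk}_X(p)$ is the minimal $r$ such that $p\in\langle p_1,\dots,p_r\rangle$ for some $p_1,\dots,p_r\in X$, where $\langle\cdot\rangle$ denotes projective linear span. The maximal $X$-rank is the minimal integer $m$ such that every point of $\mathbb{P}^N$ is in the span of at most $m$ points of $X$; for $X=\nu_4(\mathbb{P}^2)$ it equals $7$. Define $W_k=\overline{\{p\in\mathbb{P}^N : \mathrm{rk}_X(p)=k\}}$ (Zariski closure). The $k$-th secant variety is $\sigma_k(X)=\overline{\bigcup_{p_1,\dots,p_k\in X}\langle p_1,\dots,p_k\rangle}$. For closed subsets $W,X\subseteq\mathbb{P}^N$, $W+X$ denotes their join, i.e. the Zariski closure of the union of the lines $\langle w,x\rangle$ with $w\in W$, $x\in X$, $w\neq x$. *)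

theory Defs
  imports "HOL-Analysis.Analysis"
begin

section \<open>Complex projective space\<close>

text \<open>A point of the projective space of \<open>complex ^ 'n\<close> is a line through the origin, so
  \<open>'n proj\<close> is \<open>\<bbbP>\<close> of dimension \<open>CARD('n) - 1\<close>; in particular \<open>3 proj\<close> is the projective plane.\<close>

typedef (overloaded) ('n::finite) proj =
    "{L :: (complex ^ 'n) set. vec.subspace L \<and> vec.dim L = 1}"
  morphisms line_of Proj
proof -
  have "(axis undefined 1 :: complex ^ 'n) \<noteq> 0" by (simp add: axis_eq_0_iff)
  then have "vec.dim (vec.span {axis undefined 1 :: complex ^ 'n}) = 1"
    by (metis vec.dim_span vec.dim_singleton)
  then show ?thesis using vec.subspace_span by blast
qed

setup_lifting type_definition_proj

definition lin_span :: "'n::finite proj set \<Rightarrow> 'n proj set" where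
  "lin_span S = {q. line_of q \<subseteq> vec.span (\<Union>p\<in>S. line_of p)}"

definition monomial_at :: "('n::finite \<Rightarrow> nat) \<Rightarrow> complex ^ 'n \<Rightarrow> complex" where
  "monomial_at e v = (\<Prod>i\<in>UNIV. (v $ i) ^ e i)"

definition is_form :: "nat \<Rightarrow> (complex ^ 'n::finite \<Rightarrow> complex) \<Rightarrow> bool" where
  "is_form d f \<longleftrightarrow> (\<exists>M a. finite M \<and> (\<forall>e\<in>M. (\<Sum>i\<in>UNIV. e i) = d) \<and>
      f = (\<lambda>v. \<Sum>e\<in>M. a e * monomial_at e v))"

definition zariski_closed :: "'n::finite proj set \<Rightarrow> bool" where
  "zariski_closed Z \<longleftrightarrow> (\<exists>F. (\<forall>f\<in>F. \<exists>d. is_form d f) \<and>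
      Z = {p. \<forall>f\<in>F. \<forall>v\<in>line_of p. f v = 0})"

abbreviation zariski_closure :: "'n::finite proj set \<Rightarrow> 'n proj set" where
  "zariski_closure S \<equiv> zariski_closed hull S"

section \<open>Rank, rank loci, secant varieties and joins\<close>

text \<open>The rank is meaningful for non-degenerate \<open>X\<close> only: otherwise the \<open>LEAST\<close> may range over
  an empty set.\<close>

definition X_rank :: "'n::finite proj set \<Rightarrow> 'n proj \<Rightarrow> nat" where
  "X_rank X p = (LEAST r. \<exists>ps. length ps = r \<and> set ps \<subseteq> X \<and> p \<in> lin_span (set ps))"

definition rank_locus :: "'n::finite proj set \<Rightarrow> nat \<Rightarrow> 'n proj set" where
  "rank_locus X k = zariski_closure {p. X_rank X p = k}"

definition secant_variety :: "nat \<Rightarrow> 'n::finite proj set \<Rightarrow> 'n proj set" where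
  "secant_variety k X =
     zariski_closure (\<Union>ps\<in>{ps. length ps = k \<and> set ps \<subseteq> X}. lin_span (set ps))"

definition join :: "'n::finite proj set \<Rightarrow> 'n proj set \<Rightarrow> 'n proj set" where
  "join W X = zariski_closure (\<Union>w\<in>W. \<Union>x\<in>X - {w}. lin_span {w, x})"

section \<open>The quartic Veronese surface\<close>

text \<open>The homogeneous coordinates of the target space are indexed by the exponents of the
  monomials of degree 4 in three variables.\<close>

typedef quartic_exponent = "{e :: 3 \<Rightarrow> nat. (\<Sum>i\<in>UNIV. e i) = 4}"
  morphisms exponent Quartic_Exponent
  by (rule exI[of _ "\<lambda>i. if i = 1 then 4 else 0"]) (simp add: sum_3)

lemma quartic_exponent_bij:
  "bij_betw (\<lambda>e :: 3 \<Rightarrow> nat. (e 1, e 2)) {e. (\<Sum>i\<in>UNIV. e i) = 4} (SIGMA a:{..4}. {..4 - a})"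
proof (rule bij_betw_byWitness
    [where f' = "\<lambda>(a, b) i. if i = 1 then a else if i = 2 then b else 4 - a - b"])
  show "\<forall>e\<in>{e :: 3 \<Rightarrow> nat. (\<Sum>i\<in>UNIV. e i) = 4}.
      (case (e 1, e 2) of (a, b) \<Rightarrow> \<lambda>i. if i = 1 then a else if i = 2 then b else 4 - a - b) = e"
  proof
    fix e :: "3 \<Rightarrow> nat" assume "e \<in> {e. (\<Sum>i\<in>UNIV. e i) = 4}"
    then have "e 1 + e 2 + e 3 = 4" by (simp add: sum_3)
    then have "(if i = 1 then e 1 else if i = 2 then e 2 else 4 - e 1 - e 2) = e i" for i
      using exhaust_3[of i] by auto
    then show "(case (e 1, e 2) of (a, b) \<Rightarrow>
        \<lambda>i. if i = 1 then a else if i = 2 then b else 4 - a - b) = e" by auto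
  qed
qed (auto simp: sum_3)

instance quartic_exponent :: finite
proof
  have "finite {e :: 3 \<Rightarrow> nat. (\<Sum>i\<in>UNIV. e i) = 4}"
    using bij_betw_finite[OF quartic_exponent_bij] by auto
  then show "finite (UNIV :: quartic_exponent set)"
    using type_definition.univ[OF type_definition_quartic_exponent] by (metis finite_imageI)
qed

lemma card_quartic_exponent: "CARD(quartic_exponent) = 15"
proof -
  have "CARD(quartic_exponent) = card {e :: 3 \<Rightarrow> nat. (\<Sum>i\<in>UNIV. e i) = 4}"
    by (rule type_definition.card[OF type_definition_quartic_exponent])
  also have "\<dots> = card (SIGMA a:{..4::nat}. {..4 - a})"
    by (rule bij_betw_same_card[OF quartic_exponent_bij])
  also have "\<dots> = 15" by (simp add: card_SigmaI atMost_nat_numeral atMost_Suc)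
  finally show ?thesis .
qed

definition quartic_monomials :: "complex ^ 3 \<Rightarrow> complex ^ quartic_exponent" where
  "quartic_monomials v = (\<chi> e. monomial_at (exponent e) v)"

lemma quartic_monomials_scale:
  "quartic_monomials (c *s v) = c ^ 4 *s quartic_monomials v"
proof -
  have "(\<Sum>i\<in>UNIV. exponent e i) = 4" for e using exponent[of e] by simp
  then have "(\<Prod>i\<in>UNIV. c ^ exponent e i) = c ^ 4" for e
    by (metis power_sum)
  then show ?thesis
    by (simp add: quartic_monomials_def monomial_at_def vec_eq_iff power_mult_distrib prod.distrib)
qed

lemma quartic_monomials_nonzero:
  assumes "v \<noteq> 0" shows "quartic_monomials v \<noteq> 0"
proof -
  from assms obtain k where k: "v $ k \<noteq> 0" by (auto simp: vec_eq_iff)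
  let ?e = "\<lambda>i. if i = k then 4 else 0 :: nat"
  have "exponent (Quartic_Exponent ?e) = ?e"
    by (rule Quartic_Exponent_inverse) simp
  moreover have "monomial_at ?e v \<noteq> 0"
    using k by (auto simp: monomial_at_def)
  ultimately have "quartic_monomials v $ Quartic_Exponent ?e \<noteq> 0"
    by (simp add: quartic_monomials_def)
  then show ?thesis by (metis zero_index)
qed

lemma span_quartic_monomials_line:
  assumes "v \<noteq> 0"
  shows "vec.span (quartic_monomials ` vec.span {v}) = vec.span {quartic_monomials v}"
proof (rule vec.span_eq[THEN iffD2], intro conjI)
  show "quartic_monomials ` vec.span {v} \<subseteq> vec.span {quartic_monomials v}"
    by (auto simp: vec.span_singleton quartic_monomials_scale)
  show "{quartic_monomials v} \<subseteq> vec.span (quartic_monomials ` vec.span {v})"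
    by (auto intro!: vec.span_base simp: vec.span_base)
qed

text \<open>The span below is again a line: the map sends \<open>c *s v\<close> to \<open>c ^ 4 *s quartic_monomials v\<close>.\<close>

lift_definition veronese4 :: "3 proj \<Rightarrow> quartic_exponent proj"
  is "\<lambda>L. vec.span (quartic_monomials ` L)"
proof -
  fix L :: "(complex ^ 3) set"
  assume L: "vec.subspace L \<and> vec.dim L = 1"
  then obtain B where B: "B \<subseteq> L" "vec.independent B" "L \<subseteq> vec.span B" "card B = 1"
    using vec.basis_exists[of L] by metis
  then obtain v where v: "B = {v}" by (auto simp: card_1_singleton_iff)
  with B have "v \<noteq> 0" using vec.dependent_zero by blast
  moreover have "L = vec.span {v}" using B v L by (metis subset_antisym vec.span_minimal)
  ultimately have "vec.span (quartic_monomials ` L) = vec.span {quartic_monomials v}"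
    by (simp add: span_quartic_monomials_line)
  moreover have "vec.dim (vec.span {quartic_monomials v}) = 1"
    using quartic_monomials_nonzero[OF \<open>v \<noteq> 0\<close>] by (metis vec.dim_span vec.dim_singleton)
  ultimately show "vec.subspace (vec.span (quartic_monomials ` L)) \<and>
      vec.dim (vec.span (quartic_monomials ` L)) = 1"
    by (simp add: vec.subspace_span)
qed

definition veronese_surface :: "quartic_exponent proj set" where
  "veronese_surface = range veronese4"

end

theory Submission
  imports Defs "HOL-Computational_Algebra.Fundamental_Theorem_Algebra"
begin

text \<open>
  A quartic is a symmetric tensor; contracting it with symmetric \<open>3 \<times> 3\<close> matrices (conics) is its
  catalecticant. If the catalecticant is invertible, some power \<open>v\<^sup>4\<close> can be subtracted so that
  exactly one conic \<open>D\<close> remains apolar, and a small perturbation of \<open>v\<close> makes \<open>D\<close> smooth except in an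
  explicit case. A quartic with a single, smooth apolar conic is a binary octic with invertible Hankel
  matrix, hence by Gaussian quadrature a sum of five powers; if the single apolar conic is a pair of
  distinct lines, the quartic is a sum of two binary quartics that share a coefficient, which can be
  distributed so that each is a sum of three powers. So a quartic has rank at most 6 unless two
  independent conics, or a double line, are apolar to it. Adding a power in the first case leaves the
  catalecticant singular, and in the second case yields a family with only 14 parameters in a
  15-dimensional space, so the join of \<open>W\<^sub>7\<close> with the Veronese surface lies in a hypersurface.
  Conversely rank at most 5 forces a singular catalecticant (a conic passes through five points), so
  the quartics with invertible catalecticant have rank exactly 6 and they are dense.
\<close>

text \<open>Call the conic \<open>q\<close> for which \<open>contr T q\<close> is the square of
  \<open>v\<close> the dual conic of \<open>v\<close>. Six powers leave no slack: after one power is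
  peeled off, a smooth dual conic costs five more, but a pair of lines costs six. The dual conic is
  a quadratic polynomial in \<open>v\<close>, so a first-order term tells whether moving
  \<open>v\<close> smooths it. For a pair of lines this term vanishes in all directions exactly when
  the conic \<open>m\<close> dual to the node satisfies \<open>m *v v = 0\<close>. In that case
  \<open>m\<close> restricts to a quadratic on each line that is apolar to the binary quartic there,
  up to the shared coefficient; a suitable choice of this coefficient brings one of them down to two
  powers, and 1 + 2 + 3 = 6. This fails only if \<open>m\<close> is a square, and then the quartic
  is explicit enough for a smooth dual conic to be written down at another point. As for the
  hypersurface, its equation is the catalecticant determinant times a polynomial that is only known
  to exist, by comparing dimensions of spaces of power products.\<close>

lemma homogeneous_system_nontrivial_solution:
  fixes a :: "'j \<Rightarrow> 'i \<Rightarrow> 'f::field"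
  assumes "finite J" "finite I" "card J < card I"
  shows "\<exists>x. (\<exists>i\<in>I. x i \<noteq> 0) \<and> (\<forall>j\<in>J. (\<Sum>i\<in>I. a j i * x i) = 0)"
  using assms
proof (induction J arbitrary: a I rule: finite_induct)
  case empty
  then have "I \<noteq> {}" by auto
  then obtain i where "i \<in> I" by auto
  then show ?case by (intro exI[of _ "\<lambda>_. 1"]) auto
next
  case (insert j0 J)
  show ?case
  proof (cases "\<exists>i0\<in>I. a j0 i0 \<noteq> 0")
    case True
    then obtain i0 where i0: "i0 \<in> I" "a j0 i0 \<noteq> 0" by blast
    define b where "b = (\<lambda>j i. a j i - a j i0 * a j0 i / a j0 i0)"
    have fI: "finite (I - {i0})" using insert.prems by auto
    have "card J < card (I - {i0})" using insert.prems insert.hyps i0 by (simp add: card_Diff_singleton)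
    then obtain x where x: "\<exists>i\<in>I - {i0}. x i \<noteq> 0" "\<forall>j\<in>J. (\<Sum>i\<in>I - {i0}. b j i * x i) = 0"
      using insert.IH[OF fI, of b] by blast
    define s where "s = (\<Sum>i\<in>I - {i0}. a j0 i * x i)"
    define y where "y = x(i0 := - s / a j0 i0)"
    have split: "(\<Sum>i\<in>I. a j i * y i) = - a j i0 * s / a j0 i0 + (\<Sum>i\<in>I - {i0}. a j i * x i)" for j
    proof -
      have "(\<Sum>i\<in>I. a j i * y i) = a j i0 * y i0 + (\<Sum>i\<in>I - {i0}. a j i * y i)"
        using i0 insert.prems by (simp add: sum.remove)
      also have "(\<Sum>i\<in>I - {i0}. a j i * y i) = (\<Sum>i\<in>I - {i0}. a j i * x i)"
        by (intro sum.cong) (auto simp: y_def)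
      finally show ?thesis by (simp add: y_def)
    qed
    have "(\<Sum>i\<in>I. a j i * y i) = 0" if "j \<in> insert j0 J" for j
    proof (cases "j = j0")
      case True
      then show ?thesis using split[of j0] i0 by (simp add: s_def)
    next
      case False
      then have "0 = (\<Sum>i\<in>I - {i0}. b j i * x i)" using x that by auto
      also have "\<dots> = (\<Sum>i\<in>I - {i0}. a j i * x i) - a j i0 / a j0 i0 * s"
        by (simp add: b_def s_def algebra_simps sum_subtractf sum_distrib_left)
      finally show ?thesis using split[of j] by (simp add: algebra_simps)
    qed
    moreover have "\<exists>i\<in>I. y i \<noteq> 0" using x(1) by (auto simp: y_def)
    ultimately show ?thesis by blast
  next
    case False
    have "card J < card I" using insert by auto
    then obtain x where "\<exists>i\<in>I. x i \<noteq> 0" "\<forall>j\<in>J. (\<Sum>i\<in>I. a j i * x i) = 0"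
      using insert.IH[of I a] insert.prems by blast
    with False show ?thesis by auto
  qed
qed

section \<open>Gaussian quadrature over the complex numbers\<close>

text \<open>The moment functional of the sequence \<open>s\<close>: linear on polynomials, with
  value \<open>s i\<close> on the \<open>i\<close>-th power of the variable. Orthogonality below
  refers to the bilinear form \<open>moment s (p * q)\<close>, which need not be definite.\<close>

definition moment :: "(nat \<Rightarrow> complex) \<Rightarrow> complex poly \<Rightarrow> complex" where
  "moment s p = (\<Sum>i\<le>degree p. coeff p i * s i)"

lemma moment_eq_sum:
  assumes "degree p \<le> n" shows "moment s p = (\<Sum>i\<le>n. coeff p i * s i)"
  unfolding moment_def
  by (rule sum.mono_neutral_left) (use assms in \<open>auto simp: coeff_eq_0\<close>)

lemma moment_add: "moment s (p + q) = moment s p + moment s q"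
  using moment_eq_sum[of "p + q" "max (degree p) (degree q)" s]
    moment_eq_sum[of p "max (degree p) (degree q)" s] moment_eq_sum[of q "max (degree p) (degree q)" s]
    degree_add_le_max[of p q]
  by (simp add: sum.distrib algebra_simps)

lemma moment_smult: "moment s (smult c p) = c * moment s p"
  by (cases "c = 0") (simp_all add: moment_def sum_distrib_left algebra_simps)

lemma moment_0 [simp]: "moment s 0 = 0" by (simp add: moment_def)

lemma moment_diff: "moment s (p - q) = moment s p - moment s q"
  using moment_add[of s p "smult (-1) q"] moment_smult[of s "-1" q] by simp

lemma moment_sum: "moment s (sum f A) = (\<Sum>x\<in>A. moment s (f x))"
  by (induction A rule: infinite_finite_induct) (auto simp: moment_add)

lemma moment_monom: "moment s (monom c n) = c * s n"
  by (cases "c = 0") (auto simp: moment_def degree_monom_eq coeff_monom if_distrib if_distribR cong: if_cong)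

lemma moment_mult_sum:
  assumes "degree a \<le> n"
  shows "moment s (q * a) = (\<Sum>i\<le>n. coeff a i * moment s (q * monom 1 i))"
proof -
  have "a = (\<Sum>i\<le>n. smult (coeff a i) (monom 1 i))"
    using poly_as_sum_of_monoms'[OF assms] by (simp add: smult_monom)
  then have "q * a = (\<Sum>i\<le>n. smult (coeff a i) (q * monom 1 i))"
    by (metis (no_types, lifting) mult_smult_right sum.cong sum_distrib_left)
  then show ?thesis by (simp add: moment_sum moment_smult)
qed

lemma card_roots_rsquarefree:
  fixes p :: "complex poly"
  assumes "rsquarefree p"
  shows "card {z. poly p z = 0} = degree p"
proof -
  have p: "p \<noteq> 0" "order z p = 0 \<or> order z p = 1" for z using assms by (auto simp: rsquarefree_def)
  have set: "set_mset (proots p) = {z. poly p z = 0}" using p by simp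
  have "degree p = size (proots p)" by (simp add: size_proots_complex)
  also have "\<dots> = (\<Sum>z\<in>{z. poly p z = 0}. order z p)"
    unfolding size_multiset_overloaded_eq set using p by simp
  also have "\<dots> = (\<Sum>z\<in>{z. poly p z = 0}. 1)"
  proof (rule sum.cong[OF refl])
    fix z assume "z \<in> {z. poly p z = 0}"
    then have "order z p \<noteq> 0" using p(1) by (simp add: order_root)
    then show "order z p = 1" using p(2)[of z] by presburger
  qed
  finally show ?thesis by simp
qed

text \<open>Divide \<open>x ^ n\<close> by \<open>q\<close>. The multiple of \<open>q\<close> has
  moment zero, because its cofactor has degree at most \<open>n - k\<close>; the remainder is the
  Lagrange interpolant of \<open>x ^ n\<close> at the \<open>k\<close> simple roots. Hence the
  weights are the moments of the Lagrange basis.\<close>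

lemma quadrature_nodes:
  fixes q :: "complex poly"
  assumes sf: "rsquarefree q" and deg: "degree q = k" and kd: "k \<le> Suc d"
    and orth: "\<And>i. i + k \<le> d \<Longrightarrow> moment s (q * monom 1 i) = 0"
  shows "\<exists>S w. finite S \<and> card S = k \<and> (\<forall>n\<le>d. s n = (\<Sum>r\<in>S. w r * r ^ n))"
proof -
  define S where "S = {z. poly q z = 0}"
  have q0: "q \<noteq> 0" using sf by (auto simp: rsquarefree_def)
  have fS: "finite S" unfolding S_def using poly_roots_finite[OF q0] .
  have cS: "card S = k" using card_roots_rsquarefree[OF sf] deg by (simp add: S_def)
  define l where "l = (\<lambda>r. \<Prod>t\<in>S - {r}. smult (1 / (r - t)) [:- t, 1:])"
  have l_eval: "poly (l r) t = (if t = r then 1 else 0)" if "r \<in> S" "t \<in> S" for r t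
  proof (cases "t = r")
    case True
    have "poly (smult (1 / (r - u)) [:- u, 1:]) r = 1" if "u \<in> S - {r}" for u
    proof -
      have "r - u \<noteq> 0" using that by auto
      then show ?thesis by (simp add: diff_divide_distrib[symmetric])
    qed
    then show ?thesis using True by (simp add: l_def poly_prod)
  next
    case False
    then have "t \<in> S - {r}" using that by auto
    then have "\<exists>u\<in>S - {r}. poly (smult (1 / (r - u)) [:- u, 1:]) t = 0" by (intro bexI[of _ t]) auto
    then show ?thesis using False fS by (auto simp: l_def poly_prod)
  qed
  have l_deg: "degree (l r) < k" if "r \<in> S" for r
  proof -
    have "degree (l r) \<le> (\<Sum>t\<in>S - {r}. degree (smult (1 / (r - t)) [:- t, 1:]))"
      unfolding l_def
      using degree_prod_sum_le[of "S - {r}" "\<lambda>t. smult (1 / (r - t)) [:- t, 1:]"] fS by (simp add: o_def)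
    also have "\<dots> \<le> (\<Sum>t\<in>S - {r}. 1)" by (intro sum_mono) (auto intro: order.trans[OF degree_smult_le])
    also have "\<dots> = k - 1" using cS fS that by (simp add: card_Diff_singleton)
    also have "\<dots> < k" using cS that fS by (metis card_gt_0_iff diff_less empty_iff less_one)
    finally show ?thesis .
  qed
  have "s n = (\<Sum>r\<in>S. moment s (l r) * r ^ n)" if n: "n \<le> d" for n
  proof -
    define f where "f = monom (1::complex) n"
    define u where "u = f mod q"
    have f: "f = q * (f div q) + u" by (simp add: u_def)
    have degf: "degree f = n" by (simp add: f_def degree_monom_eq)
    have du: "degree u < k \<or> u = 0" unfolding u_def using degree_mod_less[of q f] q0 deg by auto
    have u_eq: "u = (\<Sum>r\<in>S. smult (r ^ n) (l r))" (is "_ = ?L")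
    proof (rule ccontr)
      assume "u \<noteq> ?L"
      then have ne: "u - ?L \<noteq> 0" by simp
      have "poly (u - ?L) t = 0" if "t \<in> S" for t
      proof -
        have "poly f t = poly q t * poly (f div q) t + poly u t"
          by (subst f) simp
        then have "poly u t = poly f t" using that by (simp add: S_def)
        moreover have "poly ?L t = (\<Sum>r\<in>S. if t = r then r ^ n else 0)"
          unfolding poly_sum by (intro sum.cong) (auto simp: l_eval that)
        ultimately show ?thesis using fS that by (simp add: f_def poly_monom)
      qed
      then have "S \<subseteq> {x. poly (u - ?L) x = 0}" by auto
      then have "card S \<le> card {x. poly (u - ?L) x = 0}"
        by (rule card_mono[OF poly_roots_finite[OF ne]])
      also have "\<dots> \<le> degree (u - ?L)" by (rule card_poly_roots_bound[OF ne])
      finally have "k \<le> degree (u - ?L)" by (simp only: cS)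
      moreover have "degree ?L < k \<or> k = 0"
      proof (cases "k = 0")
        case False
        then show ?thesis
          using degree_sum_less[of S "\<lambda>r. smult (r ^ n) (l r)" k] l_deg
          by (auto intro: le_less_trans[OF degree_smult_le])
      qed simp
      moreover have "k \<noteq> 0"
      proof
        assume "k = 0"
        then have "u = 0" "S = {}" using du cS fS by auto
        then show False using ne by simp
      qed
      ultimately show False using du degree_diff_less[of u k ?L] by auto
    qed
    have "moment s (q * (f div q)) = 0"
    proof (cases "n < k")
      case True
      then have "f div q = 0" using degf deg by (simp add: div_poly_less)
      then show ?thesis by simp
    next
      case False
      have "f = q * (f div q) + u" by (rule f)
      then have "q * (f div q) = f - u" by (metis add_diff_cancel_right')
      moreover have "degree (f - u) \<le> n" using du degf False by (intro degree_diff_le) auto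
      ultimately have "f div q = 0 \<or> k + degree (f div q) \<le> n"
        using q0 deg by (metis degree_mult_eq)
      then have "degree (f div q) \<le> n - k" by auto
      then have "moment s (q * (f div q)) = (\<Sum>i\<le>n - k. coeff (f div q) i * moment s (q * monom 1 i))"
        by (simp add: moment_mult_sum)
      also have "\<dots> = 0" by (rule sum.neutral) (use orth n False in auto)
      finally show ?thesis .
    qed
    moreover have "moment s f = moment s (q * (f div q)) + moment s u"
      by (subst f) (simp add: moment_add)
    ultimately have "moment s f = moment s u" by simp
    then have "s n = moment s u" by (simp add: f_def moment_monom)
    then show ?thesis by (simp add: u_eq moment_sum moment_smult mult.commute)
  qed
  with fS cS show ?thesis by (intro exI[of _ S] exI[of _ "\<lambda>r. moment s (l r)"]) auto
qed


text \<open>A multiple root \<open>r\<close> of \<open>q + c p\<close> is a zero of the Wronskian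
  \<open>W\<close> and determines \<open>c\<close> as \<open>- q(r) / p(r)\<close>, so a nonzero
  Wronskian leaves only finitely many bad \<open>c\<close>. It is nonzero because at a root of
  \<open>q\<close>, where \<open>p\<close> does not vanish, \<open>q' p\<close> has smaller order
  than \<open>q p'\<close>.\<close>

lemma pencil_rsquarefree_member:
  fixes p q :: "complex poly"
  assumes coprime: "\<And>r. \<not> (poly p r = 0 \<and> poly q r = 0)"
    and deg: "degree p < degree q"
  shows "\<exists>c. rsquarefree (q + smult c p)"
proof -
  define W where "W = pderiv q * p - q * pderiv p"
  have q0: "q \<noteq> 0" using deg by auto
  have "p \<noteq> 0"
  proof
    assume "p = 0"
    moreover have "\<not> constant (poly q)" using deg by (simp add: constant_degree)
    then obtain r where "poly q r = 0" using fundamental_theorem_of_algebra by blast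
    ultimately show False using coprime[of r] by simp
  qed
  have "W \<noteq> 0"
  proof
    assume "W = 0"
    then have eq: "pderiv q * p = q * pderiv p" by (simp add: W_def)
    have "\<not> constant (poly q)" using deg by (simp add: constant_degree)
    then obtain r where r: "poly q r = 0" using fundamental_theorem_of_algebra by blast
    have "poly p r \<noteq> 0" using coprime r by blast
    then have "order r p = 0" by (simp add: order_root)
    have pd: "pderiv q \<noteq> 0" using deg by (auto simp: pderiv_eq_0_iff)
    have nz: "pderiv q * p \<noteq> 0" using pd \<open>p \<noteq> 0\<close> by simp
    then have "order r (pderiv q * p) = order r q + order r (pderiv p)"
      using eq order_mult by metis
    moreover have "order r (pderiv q * p) = order r (pderiv q)"
      using order_mult[OF nz, of r] \<open>order r p = 0\<close> by simp
    moreover have "order r q = Suc (order r (pderiv q))"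
      using order_pderiv[of q r] pd r q0 by (simp add: order_root)
    ultimately show False by simp
  qed
  define B where "B = (\<lambda>r. - poly q r / poly p r) ` {r. poly W r = 0}"
  have "finite B" unfolding B_def using poly_roots_finite[OF \<open>W \<noteq> 0\<close>] by simp
  then obtain c where c: "c \<notin> B" using infinite_UNIV_char_0 by (metis ex_new_if_finite)
  have "rsquarefree (q + smult c p)" unfolding rsquarefree_roots
  proof (intro allI notI, elim conjE)
    fix r assume r: "poly (q + smult c p) r = 0" "poly (pderiv (q + smult c p)) r = 0"
    then have 1: "poly q r = - c * poly p r" "poly (pderiv q) r = - c * poly (pderiv p) r"
      by (simp_all add: pderiv_add pderiv_smult add_eq_0_iff2)
    then have "poly W r = 0" by (simp add: W_def)
    moreover have "poly p r \<noteq> 0" using coprime[of r] 1 by auto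
    then have "c = - poly q r / poly p r" using 1 by simp
    ultimately show False using c by (auto simp: B_def)
  qed
  then show ?thesis by blast
qed

text \<open>\<open>x ^ (i + 1) = (x - r) x ^ i + r x ^ i\<close>, so orthogonality passes from
  \<open>(x - r) f\<close> to \<open>f\<close>, with one power gained. This serves to divide a
  common root out of orthogonal polynomials.\<close>

lemma moment_orthogonal_shift:
  assumes "moment s f = 0" "\<And>i. i < n \<Longrightarrow> moment s (f * [:- r, 1:] * monom 1 i) = 0"
  shows "i \<le> n \<Longrightarrow> moment s (f * monom 1 i) = 0"
proof (induction i)
  case 0
  then show ?case using assms by (simp add: monom_0)
next
  case (Suc i)
  have "monom 1 (Suc i) = [:- r, 1:] * monom 1 i + smult r (monom 1 i :: complex poly)"
    by (simp add: monom_Suc)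
  then have "f * monom 1 (Suc i) = f * [:- r, 1:] * monom 1 i + smult r (f * monom 1 i)"
    by (simp add: algebra_simps)
  then show ?case using Suc assms by (simp add: moment_add moment_smult)
qed

text \<open>Only \<open>2 * k - 1\<close> moments are to be represented, so a node polynomial need
  only be orthogonal to degrees up to \<open>k - 2\<close>. A whole pencil \<open>q + c p\<close>
  meets this condition, and the choice of \<open>c\<close> replaces the positivity that makes the
  roots simple over the reals.\<close>

lemma gaussian_quadrature:
  assumes nondeg: "\<And>p. degree p < k \<Longrightarrow> (\<And>i. i < k \<Longrightarrow> moment s (p * monom 1 i) = 0) \<Longrightarrow> p = 0"
    and k: "0 < k"
  shows "\<exists>S w. finite S \<and> card S = k \<and> (\<forall>n \<le> 2 * k - 2. s n = (\<Sum>r\<in>S. w r * r ^ n))"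
proof -
  have solve: "\<exists>p. p \<noteq> 0 \<and> degree p \<le> n \<and> (\<forall>i<m. moment s (p * monom 1 i) = 0)" if "m \<le> n" for m n
  proof -
    obtain x where x: "\<exists>j\<in>{..n}. x j \<noteq> 0"
      "\<forall>i\<in>{..<m}. (\<Sum>j\<in>{..n}. moment s (monom 1 i * monom 1 j) * x j) = 0"
      using homogeneous_system_nontrivial_solution[of "{..<m}" "{..n}"
          "\<lambda>i j. moment s (monom 1 i * monom 1 j)"] \<open>m \<le> n\<close> by auto
    define p where "p = (\<Sum>j\<le>n. monom (x j) j)"
    have cp: "coeff p j = (if j \<le> n then x j else 0)" for j
      unfolding p_def by (simp add: coeff_sum)
    then have dp: "degree p \<le> n" by (intro degree_le) auto
    have "p \<noteq> 0" using x(1) cp by (metis atMost_iff coeff_0)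
    moreover have "moment s (p * monom 1 i) = 0" if "i < m" for i
    proof -
      have "moment s (monom 1 i * p) = (\<Sum>j\<le>n. moment s (monom 1 i * monom 1 j) * x j)"
        unfolding moment_mult_sum[OF dp] by (intro sum.cong refl) (simp add: cp)
      also have "\<dots> = 0" using x(2) that by simp
      finally show ?thesis by (simp only: mult.commute[of p])
    qed
    ultimately show ?thesis using dp by blast
  qed
  obtain p where p: "p \<noteq> 0" "degree p \<le> k - 1" "\<forall>i<k - 1. moment s (p * monom 1 i) = 0"
    using solve[of "k - 1" "k - 1"] by auto
  \<comment> \<open>For \<open>i = k - 1\<close> the condition involves
    \<open>s (2 * k - 1)\<close>, which lies beyond the moments to be represented and may have any
    value; the extra condition serves to force degree exactly \<open>k\<close>.\<close>
  obtain q where q: "q \<noteq> 0" "degree q \<le> k" "\<forall>i<k. moment s (q * monom 1 i) = 0"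
    using solve[of k k] by auto
  have dq: "degree q = k" using q nondeg[of q] by (metis le_neq_implies_less)
  have dpq: "degree p < degree q" using p dq k by simp
  have "\<not> (poly p r = 0 \<and> poly q r = 0)" for r
  proof
    assume "poly p r = 0 \<and> poly q r = 0"
    then obtain u v where u: "p = [:- r, 1:] * u" and v: "q = [:- r, 1:] * v"
      by (auto simp: poly_eq_0_iff_dvd elim!: dvdE)
    have u0: "u \<noteq> 0" and v0: "v \<noteq> 0" using p q u v by auto
    have deg_lin: "degree ([:- r, 1:] * g) = Suc (degree g)" if "g \<noteq> 0" for g
      by (subst degree_mult_eq) (use that in auto)
    have du: "Suc (degree u) \<le> k - 1" using p(2) deg_lin[OF u0] by (simp only: u)
    have dv: "Suc (degree v) = k" using dq deg_lin[OF v0] by (simp only: v)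
    \<comment> \<open>A combination of the cofactors with moment zero. It is orthogonal to all
      degrees below \<open>k\<close>, hence zero; comparing degrees gives
      \<open>moment s u = 0\<close>, and then \<open>u\<close> itself is orthogonal and must
      vanish.\<close>
    define f where "f = smult (moment s u) v - smult (moment s v) u"
    have degf: "degree f < k" unfolding f_def using du dv
      by (intro degree_diff_less) (auto intro: le_less_trans[OF degree_smult_le])
    have "f * [:- r, 1:] = smult (moment s u) q - smult (moment s v) p"
      by (simp only: f_def u v mult.commute[of _ "[:- r, 1:]"] right_diff_distrib mult_smult_right)
    then have "moment s (f * [:- r, 1:] * monom 1 i) = 0" if "i < k - 1" for i
      using p(3) q(3) that by (simp add: left_diff_distrib moment_diff moment_smult)
    moreover have "moment s f = 0" by (simp add: f_def moment_diff moment_smult)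
    ultimately have "moment s (f * monom 1 i) = 0" if "i < k" for i
      using moment_orthogonal_shift[of s f "k - 1" r i] that by simp
    then have "f = 0" using nondeg degf by blast
    then have "smult (moment s u) v = smult (moment s v) u" by (simp add: f_def)
    then have "moment s u \<noteq> 0 \<Longrightarrow> degree v \<le> degree u"
      by (metis degree_smult_eq degree_smult_le)
    then have "moment s u = 0" using du dv by linarith
    moreover have "moment s (u * [:- r, 1:] * monom 1 i) = 0" if "i < k - 1" for i
      using p(3) u that by (simp add: mult.commute)
    ultimately have "moment s (u * monom 1 i) = 0" if "i < k" for i
      using moment_orthogonal_shift[of s u "k - 1" r i] that by simp
    moreover have "degree u < k" using du by linarith
    ultimately show False using nondeg[of u] u0 by blast
  qed
  then obtain c where c: "rsquarefree (q + smult c p)"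
    using pencil_rsquarefree_member dpq by blast
  have "degree (q + smult c p) = k"
    using dpq dq by (metis degree_add_eq_left degree_smult_le le_less_trans)
  moreover have "moment s ((q + smult c p) * monom 1 i) = 0" if "i + k \<le> 2 * k - 2" for i
    using p(3) q(3) that k by (simp add: distrib_right moment_add moment_smult)
  ultimately show ?thesis using quadrature_nodes[OF c, of k "2 * k - 2" s] k by auto
qed

section \<open>Symmetric tensors and conics\<close>

type_synonym tensor4 = "3 \<Rightarrow> 3 \<Rightarrow> 3 \<Rightarrow> 3 \<Rightarrow> complex"

definition sym4 :: "tensor4 \<Rightarrow> bool" where
  "sym4 T \<longleftrightarrow> (\<forall>i j k l. T i j k l = T j i k l \<and> T i j k l = T i k j l \<and> T i j k l = T i j l k)"

definition pow4 :: "complex ^ 3 \<Rightarrow> tensor4" where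
  "pow4 v = (\<lambda>i j k l. v $ i * v $ j * v $ k * v $ l)"

definition rank_le :: "nat \<Rightarrow> tensor4 \<Rightarrow> bool" where
  "rank_le n T \<longleftrightarrow> (\<exists>xs. length xs \<le> n \<and>
     (\<forall>i j k l. T i j k l = (\<Sum>(c, v)\<leftarrow>xs. c * pow4 v i j k l)))"

definition symmat :: "complex ^ 3 ^ 3 \<Rightarrow> bool" where
  "symmat q \<longleftrightarrow> (\<forall>i j. q $ i $ j = q $ j $ i)"

text \<open>The catalecticant map. Up to a scalar it differentiates the quartic by the conic
  \<open>q\<close>, so its kernel on symmetric matrices is the space of apolar conics.\<close>

definition contr :: "tensor4 \<Rightarrow> complex ^ 3 ^ 3 \<Rightarrow> complex ^ 3 ^ 3" where
  "contr T q = (\<chi> k l. \<Sum>i\<in>UNIV. \<Sum>j\<in>UNIV. q $ i $ j * T i j k l)"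

definition conic_at :: "complex ^ 3 ^ 3 \<Rightarrow> complex ^ 3 \<Rightarrow> complex" where
  "conic_at q v = (\<Sum>i\<in>UNIV. \<Sum>j\<in>UNIV. q $ i $ j * v $ i * v $ j)"

text \<open>The product of two linear forms as a conic; the factor 1/2 makes
  \<open>line_pair a a\<close> the square of \<open>a\<close>.\<close>

definition line_pair :: "complex ^ 3 \<Rightarrow> complex ^ 3 \<Rightarrow> complex ^ 3 ^ 3" where
  "line_pair a b = (\<chi> i j. (a $ i * b $ j + a $ j * b $ i) / 2)"

definition nondeg :: "tensor4 \<Rightarrow> bool" where
  "nondeg T \<longleftrightarrow> (\<forall>q. symmat q \<longrightarrow> contr T q = 0 \<longrightarrow> q = 0)"

definition kernel_spanned_by :: "tensor4 \<Rightarrow> complex ^ 3 ^ 3 \<Rightarrow> bool" where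
  "kernel_spanned_by T D \<longleftrightarrow>
     contr T D = 0 \<and> (\<forall>q. symmat q \<longrightarrow> contr T q = 0 \<longrightarrow> (\<exists>c. q = (\<chi> i j. c * D $ i $ j)))"

lemma mat3_eq_iff: "(A :: complex ^ 3 ^ 3) = B \<longleftrightarrow> (\<forall>i j. A $ i $ j = B $ i $ j)"
  by (auto simp: vec_eq_iff)

text \<open>Adjacent swaps at concrete indices, oriented so that rewriting ends in sorted indices
  and only the fifteen independent entries remain.\<close>

lemma sym4_sort:
  assumes "sym4 T"
  shows "T 2 1 k l = T 1 2 k l" "T 3 1 k l = T 1 3 k l" "T 3 2 k l = T 2 3 k l"
    "T i 2 1 l = T i 1 2 l" "T i 3 1 l = T i 1 3 l" "T i 3 2 l = T i 2 3 l"
    "T i j 2 1 = T i j 1 2" "T i j 3 1 = T i j 1 3" "T i j 3 2 = T i j 2 3"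
  using assms by (auto simp: sym4_def)

lemma sym4_pow4: "sym4 (pow4 v)" by (simp add: sym4_def pow4_def)

lemma sym4_diff_pow4: "sym4 T \<Longrightarrow> sym4 (\<lambda>i j k l. T i j k l - c * pow4 v i j k l)"
  using sym4_pow4[of v] by (auto simp: sym4_def)

lemma rank_le_mono: "rank_le n T \<Longrightarrow> n \<le> m \<Longrightarrow> rank_le m T"
  unfolding rank_le_def by (meson order.trans)

lemma rank_le_add:
  assumes "rank_le n S" "rank_le m T"
  shows "rank_le (n + m) (\<lambda>i j k l. S i j k l + T i j k l)"
proof -
  obtain xs ys where "length xs \<le> n" "\<forall>i j k l. S i j k l = (\<Sum>(c, v)\<leftarrow>xs. c * pow4 v i j k l)"
    "length ys \<le> m" "\<forall>i j k l. T i j k l = (\<Sum>(c, v)\<leftarrow>ys. c * pow4 v i j k l)"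
    using assms by (auto simp: rank_le_def)
  then show ?thesis unfolding rank_le_def by (intro exI[of _ "xs @ ys"]) auto
qed

lemma rank_le_pow4: "rank_le 1 (\<lambda>i j k l. c * pow4 v i j k l)"
  unfolding rank_le_def by (intro exI[of _ "[(c, v)]"]) simp

lemma rank_le_sum:
  assumes "finite S" "\<And>i j k l. T i j k l = (\<Sum>r\<in>S. w r * pow4 (f r) i j k l)"
  shows "rank_le (card S) T"
proof -
  obtain rs where rs: "set rs = S" "distinct rs" using assms(1) finite_distinct_list by blast
  show ?thesis unfolding rank_le_def
  proof (intro exI[of _ "map (\<lambda>r. (w r, f r)) rs"] conjI allI)
    show "length (map (\<lambda>r. (w r, f r)) rs) \<le> card S" using rs distinct_card by force
    show "T i j k l = (\<Sum>(c, v)\<leftarrow>map (\<lambda>r. (w r, f r)) rs. c * pow4 v i j k l)" for i j k l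
      using rs by (simp add: assms(2) o_def sum_list_distinct_conv_sum_set)
  qed
qed

lemma symmat_contr: "sym4 T \<Longrightarrow> symmat (contr T q)"
  by (auto simp: symmat_def contr_def sym4_def)

lemma contr_linear:
  "contr T (\<chi> i j. a * p $ i $ j + b * q $ i $ j) = (\<chi> i j. a * contr T p $ i $ j + b * contr T q $ i $ j)"
  by (simp add: contr_def vec_eq_iff sum_3 algebra_simps)

lemma contr_pow4: "contr (pow4 v) q = (\<chi> k l. conic_at q v * v $ k * v $ l)"
  by (simp add: contr_def conic_at_def pow4_def vec_eq_iff sum_3 algebra_simps)

lemma contr_diff_pow4:
  "contr (\<lambda>i j k l. T i j k l - c * pow4 v i j k l) q
     = (\<chi> k l. contr T q $ k $ l - c * conic_at q v * v $ k * v $ l)"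
  by (simp add: contr_def conic_at_def pow4_def vec_eq_iff sum_3 algebra_simps)

lemma symmat_line_pair: "symmat (line_pair a b)"
  by (simp add: symmat_def line_pair_def add.commute)

text \<open>Self-adjointness of the catalecticant. It turns a pairing with a known contraction into
  an entry of an unknown dual conic.\<close>

lemma contr_pairing:
  assumes "sym4 T"
  shows "(\<Sum>i\<in>UNIV. \<Sum>j\<in>UNIV. p $ i $ j * contr T q $ i $ j)
    = (\<Sum>i\<in>UNIV. \<Sum>j\<in>UNIV. q $ i $ j * contr T p $ i $ j)"
  by (simp add: contr_def sum_3 sym4_sort[OF assms] algebra_simps)

subsection \<open>Coordinate changes\<close>

definition app :: "complex ^ 3 ^ 3 \<Rightarrow> (3 \<Rightarrow> complex) \<Rightarrow> 3 \<Rightarrow> complex" where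
  "app P f i = (\<Sum>a\<in>UNIV. P $ i $ a * f a)"

text \<open>Built one slot at a time, so that composition and symmetry reduce to the commutation of
  two slots, \<open>app_swap\<close>.\<close>

definition act :: "complex ^ 3 ^ 3 \<Rightarrow> tensor4 \<Rightarrow> tensor4" where
  "act P T i j k l = app P (\<lambda>a. app P (\<lambda>b. app P (\<lambda>c. app P (\<lambda>d. T a b c d) l) k) j) i"

lemma app_swap: "app Q (\<lambda>d. app P (\<lambda>a. f a d) x) y = app P (\<lambda>a. app Q (\<lambda>d. f a d) y) x"
  by (simp add: app_def sum_3 algebra_simps)

lemma app_app: "app Q (\<lambda>a. app P f a) i = app (Q ** P) f i"
  by (simp add: app_def sum_3 matrix_matrix_mult_def algebra_simps)

lemma act_act: "act Q (act P T) = act (Q ** P) T"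
proof (intro ext)
  show "act Q (act P T) i j k l = act (Q ** P) T i j k l" for i j k l
    unfolding act_def by (simp only: app_swap[of Q P] app_app[of Q P])
qed

lemma app_1: "app (mat 1) f i = f i"
  using exhaust_3[of i] by (auto simp: app_def sum_3 mat_def)

lemma act_1: "act (mat 1) T = T"
  by (intro ext) (simp add: act_def app_1)

lemma act_pow4: "act P (pow4 v) = pow4 (P *v v)"
  by (intro ext) (simp add: act_def app_def pow4_def matrix_vector_mult_def sum_3 algebra_simps)

lemma sym4_act:
  assumes "sym4 T" shows "sym4 (act P T)"
proof -
  have 1: "T a b c d = T b a c d" and 2: "T a b c d = T a c b d" and 3: "T a b c d = T a b d c" for a b c d
    using assms by (auto simp: sym4_def)
  have s1: "app P (\<lambda>a. app P (\<lambda>b. app P (\<lambda>c. app P (\<lambda>d. T a b c d) l) k) j) i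
      = app P (\<lambda>a. app P (\<lambda>b. app P (\<lambda>c. app P (\<lambda>d. T a b c d) l) k) i) j" for i j k l
    using app_swap[of P P "\<lambda>b a. app P (\<lambda>c. app P (\<lambda>d. T a b c d) l) k" j i] by (simp add: 1)
  have s2: "app P (\<lambda>b. app P (\<lambda>c. app P (\<lambda>d. T a b c d) l) k) j
      = app P (\<lambda>b. app P (\<lambda>c. app P (\<lambda>d. T a b c d) l) j) k" for a j k l
    using app_swap[of P P "\<lambda>c b. app P (\<lambda>d. T a b c d) l" k j] by (simp add: 2)
  have s3: "app P (\<lambda>c. app P (\<lambda>d. T a b c d) l) k = app P (\<lambda>c. app P (\<lambda>d. T a b c d) k) l" for a b k l
    using app_swap[of P P "\<lambda>d c. T a b c d" l k] by (simp add: 3)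
  have "act P T i j k l = act P T j i k l" for i j k l
    unfolding act_def by (rule s1)
  moreover have "act P T i j k l = act P T i k j l" for i j k l
    unfolding act_def by (simp only: s2[of _ l k j])
  moreover have "act P T i j k l = act P T i j l k" for i j k l
    unfolding act_def by (simp only: s3[of _ _ l k])
  ultimately show ?thesis unfolding sym4_def by blast
qed

text \<open>Conics live on the dual side: they are pulled back along \<open>P\<close>, contracted,
  and the result is pushed forward.\<close>

lemma contr_act: "contr (act P T) q = P ** contr T (transpose P ** q ** P) ** transpose P"
proof -
  define X where "X k l a b = app P (\<lambda>c. app P (\<lambda>d. T a b c d) l) k" for k l a b
  define q' where "q' = transpose P ** q ** P"
  have "contr (act P T) q $ k $ l = (\<Sum>a\<in>UNIV. \<Sum>b\<in>UNIV. q' $ a $ b * X k l a b)" for k l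
    by (simp add: contr_def act_def X_def[symmetric] q'_def)
      (simp add: app_def sum_3 matrix_matrix_mult_def transpose_def algebra_simps)
  moreover have "(P ** contr T q' ** transpose P) $ k $ l = (\<Sum>a\<in>UNIV. \<Sum>b\<in>UNIV. q' $ a $ b * X k l a b)" for k l
    by (simp add: X_def contr_def app_def sum_3 matrix_matrix_mult_def transpose_def algebra_simps)
  ultimately show ?thesis by (simp add: mat3_eq_iff q'_def)
qed

lemma rank_le_act:
  assumes "rank_le n T" shows "rank_le n (act P T)"
proof -
  obtain xs where xs: "length xs \<le> n" "\<And>i j k l. T i j k l = (\<Sum>(c, v)\<leftarrow>xs. c * pow4 v i j k l)"
    using assms by (auto simp: rank_le_def)
  have app_lin: "app P (\<lambda>a. c * f a + g a) i = c * app P f i + app P g i" for c f g i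
    by (simp add: app_def sum.distrib sum_distrib_left algebra_simps)
  have app_0: "app P (\<lambda>a. 0) i = 0" for i by (simp add: app_def)
  have "act P (\<lambda>i j k l. \<Sum>(c, v)\<leftarrow>xs. c * pow4 v i j k l) i j k l
      = (\<Sum>(c, v)\<leftarrow>xs. c * pow4 (P *v v) i j k l)" for i j k l
    by (induction xs) (auto simp: act_def app_0 app_lin act_pow4[symmetric])
  moreover have "T = (\<lambda>i j k l. \<Sum>(c, v)\<leftarrow>xs. c * pow4 v i j k l)" using xs(2) by (intro ext)
  ultimately show ?thesis using xs(1) unfolding rank_le_def
    by (intro exI[of _ "map (\<lambda>(c, v). (c, P *v v)) xs"]) (auto simp: o_def split_def)
qed

lemma rank_le_act_iff:
  assumes "invertible P" shows "rank_le n (act P T) \<longleftrightarrow> rank_le n T"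
proof -
  obtain Q where Q: "Q ** P = mat 1" using assms by (auto simp: invertible_def)
  then have "act Q (act P T) = T" by (simp add: act_act act_1)
  then show ?thesis using rank_le_act by metis
qed

lemma symmat_congruence: "symmat q \<Longrightarrow> symmat (transpose P ** q ** P)"
  by (simp add: symmat_def sum_3 matrix_matrix_mult_def transpose_def algebra_simps)

lemma nondeg_act:
  assumes P: "invertible P" and T: "nondeg T"
  shows "nondeg (act P T)"
  unfolding nondeg_def
proof (intro allI impI)
  fix q assume q: "symmat q" "contr (act P T) q = 0"
  obtain Q where Q: "Q ** P = mat 1" "P ** Q = mat 1" using P by (auto simp: invertible_def)
  have Qt: "transpose P ** transpose Q = mat 1" "transpose Q ** transpose P = mat 1"
    using Q by (metis matrix_transpose_mul transpose_mat)+
  have "contr T (transpose P ** q ** P) = (Q ** P) ** contr T (transpose P ** q ** P) ** (transpose P ** transpose Q)"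
    by (simp add: Q Qt)
  also have "\<dots> = Q ** contr (act P T) q ** transpose Q"
    by (simp add: contr_act matrix_mul_assoc)
  also have "\<dots> = 0" by (simp add: q matrix_matrix_mult_def vec_eq_iff)
  finally have "transpose P ** q ** P = 0" using T symmat_congruence[OF q(1)] by (auto simp: nondeg_def)
  then have "transpose Q ** (transpose P ** q ** P) ** Q = 0" by (simp add: matrix_matrix_mult_def vec_eq_iff)
  then show "q = 0" using Q Qt by (metis matrix_mul_assoc matrix_mul_lid matrix_mul_rid)
qed

text \<open>Brings the apolar conic \<open>D\<close> into a normal form \<open>J\<close>; by
  \<open>rank_le_act_iff\<close> the rank bound is not affected.\<close>

lemma kernel_spanned_by_act:
  assumes P: "invertible P" and D: "D = transpose P ** J ** P" and T: "kernel_spanned_by T D"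
  shows "kernel_spanned_by (act P T) J"
  unfolding kernel_spanned_by_def
proof (intro conjI allI impI)
  have "contr T (transpose P ** J ** P) = 0" using T by (simp add: D[symmetric] kernel_spanned_by_def)
  then have "contr (act P T) J = P ** 0 ** transpose P" by (simp only: contr_act)
  then show "contr (act P T) J = 0" by (simp add: matrix_matrix_mult_def vec_eq_iff)
  fix q assume q: "symmat q" "contr (act P T) q = 0"
  obtain Q where Q: "Q ** P = mat 1" "P ** Q = mat 1" using P by (auto simp: invertible_def)
  have Qt: "transpose P ** transpose Q = mat 1" "transpose Q ** transpose P = mat 1"
    using Q by (metis matrix_transpose_mul transpose_mat)+
  have "contr T (transpose P ** q ** P) = (Q ** P) ** contr T (transpose P ** q ** P) ** (transpose P ** transpose Q)"
    by (simp add: Q Qt)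
  also have "\<dots> = Q ** contr (act P T) q ** transpose Q"
    by (simp add: contr_act matrix_mul_assoc)
  also have "\<dots> = 0" by (simp add: q matrix_matrix_mult_def vec_eq_iff)
  finally obtain c where c: "transpose P ** q ** P = (\<chi> i j. c * D $ i $ j)"
    using T symmat_congruence[OF q(1)] by (auto simp: kernel_spanned_by_def)
  have "q = transpose Q ** (transpose P ** q ** P) ** Q"
    using Q Qt by (metis matrix_mul_assoc matrix_mul_lid matrix_mul_rid)
  also have "\<dots> = (\<chi> i j. c * (transpose Q ** D ** Q) $ i $ j)"
    unfolding c by (simp add: matrix_matrix_mult_def vec_eq_iff sum_3 algebra_simps)
  also have "transpose Q ** D ** Q = J" unfolding D
    using Q Qt by (metis matrix_mul_assoc matrix_mul_lid matrix_mul_rid)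
  finally show "\<exists>c. q = (\<chi> i j. c * J $ i $ j)" by blast
qed

text \<open>Adding the antisymmetric part makes the contraction with a symmetric tensor invertible on
  all matrices exactly when it is invertible on the symmetric ones.\<close>

definition cat_matrix :: "tensor4 \<Rightarrow> complex ^ (3 \<times> 3) ^ (3 \<times> 3)" where
  "cat_matrix T = (\<chi> a b. T (fst b) (snd b) (fst a) (snd a) + (if a = b then 1 else 0)
     - (if a = prod.swap b then 1 else 0))"

lemma sum_prod_3: "(\<Sum>b\<in>(UNIV :: (3 \<times> 3) set). f b) = (\<Sum>i\<in>UNIV. \<Sum>j\<in>UNIV. f (i, j))"
  by (simp add: sum.cartesian_product)

lemma cat_matrix_mult:
  "(cat_matrix T *v x) $ (k, l) = contr T (\<chi> i j. x $ (i, j)) $ k $ l + x $ (k, l) - x $ (l, k)"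
proof -
  have "cat_matrix T $ (k, l) $ b * x $ b = x $ b * T (fst b) (snd b) k l
      + (if b = (k, l) then x $ b else 0) - (if b = (l, k) then x $ b else 0)" for b
  proof -
    obtain i j where "b = (i, j)" by (cases b)
    then show ?thesis by (cases "k = i"; cases "l = j"; cases "k = j"; cases "l = i")
        (simp_all add: cat_matrix_def algebra_simps)
  qed
  then have "(cat_matrix T *v x) $ (k, l) = (\<Sum>b\<in>UNIV. x $ b * T (fst b) (snd b) k l
      + (if b = (k, l) then x $ b else 0) - (if b = (l, k) then x $ b else 0))"
    by (simp add: matrix_vector_mult_def)
  also have "\<dots> = (\<Sum>b\<in>UNIV. x $ b * T (fst b) (snd b) k l) + x $ (k, l) - x $ (l, k)"
    by (simp add: sum.distrib sum_subtractf)
  finally show ?thesis by (simp add: sum_prod_3 contr_def)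
qed

text \<open>The matrix sends \<open>x\<close> to its contraction plus \<open>x\<close> minus its
  transpose. The contraction is symmetric, so a symmetric right-hand side forces the antisymmetric
  part of \<open>x\<close> to vanish.\<close>

lemma cat_matrix_mult_eq:
  assumes T: "sym4 T" and m: "symmat m" and x: "cat_matrix T *v x = (\<chi> a. m $ fst a $ snd a)"
  shows "symmat (\<chi> i j. x $ (i, j)) \<and> contr T (\<chi> i j. x $ (i, j)) = m"
proof -
  let ?c = "contr T (\<chi> i j. x $ (i, j))"
  have eq: "?c $ k $ l + x $ (k, l) - x $ (l, k) = m $ k $ l" for k l
    using cat_matrix_mult[of T x k l] x by simp
  moreover have "?c $ k $ l = ?c $ l $ k" "m $ k $ l = m $ l $ k" for k l
    using symmat_contr[OF T] m unfolding symmat_def by blast+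
  ultimately have eq': "?c $ k $ l + x $ (l, k) - x $ (k, l) = m $ k $ l" for k l by metis
  have sym: "x $ (k, l) = x $ (l, k)" for k l
  proof -
    have "2 * (x $ (k, l) - x $ (l, k)) = (?c $ k $ l + x $ (k, l) - x $ (l, k)) - (?c $ k $ l + x $ (l, k) - x $ (k, l))"
      by simp
    then show ?thesis unfolding eq eq' by simp
  qed
  then show ?thesis using eq by (simp add: symmat_def mat3_eq_iff)
qed

lemma det_cat_matrix_iff_nondeg:
  assumes T: "sym4 T"
  shows "det (cat_matrix T) \<noteq> 0 \<longleftrightarrow> nondeg T"
proof -
  have "nondeg T \<longleftrightarrow> (\<forall>x. cat_matrix T *v x = 0 \<longrightarrow> x = 0)"
  proof (intro iffI allI impI)
    fix x assume T': "nondeg T" and "cat_matrix T *v x = 0"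
    then have "cat_matrix T *v x = (\<chi> a. (0 :: complex ^ 3 ^ 3) $ fst a $ snd a)"
      by (simp add: vec_eq_iff)
    then have "(\<chi> i j. x $ (i, j)) = (0 :: complex ^ 3 ^ 3)"
      using cat_matrix_mult_eq[OF T, of 0 x] T' by (auto simp: nondeg_def symmat_def)
    then show "x = 0" by (auto simp: vec_eq_iff)
  next
    assume ker: "\<forall>x. cat_matrix T *v x = 0 \<longrightarrow> x = 0"
    show "nondeg T" unfolding nondeg_def
    proof (intro allI impI)
      fix q assume q: "symmat q" "contr T q = 0"
      have "(\<chi> i j. q $ i $ j) = q" by (simp add: vec_eq_iff)
      then have "(cat_matrix T *v (\<chi> a. q $ fst a $ snd a)) $ (k, l) = 0" for k l
        using q unfolding cat_matrix_mult by (simp add: symmat_def)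
      then have "cat_matrix T *v (\<chi> a. q $ fst a $ snd a) = 0" by (auto simp: vec_eq_iff)
      then have "(\<chi> a. q $ fst a $ snd a) = (0 :: complex ^ (3 \<times> 3))" using ker by blast
      then show "q = 0" by (auto simp: vec_eq_iff)
    qed
  qed
  then show ?thesis
    by (simp add: invertible_det_nz[symmetric] invertible_left_inverse matrix_left_invertible_ker)
qed

lemma nondeg_solve:
  assumes T: "sym4 T" "nondeg T" and m: "symmat m"
  obtains q where "symmat q" "contr T q = m"
proof -
  have "invertible (cat_matrix T)" using det_cat_matrix_iff_nondeg T by (simp add: invertible_det_nz)
  then obtain B where "cat_matrix T ** B = mat 1" by (auto simp: invertible_def)
  then have "cat_matrix T *v (B *v (\<chi> a. m $ fst a $ snd a)) = (\<chi> a. m $ fst a $ snd a)"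
    by (simp add: matrix_vector_mul_assoc)
  then show ?thesis using cat_matrix_mult_eq[OF T(1) m] that by blast
qed

text \<open>The coefficient \<open>1 / conic_at q v\<close> is the one that makes \<open>q\<close>
  apolar, as the fourth power of \<open>v\<close> contracts \<open>q\<close> to
  \<open>conic_at q v\<close> times the square of \<open>v\<close>. Any other conic apolar to the
  difference is contracted by \<open>T\<close> to a multiple of that square, hence is a multiple of
  \<open>q\<close> by injectivity.\<close>

lemma kernel_after_peeling:
  assumes T: "nondeg T" and q: "symmat q" "contr T q = (\<chi> k l. v $ k * v $ l)"
    and b: "conic_at q v \<noteq> 0"
  shows "kernel_spanned_by (\<lambda>i j k l. T i j k l - 1 / conic_at q v * pow4 v i j k l) q"
  unfolding kernel_spanned_by_def
proof (intro conjI allI impI)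
  let ?T = "\<lambda>i j k l. T i j k l - 1 / conic_at q v * pow4 v i j k l"
  show "contr ?T q = 0" unfolding contr_diff_pow4 using q b by (simp add: vec_eq_iff)
  fix p assume p: "symmat p" "contr ?T p = 0"
  define c where "c = conic_at p v / conic_at q v"
  have "contr T p $ k $ l = c * v $ k * v $ l" for k l
    using p(2)[unfolded contr_diff_pow4] by (simp add: mat3_eq_iff c_def)
  then have "contr T (\<chi> i j. 1 * p $ i $ j + (- c) * q $ i $ j) = 0"
    unfolding contr_linear q by (simp add: mat3_eq_iff)
  moreover have "symmat (\<chi> i j. 1 * p $ i $ j + (- c) * q $ i $ j)"
    using p q by (simp add: symmat_def)
  ultimately have "(\<chi> i j. 1 * p $ i $ j + (- c) * q $ i $ j) = (0 :: complex ^ 3 ^ 3)"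
    using T unfolding nondeg_def by blast
  then have "p = (\<chi> i j. c * q $ i $ j)" by (simp add: vec_eq_iff)
  then show "\<exists>c. p = (\<chi> i j. c * q $ i $ j)" by blast
qed

subsection \<open>Quartics apolar to a reduced conic\<close>

text \<open>The conic \<open>x1 x3 = x2^2\<close>, parametrised by
  \<open>(1, r, r^2)\<close>.\<close>

definition smooth_conic :: "complex ^ 3 ^ 3" where
  "smooth_conic = vector [vector [0, 0, 1/2], vector [0, -1, 0], vector [1/2, 0, 0]]"

text \<open>The pair of lines \<open>x1 x2 = 0\<close>, with node at the third unit vector.\<close>

definition nodal_conic :: "complex ^ 3 ^ 3" where
  "nodal_conic = vector [vector [0, 1/2, 0], vector [1/2, 0, 0], vector [0, 0, 0]]"

lemma moment_mult_monom:
  assumes "degree p \<le> n"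
  shows "moment s (p * monom 1 i) = (\<Sum>j\<le>n. coeff p j * s (i + j))"
  using moment_mult_sum[OF assms, of s "monom 1 i"]
  by (simp add: mult.commute[of p] mult_monom moment_monom)

lemma nat_le_4_sum: "(\<Sum>j\<le>4. f j) = f 0 + f 1 + f 2 + f 3 + f (4::nat)"
  by (simp add: eval_nat_numeral)

lemma nat_le_2_sum: "(\<Sum>j\<le>2. f j) = f 0 + f 1 + f (2::nat)"
  by (simp add: eval_nat_numeral)

text \<open>Apolarity identifies the index pair 1 3 with 2 2, so an entry of \<open>T\<close>
  depends only on the total weight of its indices, where 1, 2, 3 have weights 0, 1, 2. These nine
  values are the moments of a binary octic, and nodes \<open>r\<close> correspond to the points
  \<open>(1, r, r^2)\<close> of the conic.\<close>

lemma rank_le_smooth_conic: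
  assumes T: "sym4 T" and ker: "kernel_spanned_by T smooth_conic"
  shows "rank_le 5 T"
proof -
  define s where "s n = [T 1 1 1 1, T 1 1 1 2, T 1 1 2 2, T 1 2 2 2, T 2 2 2 2,
      T 2 2 2 3, T 2 2 3 3, T 2 3 3 3, T 3 3 3 3] ! n" for n
  define wt :: "3 \<Rightarrow> nat" where "wt i = (if i = 1 then 0 else if i = 2 then 1 else 2)" for i
  note sort = sym4_sort[OF T]
  have "T 1 3 k l = T 2 2 k l" for k l
    using ker by (auto simp: kernel_spanned_by_def mat3_eq_iff contr_def smooth_conic_def sum_3 sort
        dest!: spec[of _ k] spec[of _ l])
  from this[of 1 1] this[of 1 2] this[of 1 3] this[of 2 2] this[of 2 3] this[of 3 3]
  have T13: "T 1 1 1 3 = T 1 1 2 2" "T 1 1 2 3 = T 1 2 2 2" "T 1 1 3 3 = T 1 2 2 3"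
    "T 1 2 2 3 = T 2 2 2 2" "T 1 2 3 3 = T 2 2 2 3" "T 1 3 3 3 = T 2 2 3 3"
    by (simp_all add: sort)
  have "\<forall>i j k l. T i j k l = s (wt i + wt j + wt k + wt l)"
    by (simp add: forall_3 s_def wt_def sort T13)
  then have Ts: "T i j k l = s (wt i + wt j + wt k + wt l)" for i j k l by blast
  have "\<exists>S w. finite S \<and> card S = 5 \<and> (\<forall>n \<le> 2 * 5 - 2. s n = (\<Sum>r\<in>S. w r * r ^ n))"
  proof (rule gaussian_quadrature)
    fix p :: "complex poly" assume p: "degree p < 5" "\<And>i. i < 5 \<Longrightarrow> moment s (p * monom 1 i) = 0"
    define c where "c = coeff p"
    have eq: "c 0 * s i + c 1 * s (i + 1) + c 2 * s (i + 2) + c 3 * s (i + 3) + c 4 * s (i + 4) = 0"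
      if "i < 5" for i
      using p(2)[OF that] moment_mult_monom[of p 4 s i] p(1) by (simp add: nat_le_4_sum c_def)
    \<comment> \<open>A conic that restricts to \<open>p\<close> on the curve
      \<open>(1, r, r^2)\<close>. Such a lift is unique up to multiples of
      \<open>smooth_conic\<close>; placing the quadratic term in the entry \<open>(2, 2)\<close> and
      0 in \<open>(1, 3)\<close> excludes the nonzero multiples.\<close>
    define q :: "complex ^ 3 ^ 3" where
      "q = vector [vector [c 0, c 1 / 2, 0], vector [c 1 / 2, c 2, c 3 / 2], vector [0, c 3 / 2, c 4]]"
    have "contr T q $ k $ l = c 0 * s (wt k + wt l) + c 1 * s (wt k + wt l + 1) + c 2 * s (wt k + wt l + 2)
        + c 3 * s (wt k + wt l + 3) + c 4 * s (wt k + wt l + 4)" for k l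
      by (simp add: contr_def q_def sum_3 Ts wt_def[of 1] wt_def[of 2] wt_def[of 3] add_ac eval_nat_numeral)
    moreover have "wt k + wt l < 5" for k l by (simp add: wt_def)
    ultimately have "contr T q = 0" using eq by (simp add: mat3_eq_iff)
    moreover have "symmat q" by (simp add: symmat_def forall_3 q_def)
    ultimately obtain d where d: "q = (\<chi> i j. d * smooth_conic $ i $ j)"
      using ker by (auto simp: kernel_spanned_by_def)
    have "q $ 1 $ 3 = 0" by (simp add: q_def)
    then have "d = 0" by (simp add: d smooth_conic_def)
    then have "q = 0" by (simp add: d vec_eq_iff)
    then have "c 0 = 0 \<and> c 1 = 0 \<and> c 2 = 0 \<and> c 3 = 0 \<and> c 4 = 0"
      by (auto simp: q_def vec_eq_iff forall_3)
    moreover have "c n = 0" if "n \<ge> 5" for n using p(1) that by (simp add: c_def coeff_eq_0)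
    ultimately have "c n = 0" for n
      by (cases "n \<ge> 5") (auto simp: not_le less_Suc_eq eval_nat_numeral)
    then show "p = 0" by (simp add: poly_eq_iff c_def)
  qed simp
  then obtain S w where S: "finite S" "card S = 5" "\<And>n. n \<le> 8 \<Longrightarrow> s n = (\<Sum>r\<in>S. w r * r ^ n)" by auto
  have vr: "(vector [1, r, r\<^sup>2] :: complex ^ 3) $ i = r ^ wt i" for r i
    using exhaust_3[of i] by (auto simp: wt_def)
  have "T i j k l = (\<Sum>r\<in>S. w r * pow4 (vector [1, r, r\<^sup>2]) i j k l)" for i j k l
  proof -
    have "wt i + wt j + wt k + wt l \<le> 8" by (simp add: wt_def)
    from S(3)[OF this] show ?thesis by (simp add: Ts pow4_def vr power_add mult_ac)
  qed
  from rank_le_sum[OF S(1) this] show ?thesis by (simp add: S(2))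
qed

section \<open>Binary quartics on the two lines of the nodal conic\<close>

definition arm_tensor :: "3 \<Rightarrow> (nat \<Rightarrow> complex) \<Rightarrow> tensor4" where
  "arm_tensor a s i j k l = (if {i, j, k, l} \<subseteq> {a, 3}
     then s (of_bool (i = a) + of_bool (j = a) + of_bool (k = a) + of_bool (l = a)) else 0)"

text \<open>The parameter \<open>t\<close> stands in place of \<open>T 3 3 3 3\<close>, the entry at
  the node, which both lines share and which may be divided between them at will.\<close>

definition arm_moments :: "tensor4 \<Rightarrow> 3 \<Rightarrow> complex \<Rightarrow> nat \<Rightarrow> complex" where
  "arm_moments T a t n = [t, T a 3 3 3, T a a 3 3, T a a a 3, T a a a a] ! n"

definition hankel_kernel :: "(nat \<Rightarrow> complex) \<Rightarrow> complex \<Rightarrow> complex \<Rightarrow> complex \<Rightarrow> bool" where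
  "hankel_kernel s a b c \<longleftrightarrow> a * s 0 + b * s 1 + c * s 2 = 0 \<and>
     a * s 1 + b * s 2 + c * s 3 = 0 \<and> a * s 2 + b * s 3 + c * s 4 = 0"

lemma arm_moments_simps [simp]:
  "arm_moments T a t 0 = t" "arm_moments T a t (Suc 0) = T a 3 3 3" "arm_moments T a t 2 = T a a 3 3"
  "arm_moments T a t 3 = T a a a 3" "arm_moments T a t 4 = T a a a a"
  by (simp_all add: arm_moments_def)

lemma rank_le_arm_tensor:
  assumes "finite S" and s: "\<And>n. n \<le> 4 \<Longrightarrow> s n = (\<Sum>r\<in>S. w r * r ^ n)" and a: "a \<noteq> 3"
  shows "rank_le (card S) (arm_tensor a s)"
proof (rule rank_le_sum[OF assms(1)])
  fix i j k l :: 3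
  let ?v = "\<lambda>r. (\<chi> i. if i = a then r else if i = 3 then 1 else 0) :: complex ^ 3"
  have v: "?v r $ i = (if i \<in> {a, 3} then r ^ of_bool (i = a) else 0)" for r i
    by simp
  have "pow4 (?v r) i j k l = (if {i, j, k, l} \<subseteq> {a, 3}
      then r ^ (of_bool (i = a) + of_bool (j = a) + of_bool (k = a) + of_bool (l = a)) else 0)" for r
    unfolding pow4_def v power_add by simp
  moreover have "of_bool (i = a) + of_bool (j = a) + of_bool (k = a) + of_bool (l = a) \<le> (4::nat)"
    by (simp add: of_bool_def)
  ultimately show "arm_tensor a s i j k l = (\<Sum>r\<in>S. w r * pow4 (?v r) i j k l)"
    by (simp add: arm_tensor_def s)
qed

text \<open>The other affine chart of the line, with moments read backwards. It is needed when the
  quadratic that supplies the nodes may have one of them at infinity in the first chart.\<close>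

lemma rank_le_arm_tensor_rev:
  assumes "finite S" and s: "\<And>n. n \<le> 4 \<Longrightarrow> s (4 - n) = (\<Sum>r\<in>S. w r * r ^ n)" and a: "a \<noteq> 3"
  shows "rank_le (card S) (arm_tensor a s)"
proof (rule rank_le_sum[OF assms(1)])
  fix i j k l :: 3
  let ?v = "\<lambda>r. (\<chi> i. if i = a then 1 else if i = 3 then r else 0) :: complex ^ 3"
  have v: "?v r $ i = (if i \<in> {a, 3} then r ^ of_bool (i \<noteq> a) else 0)" for r i
    by simp
  have "pow4 (?v r) i j k l = (if {i, j, k, l} \<subseteq> {a, 3}
      then r ^ (of_bool (i \<noteq> a) + of_bool (j \<noteq> a) + of_bool (k \<noteq> a) + of_bool (l \<noteq> a)) else 0)" for r
    unfolding pow4_def v power_add by simp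
  moreover have "of_bool (i = a) + of_bool (j = a) + of_bool (k = a) + of_bool (l = a)
      = 4 - (of_bool (i \<noteq> a) + of_bool (j \<noteq> a) + of_bool (k \<noteq> a) + of_bool (l \<noteq> a) :: nat)"
    "of_bool (i \<noteq> a) + of_bool (j \<noteq> a) + of_bool (k \<noteq> a) + of_bool (l \<noteq> a) \<le> (4 :: nat)"
    by (simp_all add: of_bool_def)
  ultimately show "arm_tensor a s i j k l = (\<Sum>r\<in>S. w r * pow4 (?v r) i j k l)"
    by (simp add: arm_tensor_def s)
qed

lemma nodal_contr:
  assumes T: "sym4 T" and K: "contr T nodal_conic = 0"
  shows "T 1 1 1 2 = 0" "T 1 1 2 2 = 0" "T 1 1 2 3 = 0" "T 1 2 2 2 = 0" "T 1 2 2 3 = 0" "T 1 2 3 3 = 0"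
proof -
  have "T 1 2 k l = 0" for k l
  proof -
    have "contr T nodal_conic $ k $ l = 0" using K by simp
    then show ?thesis by (simp add: contr_def nodal_conic_def sum_3 sym4_sort[OF T])
  qed
  from this[of 1 1] this[of 1 2] this[of 1 3] this[of 2 2] this[of 2 3] this[of 3 3]
  show "T 1 1 1 2 = 0" "T 1 1 2 2 = 0" "T 1 1 2 3 = 0" "T 1 2 2 2 = 0" "T 1 2 2 3 = 0" "T 1 2 3 3 = 0"
    by (simp_all add: sym4_sort[OF T])
qed

text \<open>Entries containing both indices 1 and 2 vanish, so every other entry belongs to one
  line, except that at the node, to which the arms contribute \<open>t\<close> and
  \<open>T 3 3 3 3 - t\<close>.\<close>

lemma split_into_arms:
  assumes T: "sym4 T" and K: "contr T nodal_conic = 0"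
  shows "T = (\<lambda>i j k l. arm_tensor 1 (arm_moments T 1 t) i j k l
    + arm_tensor 2 (arm_moments T 2 (T 3 3 3 3 - t)) i j k l)"
proof -
  note sort = sym4_sort[OF T] and nc = nodal_contr[OF T K]
  have "\<forall>i j k l. T i j k l = arm_tensor 1 (arm_moments T 1 t) i j k l
    + arm_tensor 2 (arm_moments T 2 (T 3 3 3 3 - t)) i j k l"
    by (simp add: forall_3 arm_tensor_def sort nc
          arm_moments_def numeral_eq_Suc)
  then show ?thesis by (intro ext) blast
qed

lemma quadrature_3:
  assumes "\<And>a b c. hankel_kernel s a b c \<Longrightarrow> a = 0 \<and> b = 0 \<and> c = 0"
  shows "\<exists>S w. finite S \<and> card S = 3 \<and> (\<forall>n\<le>4. s n = (\<Sum>r\<in>S. w r * r ^ n))"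
proof -
  have "\<exists>S w. finite S \<and> card S = 3 \<and> (\<forall>n \<le> 2 * 3 - 2. s n = (\<Sum>r\<in>S. w r * r ^ n))"
  proof (rule gaussian_quadrature)
    fix p :: "complex poly" assume p: "degree p < 3" "\<And>i. i < 3 \<Longrightarrow> moment s (p * monom 1 i) = 0"
    have "coeff p 0 * s i + coeff p 1 * s (i + 1) + coeff p 2 * s (i + 2) = 0" if "i < 3" for i
      using p(2)[OF that] moment_mult_monom[of p 2 s i] p(1) by (simp add: nat_le_2_sum)
    from this[of 0] this[of 1] this[of 2]
    have "hankel_kernel s (coeff p 0) (coeff p 1) (coeff p 2)"
      by (simp add: hankel_kernel_def numeral_eq_Suc)
    then have "coeff p 0 = 0 \<and> coeff p 1 = 0 \<and> coeff p 2 = 0" using assms by blast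
    moreover have "coeff p n = 0" if "n \<ge> 3" for n using p(1) that by (simp add: coeff_eq_0)
    ultimately have "coeff p n = 0" for n
      by (cases "n \<ge> 3") (auto simp: not_le less_Suc_eq numeral_eq_Suc)
    then show "p = 0" by (simp add: poly_eq_iff)
  qed simp
  then show ?thesis by simp
qed

text \<open>A kernel vector with constant term 0 does not see \<open>t\<close>, so
  \<open>b x_a x_3 + c x_a^2\<close> is a conic apolar to \<open>T\<close> itself. It must be a
  multiple of \<open>x1 x2\<close>, hence zero.\<close>

lemma arm_kernel_affine_zero:
  assumes T: "sym4 T" and ker: "kernel_spanned_by T nodal_conic" and a: "a = 1 \<or> a = 2"
    and h: "hankel_kernel (arm_moments T a t) 0 b c"
  shows "b = 0 \<and> c = 0"
proof -
  have K: "contr T nodal_conic = 0" using ker by (simp add: kernel_spanned_by_def)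
  note sort = sym4_sort[OF T] and nc = nodal_contr[OF T K]
  define q :: "complex ^ 3 ^ 3" where
    "q = (\<chi> i j. if i = a \<and> j = a then c else if i = a \<and> j = 3 \<or> i = 3 \<and> j = a then b / 2 else 0)"
  have h': "b * T a 3 3 3 + c * T a a 3 3 = 0" "b * T a a 3 3 + c * T a a a 3 = 0"
    "b * T a a a 3 + c * T a a a a = 0"
    using h by (simp_all add: hankel_kernel_def)
  have a3: "a \<noteq> 3" using a by auto
  have "contr T q $ k $ l = c * T a a k l + b * T a 3 k l" for k l
    using a by (auto simp: contr_def q_def sum_3 sort algebra_simps)
  then have "contr T q = 0"
    using a h' by (auto simp: mat3_eq_iff forall_3 sort nc algebra_simps)
  moreover have "symmat q" by (auto simp: symmat_def q_def)
  ultimately obtain d where d: "q = (\<chi> i j. d * nodal_conic $ i $ j)"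
    using ker by (auto simp: kernel_spanned_by_def)
  have "q $ a $ a = 0" "q $ a $ 3 = 0" using a by (auto simp: d nodal_conic_def)
  then show ?thesis using a3 by (simp add: q_def)
qed

text \<open>The Hankel matrices for \<open>t\<close> and \<open>t'\<close> differ only in the
  corner. Pairing each kernel vector with the other matrix gives
  \<open>(t' - t) * x * x' = 0\<close>.\<close>

lemma arm_kernel_unique:
  assumes T: "sym4 T" and ker: "kernel_spanned_by T nodal_conic" and a: "a = 1 \<or> a = 2"
    and h: "hankel_kernel (arm_moments T a t) x y z" "x \<noteq> 0"
    and h': "hankel_kernel (arm_moments T a t') x' y' z'" and t: "t \<noteq> t'"
  shows "x' = 0 \<and> y' = 0 \<and> z' = 0"
proof -
  have "(t' - t) * x * x' = 0"
    using h(1) h' unfolding hankel_kernel_def arm_moments_simps One_nat_def by algebra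
  then have "x' = 0" using h(2) t by simp
  then show ?thesis using arm_kernel_affine_zero[OF T ker a] h' by simp
qed

text \<open>At most one value of \<open>t\<close> makes the Hankel matrix of an arm singular, so a
  splitting that avoids the bad value on both arms exists.\<close>

lemma finite_bad_arm_parameters:
  assumes T: "sym4 T" and ker: "kernel_spanned_by T nodal_conic" and a: "a = 1 \<or> a = 2"
  shows "finite {t. \<exists>x y z. hankel_kernel (arm_moments T a t) x y z \<and> \<not> (x = 0 \<and> y = 0 \<and> z = 0)}"
    (is "finite ?B")
proof (cases "?B = {}")
  case False
  then obtain t x y z where t: "hankel_kernel (arm_moments T a t) x y z" "\<not> (x = 0 \<and> y = 0 \<and> z = 0)" by blast
  have "x \<noteq> 0" using arm_kernel_affine_zero[OF T ker a] t by blast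
  then have "?B \<subseteq> {t}" using arm_kernel_unique[OF T ker a t(1)] by blast
  then show ?thesis by (rule finite_subset) simp
qed (metis finite.emptyI)

lemma rank_le_nodal_conic:
  assumes T: "sym4 T" and ker: "kernel_spanned_by T nodal_conic"
  shows "rank_le 6 T"
proof -
  let ?B = "\<lambda>a. {t. \<exists>x y z. hankel_kernel (arm_moments T a t) x y z \<and> \<not> (x = 0 \<and> y = 0 \<and> z = 0)}"
  have "finite (?B 1 \<union> (\<lambda>t. T 3 3 3 3 - t) ` ?B 2)"
    using finite_bad_arm_parameters[OF T ker] by simp
  from ex_new_if_finite[OF infinite_UNIV_char_0 this]
  obtain t where t: "t \<notin> ?B 1 \<union> (\<lambda>t. T 3 3 3 3 - t) ` ?B 2" ..
  have t1: "t \<notin> ?B 1" using t by simp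
  have t2: "T 3 3 3 3 - t \<notin> ?B 2"
  proof
    assume "T 3 3 3 3 - t \<in> ?B 2"
    then have "T 3 3 3 3 - (T 3 3 3 3 - t) \<in> (\<lambda>t. T 3 3 3 3 - t) ` ?B 2" by (rule imageI)
    then show False using t by (simp only: diff_diff_eq2 add_diff_cancel_left' Un_iff) simp
  qed
  have K: "contr T nodal_conic = 0" using ker by (simp add: kernel_spanned_by_def)
  obtain S w where S: "finite S" "card S = 3" "\<forall>n\<le>4. arm_moments T 1 t n = (\<Sum>r\<in>S. w r * r ^ n)"
    using quadrature_3[of "arm_moments T 1 t"] t1 by auto
  obtain S' w' where S': "finite S'" "card S' = 3"
    "\<forall>n\<le>4. arm_moments T 2 (T 3 3 3 3 - t) n = (\<Sum>r\<in>S'. w' r * r ^ n)"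
    using quadrature_3[of "arm_moments T 2 (T 3 3 3 3 - t)"] t2 by auto
  have "rank_le 3 (arm_tensor 1 (arm_moments T 1 t))"
    using rank_le_arm_tensor[OF S(1), of _ w 1] S by auto
  moreover have "rank_le 3 (arm_tensor 2 (arm_moments T 2 (T 3 3 3 3 - t)))"
    using rank_le_arm_tensor[OF S'(1), of _ w' 2] S' by auto
  ultimately have "rank_le (3 + 3) (\<lambda>i j k l. arm_tensor 1 (arm_moments T 1 t) i j k l
    + arm_tensor 2 (arm_moments T 2 (T 3 3 3 3 - t)) i j k l)"
    by (rule rank_le_add)
  then show ?thesis unfolding split_into_arms[OF T K, symmetric] by simp
qed

subsection \<open>Normal forms of conics\<close>

lemma complex_sqrt_exists: "\<exists>s :: complex. s\<^sup>2 = z"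
  by (metis power2_csqrt)

text \<open>A conic without the coordinate \<open>k\<close> is a binary quadratic form, and the
  quadratic formula factors it.\<close>

lemma binary_form_splits:
  assumes q: "symmat q" and k: "\<And>j. q $ k $ j = 0" and all: "\<And>i. i = k \<or> i = m \<or> i = n"
    and dist: "k \<noteq> m" "k \<noteq> n" "m \<noteq> n"
  shows "\<exists>a c. q = line_pair a c"
proof (cases "q $ m $ m = 0")
  case True
  define a c :: "complex ^ 3" where "a = (\<chi> i. if i = n then 1 else 0)"
    and "c = (\<chi> i. if i = m then 2 * q $ m $ n else if i = n then q $ n $ n else 0)"
  have "q $ i $ j = line_pair a c $ i $ j" for i j
    using all[of i] all[of j] dist k[of i] k[of j] q True
    by (auto simp: line_pair_def a_def c_def symmat_def)
  then show ?thesis by (auto simp: mat3_eq_iff)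
next
  case False
  obtain s where s: "s\<^sup>2 = (q $ m $ n)\<^sup>2 - q $ m $ m * q $ n $ n" using complex_sqrt_exists by blast
  define a c :: "complex ^ 3" where "a = (\<chi> i. if i = m then q $ m $ m else if i = n then q $ m $ n - s else 0)"
    and "c = (\<chi> i. if i = m then 1 else if i = n then (q $ m $ n + s) / q $ m $ m else 0)"
  have s': "(q $ m $ n - s) * (q $ m $ n + s) = q $ m $ m * q $ n $ n"
    using s by (simp add: power2_eq_square algebra_simps)
  have "line_pair a c $ n $ n = q $ n $ n"
    using dist False s' by (simp add: line_pair_def a_def c_def)
  moreover have "line_pair a c $ m $ n = q $ m $ n" "line_pair a c $ n $ m = q $ m $ n"
    "line_pair a c $ m $ m = q $ m $ m"
    using dist False by (simp_all add: line_pair_def a_def c_def)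
  moreover have "line_pair a c $ k $ j = 0" "line_pair a c $ j $ k = 0" for j
    using dist by (simp_all add: line_pair_def a_def c_def)
  ultimately have "q $ i $ j = line_pair a c $ i $ j" for i j
    using all[of i] all[of j] k[of i] k[of j] q by (auto simp: symmat_def)
  then show ?thesis by (auto simp: mat3_eq_iff)
qed

text \<open>The target \<open>a c - b^2\<close> has the shape of \<open>smooth_conic\<close>.
  Completing the square at a nonzero diagonal entry removes a coordinate, and the remaining binary
  form factors; conics with zero diagonal are handled directly.\<close>

lemma conic_decomposition:
  assumes q: "symmat q"
  shows "\<exists>a b c. q = (\<chi> i j. line_pair a c $ i $ j - b $ i * b $ j)"
proof (cases "\<exists>k. q $ k $ k \<noteq> 0")
  case True
  then obtain k where k: "q $ k $ k \<noteq> 0" by blast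
  obtain m n where mn: "\<And>i. i = k \<or> i = m \<or> i = n" "k \<noteq> m" "k \<noteq> n" "m \<noteq> n"
  proof -
    have e: "i = 1 \<or> i = 2 \<or> i = 3" for i :: 3 by (rule exhaust_3)
    consider "k = 1" | "k = 2" | "k = 3" using e by blast
    then show ?thesis
    proof cases
      case 1 show ?thesis by (rule that[of 2 3]) (use e 1 in \<open>simp_all\<close>)
    next
      case 2 show ?thesis by (rule that[of 1 3]) (use e 2 in \<open>auto\<close>)
    next
      case 3 show ?thesis by (rule that[of 1 2]) (use e 3 in \<open>auto\<close>)
    qed
  qed
  obtain s where s: "s\<^sup>2 = - q $ k $ k" using complex_sqrt_exists by blast
  define b :: "complex ^ 3" where "b = (\<chi> i. s * q $ k $ i / q $ k $ k)"
  have bb: "b $ i * b $ j = - q $ k $ i * q $ k $ j / q $ k $ k" for i j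
  proof -
    have "b $ i * b $ j = s\<^sup>2 * q $ k $ i * q $ k $ j / (q $ k $ k)\<^sup>2"
      by (simp add: b_def power2_eq_square)
    then show ?thesis unfolding s using k by (simp add: power2_eq_square)
  qed
  define q' :: "complex ^ 3 ^ 3" where "q' = (\<chi> i j. q $ i $ j + b $ i * b $ j)"
  have "symmat q'" using q by (simp add: symmat_def q'_def mult.commute)
  moreover have "q' $ k $ j = 0" for j using k by (simp add: q'_def bb)
  ultimately obtain a c where "q' = line_pair a c" using binary_form_splits mn by blast
  then have "q = (\<chi> i j. line_pair a c $ i $ j - b $ i * b $ j)" by (simp add: q'_def vec_eq_iff eq_diff_eq)
  then show ?thesis by blast
next
  case False
  then have d: "q $ 1 $ 1 = 0" "q $ 2 $ 2 = 0" "q $ 3 $ 3 = 0" by auto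
  have s: "q $ 2 $ 1 = q $ 1 $ 2" "q $ 3 $ 1 = q $ 1 $ 3" "q $ 3 $ 2 = q $ 2 $ 3"
    using q by (auto simp: symmat_def)
  show ?thesis
  proof (cases "q $ 1 $ 2 = 0")
    case True
    then have "q = (\<chi> i j. line_pair (vector [0, 0, 2]) (vector [q $ 1 $ 3, q $ 2 $ 3, 0]) $ i $ j
        - (0 :: complex ^ 3) $ i * (0 :: complex ^ 3) $ j)"
      by (simp add: mat3_eq_iff forall_3 line_pair_def d s)
    then show ?thesis by blast
  next
    case False
    \<comment> \<open>The product of \<open>2 q12 x1 + 2 q23 x3\<close> and
      \<open>x2 + (q13 / q12) x3\<close> exceeds the conic by exactly this multiple of
      \<open>x3^2\<close>.\<close>
    obtain t where t: "t\<^sup>2 = 2 * q $ 1 $ 3 * q $ 2 $ 3 / q $ 1 $ 2" using complex_sqrt_exists by blast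
    have "q = (\<chi> i j. line_pair (vector [2 * q $ 1 $ 2, 0, 2 * q $ 2 $ 3])
        (vector [0, 1, q $ 1 $ 3 / q $ 1 $ 2]) $ i $ j
        - (vector [0, 0, t] :: complex ^ 3) $ i * (vector [0, 0, t] :: complex ^ 3) $ j)"
      using False t by (simp add: mat3_eq_iff forall_3 line_pair_def d s power2_eq_square)
    then show ?thesis by blast
  qed
qed

text \<open>Write \<open>q = a c - b^2\<close>. Independent forms \<open>a\<close>,
  \<open>b\<close>, \<open>c\<close> are the coordinates that yield \<open>smooth_conic\<close>; a
  linear dependence makes \<open>q\<close> a form in two of them, which factors.\<close>

lemma conic_normal_form:
  assumes q: "symmat q"
  shows "(\<exists>P. invertible P \<and> q = transpose P ** smooth_conic ** P) \<or> (\<exists>a b. q = line_pair a b)"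
proof -
  obtain a b c where q': "q = (\<chi> i j. line_pair a c $ i $ j - b $ i * b $ j)"
    using conic_decomposition[OF q] by blast
  then have qe: "q $ i $ j = (a $ i * c $ j + a $ j * c $ i) / 2 - b $ i * b $ j" for i j
    by (simp add: line_pair_def)
  define P :: "complex ^ 3 ^ 3" where "P = vector [a, b, c]"
  show ?thesis
  proof (cases "invertible P")
    case True
    have "q = transpose P ** smooth_conic ** P"
      by (simp add: mat3_eq_iff qe P_def smooth_conic_def matrix_matrix_mult_def transpose_def sum_3 field_simps)
    with True show ?thesis by blast
  next
    case False
    then have "\<not> invertible (transpose P)" by (simp add: invertible_det_nz)
    then obtain x where x: "transpose P *v x = 0" "x \<noteq> 0"
      by (auto simp: invertible_left_inverse matrix_left_invertible_ker)
    have rel: "x $ 1 * a $ i + x $ 2 * b $ i + x $ 3 * c $ i = 0" for i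
    proof -
      have "(transpose P *v x) $ i = 0" using x by simp
      then show ?thesis by (simp add: P_def transpose_def matrix_vector_mult_def sum_3 algebra_simps)
    qed
    have "\<exists>a b. q = line_pair a b"
    proof (cases "x $ 3 = 0")
      case False
      define l m where "l = - x $ 1 / x $ 3" and "m = - x $ 2 / x $ 3"
      have c: "c $ i = l * a $ i + m * b $ i" for i
        using rel[of i] False by (simp add: l_def m_def field_simps eq_neg_iff_add_eq_0)
      \<comment> \<open>A square root of the discriminant of
        \<open>l a^2 + m a b - b^2\<close>.\<close>
      obtain s where s: "s\<^sup>2 = m\<^sup>2 + 4 * l" using complex_sqrt_exists by blast
      define u w :: "complex ^ 3" where "u = (\<chi> i. (m + s) / 2 * a $ i - b $ i)"
        and "w = (\<chi> i. b $ i - (m - s) / 2 * a $ i)"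
      have "q $ i $ j = line_pair u w $ i $ j" for i j
      proof -
        have "line_pair u w $ i $ j = (s\<^sup>2 - m\<^sup>2) / 4 * (a $ i * a $ j)
            + m * (a $ i * b $ j + a $ j * b $ i) / 2 - b $ i * b $ j"
          by (simp add: line_pair_def u_def w_def power2_eq_square field_simps)
        also have "s\<^sup>2 - m\<^sup>2 = 4 * l" using s by simp
        finally show ?thesis by (simp add: qe c algebra_simps add_divide_distrib)
      qed
      then show ?thesis by (auto simp: mat3_eq_iff)
    next
      case x3: True
      show ?thesis
      proof (cases "x $ 2 = 0")
        case False
        define t where "t = - x $ 1 / x $ 2"
        have b: "b $ i = t * a $ i" for i
          using rel[of i] False x3 by (simp add: t_def field_simps eq_neg_iff_add_eq_0)
        have "q = line_pair a (\<chi> i. c $ i - t\<^sup>2 * a $ i)"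
          by (simp add: mat3_eq_iff qe b line_pair_def power2_eq_square field_simps)
        then show ?thesis by blast
      next
        case True
        then have "x $ 1 \<noteq> 0" using x(2) x3 by (auto simp: vec_eq_iff forall_3)
        then have "a $ i = 0" for i using rel[of i] x3 True by simp
        then have "q = line_pair b (\<chi> i. - b $ i)"
          by (simp add: mat3_eq_iff qe line_pair_def)
        then show ?thesis by blast
      qed
    qed
    then show ?thesis by blast
  qed
qed

lemma det_line_pair: "det (line_pair a b) = 0"
  by (simp add: det_3 line_pair_def field_simps)

subsection \<open>Nondegenerate quartics\<close>

lemma rank_le_peeled:
  assumes "rank_le n (\<lambda>i j k l. T i j k l - c * pow4 v i j k l)"
  shows "rank_le (Suc n) T"
  using rank_le_add[OF assms rank_le_pow4[of c v]] by simp

lemma rank_le_nondeg_smooth: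
  assumes T: "sym4 T" "nondeg T" and q: "symmat q" "contr T q = (\<chi> k l. v $ k * v $ l)"
    and b: "conic_at q v \<noteq> 0" and d: "det q \<noteq> 0"
  shows "rank_le 6 T"
proof -
  obtain P where P: "invertible P" "q = transpose P ** smooth_conic ** P"
    using conic_normal_form[OF q(1)] d det_line_pair by auto
  let ?T = "\<lambda>i j k l. T i j k l - 1 / conic_at q v * pow4 v i j k l"
  have "kernel_spanned_by (act P ?T) smooth_conic"
    using kernel_spanned_by_act[OF P] kernel_after_peeling[OF T(2) q b] by blast
  then have "rank_le 5 ?T"
    using rank_le_smooth_conic sym4_act sym4_diff_pow4[OF T(1)] rank_le_act_iff[OF P(1)] by blast
  from rank_le_peeled[OF this] show ?thesis by (simp add: eval_nat_numeral)
qed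

text \<open>The dual conic of \<open>v + e u\<close>, expanded in \<open>e\<close>:
  \<open>q0\<close>, \<open>q1\<close> and \<open>q2\<close> are dual to \<open>v^2\<close>,
  \<open>v u\<close> and \<open>u^2\<close>.\<close>

lemma contr_perturbed:
  assumes "contr T q0 = (\<chi> k l. v $ k * v $ l)" "contr T q1 = line_pair v u"
    "contr T q2 = (\<chi> k l. u $ k * u $ l)"
  shows "contr T (\<chi> i j. q0 $ i $ j + e * (2 * q1 $ i $ j + e * q2 $ i $ j))
    = (\<chi> k l. (v + e *s u) $ k * (v + e *s u) $ l)"
proof -
  have "contr T (\<chi> i j. q0 $ i $ j + e * (2 * q1 $ i $ j + e * q2 $ i $ j))
    = (\<chi> k l. contr T q0 $ k $ l + e * (2 * contr T q1 $ k $ l + e * contr T q2 $ k $ l))"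
    by (simp add: contr_def vec_eq_iff sum_3 algebra_simps)
  then show ?thesis unfolding assms by (simp add: vec_eq_iff line_pair_def algebra_simps)
qed

lemma common_nonzero_near_0:
  fixes f g :: "complex \<Rightarrow> complex"
  assumes "isCont f 0" "f 0 \<noteq> 0" "isCont g 0" "g 0 \<noteq> 0"
  shows "\<exists>e. e \<noteq> 0 \<and> f e \<noteq> 0 \<and> g e \<noteq> 0"
proof -
  have "\<forall>\<^sub>F e in at 0. f e \<noteq> 0" "\<forall>\<^sub>F e in at 0. g e \<noteq> 0"
    using assms by (auto simp: isCont_def intro: tendsto_imp_eventually_ne)
  moreover have "\<forall>\<^sub>F e in at (0::complex). e \<noteq> 0" by (simp add: eventually_at_filter)
  ultimately have "\<forall>\<^sub>F e in at 0. e \<noteq> 0 \<and> f e \<noteq> 0 \<and> g e \<noteq> 0" by eventually_elim auto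
  then show ?thesis using eventually_happens by fastforce
qed

lemma isCont_conic_at_perturbed:
  "isCont (\<lambda>e. conic_at (\<chi> i j. q0 $ i $ j + e * (2 * q1 $ i $ j + e * q2 $ i $ j)) (v + e *s u)) 0"
  unfolding conic_at_def by (simp add: sum_3)

text \<open>The explicit case that resists both the first-order perturbation of \<open>v\<close> and
  the saving of a power on one line. The two dual conics fix all entries except
  \<open>T 1 1 1 1\<close>, \<open>T 1 1 1 3\<close>, \<open>T 2 2 2 2\<close> and
  \<open>T 2 2 2 3\<close>, and then the distant point \<open>(1, -1, 0)\<close> has a smooth dual
  conic.\<close>

lemma nodal_vertex_case:
  assumes T: "sym4 T" "nondeg T" and b: "b \<noteq> 0" and g: "g \<noteq> 0"
    and v: "v = vector [1, 1, 0]"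
    and D: "contr T (\<chi> i j. b * nodal_conic $ i $ j) = (\<chi> k l. v $ k * v $ l)"
    and M: "contr T (\<chi> i j. if i = 3 \<and> j = 3 then g else 0) = (\<chi> k l. if k = 3 \<and> l = 3 then 1 else 0)"
  shows "rank_le 6 T"
proof -
  note sort = sym4_sort[OF T(1)]
  have T12: "T 1 2 k l = v $ k * v $ l / b" for k l
  proof -
    have "contr T (\<chi> i j. b * nodal_conic $ i $ j) $ k $ l = v $ k * v $ l" by (simp add: D)
    then show ?thesis using b by (simp add: contr_def nodal_conic_def sum_3 sort field_simps)
  qed
  have T33: "g * T 3 3 k l = (if k = 3 \<and> l = 3 then 1 else 0)" for k l
  proof -
    have "contr T (\<chi> i j. if i = 3 \<and> j = 3 then g else 0) $ k $ l = (if k = 3 \<and> l = 3 then 1 else 0)"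
      by (simp add: M)
    then show ?thesis by (simp add: contr_def sum_3)
  qed
  from T12[of 1 1] T12[of 1 2] T12[of 1 3] T12[of 2 2] T12[of 2 3] T12[of 3 3]
    T33[of 1 1] T33[of 1 3] T33[of 2 2] T33[of 2 3]
  have t: "T 1 1 1 2 = 1 / b" "T 1 1 2 2 = 1 / b" "T 1 2 2 2 = 1 / b" "T 1 1 2 3 = 0" "T 1 2 2 3 = 0"
    "T 1 2 3 3 = 0" "T 1 1 3 3 = 0" "T 1 3 3 3 = 0" "T 2 2 3 3 = 0" "T 2 3 3 3 = 0"
    using g by (simp_all add: v sort)
  have b1: "T 1 1 1 3 \<noteq> 0"
  proof
    assume 0: "T 1 1 1 3 = 0"
    define q :: "complex ^ 3 ^ 3" where "q = vector [vector [0, 0, 1], vector [0, 0, 0], vector [1, 0, 0]]"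
    have "symmat q" by (simp add: symmat_def forall_3 q_def)
    moreover have "contr T q = 0" by (simp add: mat3_eq_iff forall_3 contr_def sum_3 q_def sort t 0)
    ultimately have "q = 0" using T(2) by (simp add: nondeg_def)
    then have "q $ 1 $ 3 = 0" by simp
    then show False by (simp add: q_def)
  qed
  have b2: "T 2 2 2 3 \<noteq> 0"
  proof
    assume 0: "T 2 2 2 3 = 0"
    define q :: "complex ^ 3 ^ 3" where "q = vector [vector [0, 0, 0], vector [0, 0, 1], vector [0, 1, 0]]"
    have "symmat q" by (simp add: symmat_def forall_3 q_def)
    moreover have "contr T q = 0" by (simp add: mat3_eq_iff forall_3 contr_def sum_3 q_def sort t 0)
    ultimately have "q = 0" using T(2) by (simp add: nondeg_def)
    then have "q $ 2 $ 3 = 0" by simp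
    then show False by (simp add: q_def)
  qed
  \<comment> \<open>The square of \<open>u\<close> is twice the squares of the first two unit
    vectors minus the square of \<open>v\<close>. The conics \<open>x1 x3\<close> and
    \<open>x2 x3\<close> contract to \<open>T 1 1 1 3\<close> and \<open>T 2 2 2 3\<close> times
    these two squares, whence \<open>q\<close>.\<close>
  define u :: "complex ^ 3" where "u = vector [1, -1, 0]"
  define q :: "complex ^ 3 ^ 3" where "q = vector [vector [0, - b / 2, 1 / T 1 1 1 3],
    vector [- b / 2, 0, 1 / T 2 2 2 3], vector [1 / T 1 1 1 3, 1 / T 2 2 2 3, 0]]"
  have "symmat q" by (simp add: symmat_def forall_3 q_def)
  moreover have "contr T q = (\<chi> k l. u $ k * u $ l)"
    using b b1 b2 by (simp add: mat3_eq_iff forall_3 contr_def sum_3 q_def u_def sort t)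
  moreover have "conic_at q u \<noteq> 0"
    using b by (simp add: conic_at_def sum_3 q_def u_def)
  moreover have "det q \<noteq> 0" using b b1 b2 by (simp add: det_3 q_def)
  ultimately show ?thesis using rank_le_nondeg_smooth[OF T] by blast
qed

text \<open>By \<open>m *v v = 0\<close>, the conic \<open>m\<close> is a form
  \<open>al y^2 + 2 be y z + ga z^2\<close> in \<open>y = x1 - x2\<close> and \<open>z = x3\<close>.
  If it is not a square, its restriction to the first line provides two nodes for that arm of the
  peeled quartic, while three suffice on the second. If it is a square, a shear leads to
  \<open>nodal_vertex_case\<close>.\<close>

lemma nodal_apolar_vertex:
  assumes T: "sym4 T" "nondeg T" and b: "b \<noteq> 0"
    and v: "v = vector [1, 1, 0]"
    and D: "contr T (\<chi> i j. b * nodal_conic $ i $ j) = (\<chi> k l. v $ k * v $ l)"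
    and m: "symmat m" "contr T m = (\<chi> k l. if k = 3 \<and> l = 3 then 1 else 0)" "m *v v = 0"
  shows "rank_le 6 T"
proof -
  note sort = sym4_sort[OF T(1)]
  have sm: "m $ 2 $ 1 = m $ 1 $ 2" "m $ 3 $ 1 = m $ 1 $ 3" "m $ 3 $ 2 = m $ 2 $ 3"
    using m(1) by (auto simp: symmat_def)
  define al be ga where "al = m $ 1 $ 1" and "be = m $ 1 $ 3" and "ga = m $ 3 $ 3"
  have "(m *v v) $ k = 0" for k using m(3) by simp
  from this[of 1] this[of 2] this[of 3]
  have r: "m $ 1 $ 1 + m $ 1 $ 2 = 0" "m $ 1 $ 2 + m $ 2 $ 2 = 0" "m $ 1 $ 3 + m $ 2 $ 3 = 0"
    by (simp_all add: matrix_vector_mult_def sum_3 v sm)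
  have me: "m $ 1 $ 1 = al" "m $ 1 $ 2 = - al" "m $ 2 $ 2 = al" "m $ 1 $ 3 = be" "m $ 2 $ 3 = - be" "m $ 3 $ 3 = ga"
  proof -
    show m12: "m $ 1 $ 2 = - al" using r(1) unfolding al_def by (metis minus_unique)
    show "m $ 2 $ 2 = al" using r(2) unfolding m12 by simp
    show "m $ 2 $ 3 = - be" using r(3) unfolding be_def by (metis minus_unique)
  qed (simp_all add: al_def be_def ga_def)
  define q0 :: "complex ^ 3 ^ 3" where "q0 = (\<chi> i j. b * nodal_conic $ i $ j)"
  have q0v: "conic_at q0 v = b" by (simp add: conic_at_def q0_def nodal_conic_def sum_3 v)
  have "symmat q0" by (simp add: symmat_def forall_3 q0_def nodal_conic_def)
  then have ker0: "kernel_spanned_by (\<lambda>i j k l. T i j k l - 1 / b * pow4 v i j k l) q0"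
    using kernel_after_peeling[OF T(2), of q0 v] D q0v b by (simp add: q0_def[symmetric])
  define S where "S = (\<lambda>i j k l. T i j k l - 1 / b * pow4 v i j k l)"
  have S: "sym4 S" unfolding S_def by (rule sym4_diff_pow4[OF T(1)])
  note sortS = sym4_sort[OF S]
  have ker: "kernel_spanned_by S nodal_conic"
    unfolding kernel_spanned_by_def
  proof (intro conjI allI impI)
    have "contr S q0 = 0" using ker0 by (simp add: kernel_spanned_by_def S_def)
    then show "contr S nodal_conic = 0"
      using b by (simp add: mat3_eq_iff contr_def q0_def sum_distrib_left[symmetric] mult.assoc)
    fix p assume "symmat p" "contr S p = 0"
    then obtain c where "p = (\<chi> i j. c * q0 $ i $ j)" using ker0 by (auto simp: kernel_spanned_by_def S_def)
    then have "p = (\<chi> i j. (c * b) * nodal_conic $ i $ j)" by (simp add: q0_def mult.assoc)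
    then show "\<exists>c. p = (\<chi> i j. c * nodal_conic $ i $ j)" by blast
  qed
  then have K: "contr S nodal_conic = 0" by (simp add: kernel_spanned_by_def)
  note z = nodal_contr[OF S K]
  have "conic_at m v = 0" by (simp add: conic_at_def sum_3 v sm me)
  then have Sm: "contr S m = (\<chi> k l. if k = 3 \<and> l = 3 then 1 else 0)"
    unfolding S_def contr_diff_pow4 by (simp add: m(2))
  have "contr S m $ k $ l = (if k = 3 \<and> l = 3 then 1 else 0)" for k l by (simp add: Sm)
  from this[of 1 1] this[of 1 3] this[of 2 2] this[of 2 3] this[of 3 3]
  have e: "al * S 1 1 1 1 + 2 * be * S 1 1 1 3 + ga * S 1 1 3 3 = 0"
    "al * S 1 1 1 3 + 2 * be * S 1 1 3 3 + ga * S 1 3 3 3 = 0"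
    "al * S 2 2 2 2 - 2 * be * S 2 2 2 3 + ga * S 2 2 3 3 = 0"
    "al * S 2 2 2 3 - 2 * be * S 2 2 3 3 + ga * S 2 3 3 3 = 0"
    "al * S 1 1 3 3 + 2 * be * S 1 3 3 3 + (al * S 2 2 3 3 - 2 * be * S 2 3 3 3) + ga * S 3 3 3 3 = 1"
    by (simp_all add: contr_def sum_3 sm me sortS z algebra_simps)
  define s1 s2 where "s1 = al * S 1 1 3 3 + 2 * be * S 1 3 3 3" and "s2 = al * S 2 2 3 3 - 2 * be * S 2 3 3 3"
  have ga: "ga \<noteq> 0"
  proof
    assume g0: "ga = 0"
    \<comment> \<open>With \<open>ga = 0\<close>, the parts of \<open>m\<close> on the two lines
      contract to \<open>s1\<close> and \<open>s2\<close> times the square of the third unit vector.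
      This combination cancels them, so it is apolar to \<open>S\<close> without any
      \<open>x1 x2\<close> term.\<close>
    define q :: "complex ^ 3 ^ 3" where "q = vector [vector [s2 * al, 0, s2 * be],
      vector [0, - s1 * al, s1 * be], vector [s2 * be, s1 * be, 0]]"
    have "symmat q" by (simp add: symmat_def forall_3 q_def)
    moreover have "contr S q = 0"
    proof -
      have "s2 * (al * S 1 1 1 1 + 2 * be * S 1 1 1 3) = 0" "s2 * (al * S 1 1 1 3 + 2 * be * S 1 1 3 3) = 0"
        "s1 * (al * S 2 2 2 2 - 2 * be * S 2 2 2 3) = 0" "s1 * (al * S 2 2 2 3 - 2 * be * S 2 2 3 3) = 0"
        using e g0 by simp_all
      then show ?thesis
        by (simp add: mat3_eq_iff forall_3 contr_def sum_3 q_def sortS z s1_def s2_def algebra_simps)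
    qed
    ultimately obtain c where c: "q = (\<chi> i j. c * nodal_conic $ i $ j)"
      using ker by (auto simp: kernel_spanned_by_def)
    have "q $ 1 $ 1 = 0" "q $ 1 $ 3 = 0" "q $ 2 $ 2 = 0" "q $ 2 $ 3 = 0"
      by (simp_all add: c nodal_conic_def)
    then have 0: "s2 * al = 0" "s2 * be = 0" "s1 * al = 0" "s1 * be = 0" by (simp_all add: q_def)
    have "s1 + s2 = 1" using e(5) g0 by (simp add: s1_def s2_def)
    moreover have "s1 = 0 \<and> s2 = 0 \<or> al = 0 \<and> be = 0" using 0 by auto
    ultimately show False by (auto simp: s1_def s2_def)
  qed
  \<comment> \<open>The value at the node for which \<open>m\<close>, restricted to the first line,
    is apolar to the first arm; \<open>t2\<close> is its counterpart on the second line.\<close>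
  define t where "t = - s1 / ga"
  define t2 where "t2 = - s2 / ga"
  have gt: "ga * t = - s1" "ga * t2 = - s2" using ga by (simp_all add: t_def t2_def)
  have ht: "hankel_kernel (arm_moments S 1 t) ga (2 * be) al"
    using e gt(1) by (simp add: hankel_kernel_def s1_def algebra_simps)
  have ht2: "hankel_kernel (arm_moments S 2 t2) ga (- 2 * be) al"
    using e gt(2) by (simp add: hankel_kernel_def s2_def algebra_simps)
  \<comment> \<open>The \<open>(3, 3)\<close> entry of \<open>contr S m\<close> is 1, not 0, so no
    splitting attains both special values: with \<open>t\<close> on the first arm, the second Hankel
    matrix is invertible.\<close>
  have ne: "t2 \<noteq> S 3 3 3 3 - t"
  proof
    assume "t2 = S 3 3 3 3 - t"
    then have "ga * t2 = ga * S 3 3 3 3 - ga * t" by (simp add: right_diff_distrib)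
    then have "ga * S 3 3 3 3 = - s2 - s1" unfolding gt by (simp add: algebra_simps)
    then show False using e(5) by (simp add: s1_def[symmetric] s2_def[symmetric])
  qed
  show ?thesis
  proof (cases "be\<^sup>2 = al * ga")
    case False
    have "\<exists>R w. finite R \<and> card R = 3 \<and> (\<forall>n\<le>4. arm_moments S 2 (S 3 3 3 3 - t) n = (\<Sum>r\<in>R. w r * r ^ n))"
      by (rule quadrature_3, rule arm_kernel_unique[OF S ker _ ht2 ga _ ne]) auto
    then have r2: "rank_le 3 (arm_tensor 2 (arm_moments S 2 (S 3 3 3 3 - t)))"
      using rank_le_arm_tensor[of _ "arm_moments S 2 (S 3 3 3 3 - t)" _ 2] by fastforce
    \<comment> \<open>The coefficients are reversed, so that the leading one is \<open>ga\<close>,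
      known to be nonzero; \<open>al\<close> may vanish.\<close>
    define q where "q = [:al, 2 * be, ga:]"
    have dq: "degree q = 2" using ga by (simp add: q_def)
    have "rsquarefree q" unfolding rsquarefree_roots
    proof (intro allI notI, elim conjE)
      fix r assume "poly q r = 0" "poly (pderiv q) r = 0"
      then have r: "al + r * (2 * be + r * ga) = 0" "2 * (be + r * ga) = 0"
        by (simp_all add: q_def pderiv_pCons algebra_simps)
      from r(2) have "be + r * ga = 0" by (metis mult_eq_0_iff zero_neq_numeral)
      with r(1) have "be\<^sup>2 = al * ga" by algebra
      then show False using False by simp
    qed
    moreover have "moment (\<lambda>n. arm_moments S 1 t (4 - n)) (q * monom 1 i) = 0" if "i + 2 \<le> 4" for i
    proof -
      define s' where "s' n = arm_moments S 1 t (4 - n)" for n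
      have s': "s' 0 = S 1 1 1 1" "s' 1 = S 1 1 1 3" "s' 2 = S 1 1 3 3" "s' 3 = S 1 3 3 3" "s' 4 = t"
        by (simp_all add: s'_def)
      have "coeff q 0 = al" "coeff q 1 = 2 * be" "coeff q 2 = ga"
        by (simp_all add: q_def numeral_2_eq_2)
      then have M: "moment s' (q * monom 1 i) = al * s' i + 2 * be * s' (i + 1) + ga * s' (i + 2)"
        using moment_mult_monom[of q 2 s' i] dq by (simp add: nat_le_2_sum)
      have "i = 0 \<or> i = 1 \<or> i = 2" using that by linarith
      then have "moment s' (q * monom 1 i) = 0"
        unfolding M using ht s' by (auto simp: hankel_kernel_def algebra_simps numeral_2_eq_2[symmetric])
      then show ?thesis by (simp only: s'_def[abs_def])
    qed
    ultimately obtain R w where R: "finite R" "card R = 2"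
      "\<forall>n\<le>4. arm_moments S 1 t (4 - n) = (\<Sum>r\<in>R. w r * r ^ n)"
      using quadrature_nodes[of q 2 4 "\<lambda>n. arm_moments S 1 t (4 - n)"] dq by auto
    then have r1: "rank_le 2 (arm_tensor 1 (arm_moments S 1 t))"
      using rank_le_arm_tensor_rev[of R "arm_moments S 1 t" w 1] by auto
    have "rank_le (2 + 3) S"
      using rank_le_add[OF r1 r2] unfolding split_into_arms[OF S K, symmetric] .
    then have "rank_le (2 + 3) (\<lambda>i j k l. T i j k l - 1 / b * pow4 v i j k l)" by (simp only: S_def)
    from rank_le_peeled[OF this] show ?thesis by (simp add: eval_nat_numeral)
  next
    case True
    \<comment> \<open>Here \<open>m\<close> is \<open>ga\<close> times the square of
      \<open>x3 + a (x1 - x2)\<close>. Taking this form as third coordinate preserves both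
      \<open>v\<close> and the conic \<open>x1 x2\<close>.\<close>
    define a where "a = be / ga"
    define P :: "complex ^ 3 ^ 3" where "P = vector [vector [1, 0, 0], vector [0, 1, 0], vector [a, - a, 1]]"
    have P: "invertible P" by (simp add: invertible_det_nz det_3 P_def)
    have Pv: "P *v v = v" by (simp add: vec_eq_iff forall_3 matrix_vector_mult_def sum_3 P_def v)
    have p1: "transpose P ** q0 ** P = q0"
      by (simp add: mat3_eq_iff forall_3 matrix_matrix_mult_def transpose_def sum_3 P_def q0_def nodal_conic_def)
    define e3 :: "complex ^ 3 ^ 3" where "e3 = (\<chi> i j. if i = 3 \<and> j = 3 then ga else 0)"
    have "ga * a = be" "be * a = al" using ga True by (simp_all add: a_def power2_eq_square field_simps)
    then have p2: "transpose P ** e3 ** P = m"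
      by (simp add: mat3_eq_iff forall_3 matrix_matrix_mult_def transpose_def sum_3 P_def e3_def me sm mult_ac)
    have c1: "contr (act P T) q0 = (\<chi> k l. v $ k * v $ l)"
    proof -
      have "contr (act P T) q0 = P ** (\<chi> k l. v $ k * v $ l) ** transpose P"
        unfolding contr_act p1 using D by (simp add: q0_def)
      also have "\<dots> = (\<chi> k l. (P *v v) $ k * (P *v v) $ l)"
        by (simp add: mat3_eq_iff matrix_matrix_mult_def matrix_vector_mult_def transpose_def sum_3 algebra_simps)
      finally show ?thesis by (simp add: Pv)
    qed
    have c2: "contr (act P T) e3 = (\<chi> k l. if k = 3 \<and> l = 3 then 1 else 0)"
      unfolding contr_act p2 m(2)
      by (simp add: mat3_eq_iff forall_3 matrix_matrix_mult_def transpose_def sum_3 P_def)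
    have "rank_le 6 (act P T)"
      using nodal_vertex_case[OF sym4_act[OF T(1)] nondeg_act[OF P T(2)] b ga v] c1 c2
      by (simp add: q0_def e3_def)
    then show ?thesis using rank_le_act_iff[OF P] by blast
  qed
qed

text \<open>If \<open>m *v v\<close> has a nonzero entry at \<open>u\<close>, moving
  \<open>v\<close> along the \<open>u\<close>-th unit vector smooths the dual conic: the linear
  coefficient of its determinant is a nonzero multiple of \<open>q1 $ 3 $ 3\<close>.\<close>

lemma nodal_apolar:
  assumes T: "sym4 T" "nondeg T" and b: "b \<noteq> 0"
    and v: "v = vector [1, 1, 0]"
    and D: "contr T (\<chi> i j. b * nodal_conic $ i $ j) = (\<chi> k l. v $ k * v $ l)"
  shows "rank_le 6 T"
proof -
  have "symmat (\<chi> k l. if k = 3 \<and> l = 3 then 1 else 0)" by (auto simp: symmat_def)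
  then obtain m where m: "symmat m" "contr T m = (\<chi> k l. if k = 3 \<and> l = 3 then 1 else 0)"
    using nondeg_solve[OF T] by metis
  show ?thesis
  proof (cases "m *v v = 0")
    case True
    then show ?thesis using nodal_apolar_vertex[OF T b v D m] by blast
  next
    case False
    then obtain u where u: "(m *v v) $ u \<noteq> 0" by (auto simp: vec_eq_iff)
    define e :: "complex ^ 3" where "e = axis u 1"
    obtain q1 where q1: "symmat q1" "contr T q1 = line_pair v e"
      using nondeg_solve[OF T] symmat_line_pair by metis
    have "symmat (\<chi> k l. e $ k * e $ l)" by (simp add: symmat_def)
    then obtain q2 where q2: "symmat q2" "contr T q2 = (\<chi> k l. e $ k * e $ l)"
      using nondeg_solve[OF T] by metis
    define q0 :: "complex ^ 3 ^ 3" where "q0 = (\<chi> i j. b * nodal_conic $ i $ j)"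
    define N :: "complex \<Rightarrow> complex ^ 3 ^ 3" where
      "N h = (\<chi> i j. q0 $ i $ j + h * (2 * q1 $ i $ j + h * q2 $ i $ j))" for h
    have s0: "symmat q0" by (simp add: symmat_def forall_3 q0_def nodal_conic_def)
    have sN: "symmat (N h)" for h unfolding symmat_def
    proof (intro allI)
      fix i j
      have "q0 $ i $ j = q0 $ j $ i" "q1 $ i $ j = q1 $ j $ i" "q2 $ i $ j = q2 $ j $ i"
        using s0 q1(1) q2(1) unfolding symmat_def by blast+
      then show "N h $ i $ j = N h $ j $ i" by (simp add: N_def)
    qed
    have cN: "contr T (N h) = (\<chi> k l. (v + h *s e) $ k * (v + h *s e) $ l)" for h
      unfolding N_def by (rule contr_perturbed) (use D q1 q2 in \<open>simp_all add: q0_def\<close>)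
    \<comment> \<open>Pair \<open>m\<close> with the contraction of \<open>q1\<close> and move the
      contraction to \<open>m\<close>, where it selects the entry \<open>(3, 3)\<close>.\<close>
    have "(m *v v) $ u = (\<Sum>i\<in>UNIV. \<Sum>j\<in>UNIV. m $ i $ j * contr T q1 $ i $ j)"
      using m(1) exhaust_3[of u]
      by (auto simp: q1 line_pair_def e_def axis_def sum_3 matrix_vector_mult_def symmat_def algebra_simps
          add_divide_distrib)
    also have "\<dots> = (\<Sum>i\<in>UNIV. \<Sum>j\<in>UNIV. q1 $ i $ j * contr T m $ i $ j)"
      by (rule contr_pairing[OF T(1)])
    also have "\<dots> = q1 $ 3 $ 3" by (simp add: m sum_3)
    finally have q33: "q1 $ 3 $ 3 \<noteq> 0" using u by simp
    \<comment> \<open>The third column of \<open>q0\<close> is zero, so \<open>h\<close> divides the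
      third column of \<open>N h\<close>; it is divided out here, leaving a determinant that is
      nonzero at 0.\<close>
    define N' :: "complex \<Rightarrow> complex ^ 3 ^ 3" where
      "N' h = (\<chi> i j. if j = 3 then 2 * q1 $ i $ j + h * q2 $ i $ j else N h $ i $ j)" for h
    have dN: "det (N h) = h * det (N' h)" for h
      by (simp add: det_3 N'_def N_def q0_def nodal_conic_def algebra_simps)
    have "isCont (\<lambda>h. det (N' h)) 0"
      by (simp add: det_3 N'_def N_def)
    moreover have "det (N' 0) \<noteq> 0"
      using q33 b by (simp add: det_3 N'_def N_def q0_def nodal_conic_def)
    moreover have "isCont (\<lambda>h. conic_at (N h) (v + h *s e)) 0"
      unfolding N_def by (rule isCont_conic_at_perturbed)
    moreover have "conic_at (N 0) (v + 0 *s e) \<noteq> 0"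
      using b by (simp add: conic_at_def N_def q0_def nodal_conic_def sum_3 v)
    ultimately obtain h where "h \<noteq> 0" "det (N' h) \<noteq> 0" "conic_at (N h) (v + h *s e) \<noteq> 0"
      using common_nonzero_near_0[of "\<lambda>h. det (N' h)" "\<lambda>h. conic_at (N h) (v + h *s e)"] by blast
    then show ?thesis using rank_le_nondeg_smooth[OF T sN cN] dN by simp
  qed
qed

text \<open>Neither form vanishes at \<open>v\<close>, so both can be scaled to 1 there. With a
  third form vanishing at \<open>v\<close> they are coordinates in which \<open>v\<close> is
  \<open>(1, 1, 0)\<close> and the conic a multiple of \<open>x1 x2\<close>.\<close>

lemma rank_le_nondeg_line_pair:
  assumes T: "sym4 T" "nondeg T" and D: "contr T (line_pair a c) = (\<chi> k l. v $ k * v $ l)"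
    and b: "conic_at (line_pair a c) v \<noteq> 0" and nsq: "\<And>d. line_pair a c \<noteq> line_pair d d"
  shows "rank_le 6 T"
proof -
  define av cv where "av = (\<Sum>i\<in>UNIV. a $ i * v $ i)" and "cv = (\<Sum>i\<in>UNIV. c $ i * v $ i)"
  have bv: "conic_at (line_pair a c) v = av * cv"
    by (simp add: conic_at_def line_pair_def sum_3 av_def cv_def field_simps)
  then have nz: "av \<noteq> 0" "cv \<noteq> 0" using b by auto
  define x y :: "complex ^ 3" where "x = (\<chi> i. a $ i / av)" and "y = (\<chi> i. c $ i / cv)"
  have xv: "x $ 1 * v $ 1 + x $ 2 * v $ 2 + x $ 3 * v $ 3 = 1"
    using nz by (simp add: x_def add_divide_distrib[symmetric]) (simp add: av_def sum_3)
  have yv: "y $ 1 * v $ 1 + y $ 2 * v $ 2 + y $ 3 * v $ 3 = 1"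
    using nz by (simp add: y_def add_divide_distrib[symmetric]) (simp add: cv_def sum_3)
  have xy: "line_pair a c = (\<chi> i j. av * cv * line_pair x y $ i $ j)"
    using nz by (simp add: line_pair_def x_def y_def vec_eq_iff field_simps)
  have "x \<noteq> y"
  proof
    assume "x = y"
    obtain s where s: "s\<^sup>2 = av * cv" using complex_sqrt_exists by blast
    have "line_pair a c = line_pair (\<chi> i. s * x $ i) (\<chi> i. s * x $ i)"
      unfolding xy \<open>x = y\<close>[symmetric] s[symmetric]
      by (simp add: line_pair_def vec_eq_iff power2_eq_square algebra_simps)
    then show False using nsq by blast
  qed
  have "\<exists>z. z $ 1 * v $ 1 + z $ 2 * v $ 2 + z $ 3 * v $ 3 = 0
      \<and> det (vector [x, y, z] :: complex ^ 3 ^ 3) \<noteq> 0"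
  proof -
    \<comment> \<open>The third form is the cross product of \<open>v\<close> with the
      \<open>i\<close>-th unit vector; as \<open>x\<close> and \<open>y\<close> are 1 at
      \<open>v\<close>, the determinant is \<open>y $ i - x $ i\<close>.\<close>
    obtain i where i: "x $ i \<noteq> y $ i" using \<open>x \<noteq> y\<close> by (auto simp: vec_eq_iff)
    consider "i = 1" | "i = 2" | "i = 3" using exhaust_3 by blast
    then show ?thesis
    proof cases
      case 1
      have "det (vector [x, y, vector [0, v $ 3, - v $ 2]] :: complex ^ 3 ^ 3) = y $ 1 - x $ 1"
        using xv yv by (simp add: det_3) algebra
      then show ?thesis using i 1 by (intro exI[of _ "vector [0, v $ 3, - v $ 2]"]) simp
    next
      case 2
      have "det (vector [x, y, vector [- v $ 3, 0, v $ 1]] :: complex ^ 3 ^ 3) = y $ 2 - x $ 2"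
        using xv yv by (simp add: det_3) algebra
      then show ?thesis using i 2 by (intro exI[of _ "vector [- v $ 3, 0, v $ 1]"]) simp
    next
      case 3
      have "det (vector [x, y, vector [v $ 2, - v $ 1, 0]] :: complex ^ 3 ^ 3) = y $ 3 - x $ 3"
        using xv yv by (simp add: det_3) algebra
      then show ?thesis using i 3 by (intro exI[of _ "vector [v $ 2, - v $ 1, 0]"]) simp
    qed
  qed
  then obtain z where z: "z $ 1 * v $ 1 + z $ 2 * v $ 2 + z $ 3 * v $ 3 = 0"
    "det (vector [x, y, z] :: complex ^ 3 ^ 3) \<noteq> 0" by blast
  define P :: "complex ^ 3 ^ 3" where "P = vector [x, y, z]"
  have P: "invertible P" using z by (simp add: invertible_det_nz P_def)
  have Pv: "P *v v = vector [1, 1, 0]"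
    using xv yv z by (simp add: vec_eq_iff forall_3 matrix_vector_mult_def sum_3 P_def)
  have PD: "transpose P ** (\<chi> i j. av * cv * nodal_conic $ i $ j) ** P = line_pair a c"
    unfolding xy by (simp add: mat3_eq_iff matrix_matrix_mult_def transpose_def sum_3 P_def nodal_conic_def
        line_pair_def field_simps)
  have "contr (act P T) (\<chi> i j. av * cv * nodal_conic $ i $ j)
      = P ** (\<chi> k l. v $ k * v $ l) ** transpose P"
    unfolding contr_act PD D ..
  also have "\<dots> = (\<chi> k l. (P *v v) $ k * (P *v v) $ l)"
    by (simp add: mat3_eq_iff matrix_matrix_mult_def matrix_vector_mult_def transpose_def sum_3 algebra_simps)
  finally have "rank_le 6 (act P T)"
    using nodal_apolar[OF sym4_act[OF T(1)] nondeg_act[OF P T(2)], of "av * cv" "P *v v"] Pv nz by simp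
  then show ?thesis using rank_le_act_iff[OF P] by blast
qed

lemma rank_le_nondeg_not_square:
  assumes T: "sym4 T" "nondeg T" and q: "symmat q" "contr T q = (\<chi> k l. v $ k * v $ l)"
    and b: "conic_at q v \<noteq> 0" and nsq: "\<And>d. q \<noteq> line_pair d d"
  shows "rank_le 6 T"
  using conic_normal_form[OF q(1)]
proof (elim disjE exE conjE)
  fix P assume "invertible P" "q = transpose P ** smooth_conic ** P"
  then have "det q \<noteq> 0"
    by (simp add: det_mul invertible_det_nz) (simp add: det_3 smooth_conic_def)
  then show ?thesis by (rule rank_le_nondeg_smooth[OF T q b])
next
  fix a c assume "q = line_pair a c"
  then show ?thesis using rank_le_nondeg_line_pair[OF T, of a c v] q b nsq by simp
qed

text \<open>Moving \<open>v\<close> along the second unit vector makes a 2 by 2 minor of the dual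
  conic nonzero at first order, whereas all such minors of a double line vanish. The perturbed conic
  is then smooth or a pair of distinct lines.\<close>

lemma double_line_apolar:
  assumes T: "sym4 T" "nondeg T" and b: "b \<noteq> 0" and v: "v = vector [1, 0, 0]"
    and D: "contr T (\<chi> i j. if i = 1 \<and> j = 1 then b else 0) = (\<chi> k l. v $ k * v $ l)"
  shows "rank_le 6 T"
proof -
  note sort = sym4_sort[OF T(1)]
  define e :: "complex ^ 3" where "e = vector [0, 1, 0]"
  obtain q1 where q1: "symmat q1" "contr T q1 = line_pair v e"
    using nondeg_solve[OF T] symmat_line_pair by metis
  have "symmat (\<chi> k l. e $ k * e $ l)" by (simp add: symmat_def)
  then obtain q2 where q2: "symmat q2" "contr T q2 = (\<chi> k l. e $ k * e $ l)"
    using nondeg_solve[OF T] by metis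
  define q0 :: "complex ^ 3 ^ 3" where "q0 = (\<chi> i j. if i = 1 \<and> j = 1 then b else 0)"
  have T11: "b * T 1 1 k l = v $ k * v $ l" for k l
  proof -
    have "contr T (\<chi> i j. if i = 1 \<and> j = 1 then b else 0) $ k $ l = v $ k * v $ l"
      by (simp add: D)
    then show ?thesis by (simp add: contr_def sum_3)
  qed
  from T11[of 1 1] T11[of 1 2] T11[of 1 3] T11[of 2 2] T11[of 2 3]
  have t: "b * T 1 1 1 1 = 1" "T 1 1 1 2 = 0" "T 1 1 1 3 = 0" "T 1 1 2 2 = 0" "T 1 1 2 3 = 0"
    using b by (simp_all add: v)
  \<comment> \<open>In the \<open>(1, 2)\<close> entry of the contraction, the first row and column
    of \<open>q1\<close> meet only \<open>T 1 1 1 2\<close>, \<open>T 1 1 2 2\<close> and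
    \<open>T 1 1 2 3\<close>, which are zero; yet this entry is 1/2.\<close>
  have "\<exists>j k. j \<noteq> 1 \<and> k \<noteq> 1 \<and> q1 $ j $ k \<noteq> 0"
  proof (rule ccontr)
    assume "\<not> ?thesis"
    then have z: "q1 $ 2 $ 2 = 0" "q1 $ 2 $ 3 = 0" "q1 $ 3 $ 2 = 0" "q1 $ 3 $ 3 = 0"
      by (simp_all add: forall_3)
    have "contr T q1 $ 1 $ 2 = 1 / 2" unfolding q1 by (simp add: line_pair_def v e_def)
    then show False by (simp add: contr_def sum_3 z sort t)
  qed
  then obtain j k where jk: "j \<noteq> 1" "k \<noteq> 1" "q1 $ j $ k \<noteq> 0" by blast
  define N :: "complex \<Rightarrow> complex ^ 3 ^ 3" where
    "N h = (\<chi> i j. q0 $ i $ j + h * (2 * q1 $ i $ j + h * q2 $ i $ j))" for h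
  have s0: "symmat q0" by (simp add: symmat_def forall_3 q0_def)
  have sN: "symmat (N h)" for h unfolding symmat_def
  proof (intro allI)
    fix i j
    have "q0 $ i $ j = q0 $ j $ i" "q1 $ i $ j = q1 $ j $ i" "q2 $ i $ j = q2 $ j $ i"
      using s0 q1(1) q2(1) unfolding symmat_def by blast+
    then show "N h $ i $ j = N h $ j $ i" by (simp add: N_def)
  qed
  have cN: "contr T (N h) = (\<chi> k l. (v + h *s e) $ k * (v + h *s e) $ l)" for h
    unfolding N_def by (rule contr_perturbed) (use D q1 q2 in \<open>simp_all add: q0_def\<close>)
  define r where "r h = N h $ 1 $ 1 * (2 * q1 $ j $ k + h * q2 $ j $ k)
    - h * (2 * q1 $ 1 $ k + h * q2 $ 1 $ k) * (2 * q1 $ j $ 1 + h * q2 $ j $ 1)" for h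
  have minor: "N h $ 1 $ 1 * N h $ j $ k - N h $ 1 $ k * N h $ j $ 1 = h * r h" for h
    using jk by (simp add: r_def N_def[of h] q0_def algebra_simps)
  have "isCont r 0" unfolding r_def[abs_def] by (simp add: N_def)
  moreover have "r 0 \<noteq> 0" using jk b by (simp add: r_def N_def q0_def)
  moreover have "isCont (\<lambda>h. conic_at (N h) (v + h *s e)) 0"
    unfolding N_def by (rule isCont_conic_at_perturbed)
  moreover have "conic_at (N 0) (v + 0 *s e) \<noteq> 0"
    using b by (simp add: conic_at_def N_def q0_def sum_3 v)
  ultimately obtain h where h: "h \<noteq> 0" "r h \<noteq> 0" "conic_at (N h) (v + h *s e) \<noteq> 0"
    using common_nonzero_near_0[of r "\<lambda>h. conic_at (N h) (v + h *s e)"] by blast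
  have "N h \<noteq> line_pair d d" for d
  proof
    assume "N h = line_pair d d"
    then have "N h $ 1 $ 1 * N h $ j $ k - N h $ 1 $ k * N h $ j $ 1 = 0"
      by (simp add: line_pair_def field_simps)
    then show False using h by (simp add: minor)
  qed
  then show ?thesis using rank_le_nondeg_not_square[OF T sN cN h(3)] by blast
qed

lemma rank_le_nondeg_square:
  assumes T: "sym4 T" "nondeg T" and D: "contr T (line_pair a a) = (\<chi> k l. v $ k * v $ l)"
    and b: "conic_at (line_pair a a) v \<noteq> 0"
  shows "rank_le 6 T"
proof -
  define av where "av = (\<Sum>i\<in>UNIV. a $ i * v $ i)"
  have "conic_at (line_pair a a) v = av * av"
    by (simp add: conic_at_def line_pair_def sum_3 av_def field_simps)
  then have nz: "av \<noteq> 0" using b by auto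
  define x :: "complex ^ 3" where "x = (\<chi> i. a $ i / av)"
  have xv: "x $ 1 * v $ 1 + x $ 2 * v $ 2 + x $ 3 * v $ 3 = 1"
    using nz by (simp add: x_def add_divide_distrib[symmetric]) (simp add: av_def sum_3)
  have xx: "line_pair a a = (\<chi> i j. av * av * (x $ i * x $ j))"
    using nz by (simp add: line_pair_def x_def vec_eq_iff field_simps)
  have "\<exists>y z. y $ 1 * v $ 1 + y $ 2 * v $ 2 + y $ 3 * v $ 3 = 0
      \<and> z $ 1 * v $ 1 + z $ 2 * v $ 2 + z $ 3 * v $ 3 = 0
      \<and> det (vector [x, y, z] :: complex ^ 3 ^ 3) \<noteq> 0"
  proof -
    have "v $ 1 \<noteq> 0 \<or> v $ 2 \<noteq> 0 \<or> v $ 3 \<noteq> 0" using xv by auto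
    then consider "v $ 1 \<noteq> 0" | "v $ 2 \<noteq> 0" | "v $ 3 \<noteq> 0" by blast
    then show ?thesis
    proof cases
      case 1
      have "det (vector [x, vector [- v $ 2, v $ 1, 0], vector [- v $ 3, 0, v $ 1]] :: complex ^ 3 ^ 3) = v $ 1"
        using xv by (simp add: det_3) algebra
      then show ?thesis using 1
        by (intro exI[of _ "vector [- v $ 2, v $ 1, 0]"] exI[of _ "vector [- v $ 3, 0, v $ 1]"]) simp
    next
      case 2
      have "det (vector [x, vector [v $ 2, - v $ 1, 0], vector [0, - v $ 3, v $ 2]] :: complex ^ 3 ^ 3) = - v $ 2"
        using xv by (simp add: det_3) algebra
      then show ?thesis using 2
        by (intro exI[of _ "vector [v $ 2, - v $ 1, 0]"] exI[of _ "vector [0, - v $ 3, v $ 2]"]) simp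
    next
      case 3
      have "det (vector [x, vector [v $ 3, 0, - v $ 1], vector [0, v $ 3, - v $ 2]] :: complex ^ 3 ^ 3) = v $ 3"
        using xv by (simp add: det_3) algebra
      then show ?thesis using 3
        by (intro exI[of _ "vector [v $ 3, 0, - v $ 1]"] exI[of _ "vector [0, v $ 3, - v $ 2]"]) simp
    qed
  qed
  then obtain y z where yz: "y $ 1 * v $ 1 + y $ 2 * v $ 2 + y $ 3 * v $ 3 = 0"
    "z $ 1 * v $ 1 + z $ 2 * v $ 2 + z $ 3 * v $ 3 = 0"
    "det (vector [x, y, z] :: complex ^ 3 ^ 3) \<noteq> 0" by blast
  define P :: "complex ^ 3 ^ 3" where "P = vector [x, y, z]"
  have P: "invertible P" using yz by (simp add: invertible_det_nz P_def)
  have Pv: "P *v v = vector [1, 0, 0]"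
    using xv yz by (simp add: vec_eq_iff forall_3 matrix_vector_mult_def sum_3 P_def)
  define q0 :: "complex ^ 3 ^ 3" where "q0 = (\<chi> i j. if i = 1 \<and> j = 1 then av * av else 0)"
  have PD: "transpose P ** q0 ** P = line_pair a a"
    unfolding xx by (simp add: mat3_eq_iff matrix_matrix_mult_def transpose_def sum_3 P_def q0_def)
  have "contr (act P T) q0 = P ** (\<chi> k l. v $ k * v $ l) ** transpose P"
    unfolding contr_act PD D ..
  also have "\<dots> = (\<chi> k l. (P *v v) $ k * (P *v v) $ l)"
    by (simp add: mat3_eq_iff matrix_matrix_mult_def matrix_vector_mult_def transpose_def sum_3 algebra_simps)
  finally have "rank_le 6 (act P T)"
    using double_line_apolar[OF sym4_act[OF T(1)] nondeg_act[OF P T(2)], of "av * av" "P *v v"] Pv nz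
    by (simp add: q0_def)
  then show ?thesis using rank_le_act_iff[OF P] by blast
qed

lemma rank_le_nondeg:
  assumes T: "sym4 T" "nondeg T" and q: "symmat q" "contr T q = (\<chi> k l. v $ k * v $ l)"
    and b: "conic_at q v \<noteq> 0"
  shows "rank_le 6 T"
proof (cases "\<exists>d. q = line_pair d d")
  case True
  then show ?thesis using rank_le_nondeg_square[OF T] q b by blast
next
  case False
  then show ?thesis using rank_le_nondeg_not_square[OF T q b] by blast
qed

section \<open>Polynomial functions\<close>

text \<open>The algebra generated by \<open>G\<close> on an arbitrary domain, so that it covers
  polynomials in coordinates as well as polynomials in the parameters of a family.\<close>

inductive_set palg :: "('x \<Rightarrow> complex) set \<Rightarrow> ('x \<Rightarrow> complex) set" for G where
  palg_const: "(\<lambda>_. c) \<in> palg G"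
| palg_gen: "g \<in> G \<Longrightarrow> g \<in> palg G"
| palg_add: "f \<in> palg G \<Longrightarrow> g \<in> palg G \<Longrightarrow> (\<lambda>x. f x + g x) \<in> palg G"
| palg_mult: "f \<in> palg G \<Longrightarrow> g \<in> palg G \<Longrightarrow> (\<lambda>x. f x * g x) \<in> palg G"

abbreviation polynomial_functions :: "(complex ^ 'n \<Rightarrow> complex) set" where
  "polynomial_functions \<equiv> palg (range (\<lambda>i v. v $ i))"

lemma palg_sum: "(\<And>i. i \<in> A \<Longrightarrow> f i \<in> palg G) \<Longrightarrow> (\<lambda>x. \<Sum>i\<in>A. f i x) \<in> palg G"
  by (induction A rule: infinite_finite_induct) (auto intro: palg.intros)

lemma palg_prod: "(\<And>i. i \<in> A \<Longrightarrow> f i \<in> palg G) \<Longrightarrow> (\<lambda>x. \<Prod>i\<in>A. f i x) \<in> palg G"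
  by (induction A rule: infinite_finite_induct) (auto intro: palg.intros)

lemma palg_power: "f \<in> palg G \<Longrightarrow> (\<lambda>x. f x ^ n) \<in> palg G"
  by (induction n) (auto intro: palg.intros)

lemma palg_comp:
  assumes "f \<in> palg G" "\<And>g. g \<in> G \<Longrightarrow> (\<lambda>x. g (h x)) \<in> palg H"
  shows "(\<lambda>x. f (h x)) \<in> palg H"
  using assms(1) by induction (auto intro: palg.intros assms(2))

lemma monomial_at_polynomial: "monomial_at e \<in> polynomial_functions"
  unfolding monomial_at_def[abs_def] by (intro palg_prod palg_power palg_gen) auto

lemma palg_on_line:
  assumes "f \<in> polynomial_functions"
  shows "\<exists>p. \<forall>t. f (u + t *s (v - u)) = poly p t"
  using assms
proof induction
  case (palg_const c)
  then show ?case by (intro exI[of _ "[:c:]"]) simp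
next
  case (palg_gen g)
  then obtain i where "g = (\<lambda>v. v $ i)" by blast
  then show ?case by (intro exI[of _ "[:u $ i, v $ i - u $ i:]"]) (simp add: right_diff_distrib)
next
  case (palg_add f g)
  then obtain p q where "\<forall>t. f (u + t *s (v - u)) = poly p t" "\<forall>t. g (u + t *s (v - u)) = poly q t" by blast
  then show ?case by (intro exI[of _ "p + q"]) simp
next
  case (palg_mult f g)
  then obtain p q where "\<forall>t. f (u + t *s (v - u)) = poly p t" "\<forall>t. g (u + t *s (v - u)) = poly q t" by blast
  then show ?case by (intro exI[of _ "p * q"]) simp
qed

text \<open>Irreducibility of affine space: on the line through \<open>u\<close> and
  \<open>v\<close> both functions are nonzero univariate polynomials, and so is their
  product.\<close>

lemma polynomial_functions_common_nonzero:
  assumes f: "f \<in> polynomial_functions" "f u \<noteq> 0" and g: "g \<in> polynomial_functions" "g v \<noteq> 0"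
  shows "\<exists>x. f x \<noteq> 0 \<and> g x \<noteq> 0"
proof -
  obtain p where p: "\<And>t. f (u + t *s (v - u)) = poly p t" using palg_on_line[OF f(1)] by blast
  obtain q where q: "\<And>t. g (u + t *s (v - u)) = poly q t" using palg_on_line[OF g(1)] by blast
  have "poly p 0 \<noteq> 0" "poly q 1 \<noteq> 0" using p[of 0] q[of 1] f g by auto
  then have "p * q \<noteq> 0" by auto
  from ex_new_if_finite[OF infinite_UNIV_char_0 poly_roots_finite[OF this]]
  obtain t where "poly (p * q) t \<noteq> 0" by auto
  then show ?thesis using p[of t] q[of t] by (intro exI[of _ "u + t *s (v - u)"]) auto
qed

text \<open>Induction on the variables: as a polynomial in the variable \<open>i0\<close> the sum
  vanishes identically, so its coefficient of degree \<open>e0 i0\<close> is a vanishing sum in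
  fewer variables.\<close>

lemma power_products_independent:
  fixes a :: "('i \<Rightarrow> nat) \<Rightarrow> complex"
  assumes "finite I" "finite M" "\<forall>e\<in>M. \<forall>i. i \<notin> I \<longrightarrow> e i = 0"
    "\<forall>v. (\<Sum>e\<in>M. a e * (\<Prod>i\<in>I. v i ^ e i)) = 0" "e0 \<in> M"
  shows "a e0 = 0"
  using assms
proof (induction I arbitrary: M a e0 rule: finite_induct)
  case empty
  have "e i = 0" if "e \<in> M" for e i using empty.prems(2) that by blast
  then have "\<And>e. e \<in> M \<Longrightarrow> e = e0" using empty.prems(4) by (intro ext) metis
  then have "M = {e0}" using empty.prems by blast
  then show ?case using empty.prems by simp
next
  case (insert i0 I)
  define d where "d = e0 i0"
  define M0 where "M0 = {e \<in> M. e i0 = d}"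
  have zero: "(\<Sum>e\<in>M0. a e * (\<Prod>i\<in>I. v i ^ e i)) = 0" for v :: "'i \<Rightarrow> complex"
  proof -
    define p where "p = (\<Sum>e\<in>M. monom (a e * (\<Prod>i\<in>I. v i ^ e i)) (e i0))"
    have "poly p t = 0" for t
    proof -
      have "poly p t = (\<Sum>e\<in>M. a e * (\<Prod>i\<in>insert i0 I. (v(i0 := t)) i ^ e i))"
        unfolding p_def poly_sum poly_monom
      proof (intro sum.cong refl)
        fix e
        have "(\<Prod>i\<in>I. (v(i0 := t)) i ^ e i) = (\<Prod>i\<in>I. v i ^ e i)"
          using insert.hyps by (intro prod.cong) auto
        then show "a e * (\<Prod>i\<in>I. v i ^ e i) * t ^ e i0 = a e * (\<Prod>i\<in>insert i0 I. (v(i0 := t)) i ^ e i)"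
          using insert.hyps by simp
      qed
      then show ?thesis using insert.prems(3) by simp
    qed
    then have "p = 0" using poly_all_0_iff_0 by blast
    then have "0 = coeff p d" by simp
    also have "\<dots> = (\<Sum>e\<in>M. if e i0 = d then a e * (\<Prod>i\<in>I. v i ^ e i) else 0)"
      by (simp add: p_def coeff_sum)
    also have "\<dots> = (\<Sum>e\<in>M0. a e * (\<Prod>i\<in>I. v i ^ e i))"
      unfolding M0_def using insert.prems(1) by (simp add: sum.inter_filter)
    finally show ?thesis by simp
  qed
  \<comment> \<open>The exponent at \<open>i0\<close> is reset to 0 to meet the support condition of
    the induction hypothesis; nothing collapses, since it equals \<open>d\<close> throughout
    \<open>M0\<close>.\<close>
  define M' where "M' = (\<lambda>e. e(i0 := 0)) ` M0"
  define a' where "a' e = a (e(i0 := d))" for e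
  have inj: "inj_on (\<lambda>e. e(i0 := 0)) M0"
    by (rule inj_on_inverseI[where g = "\<lambda>e. e(i0 := d)"]) (auto simp: M0_def)
  have "(\<Sum>e\<in>M'. a' e * (\<Prod>i\<in>I. v i ^ e i)) = 0" for v :: "'i \<Rightarrow> complex"
  proof -
    have "(\<Sum>e\<in>M'. a' e * (\<Prod>i\<in>I. v i ^ e i))
        = (\<Sum>e\<in>M0. a' (e(i0 := 0)) * (\<Prod>i\<in>I. v i ^ (e(i0 := 0)) i))"
      unfolding M'_def by (subst sum.reindex[OF inj]) (simp add: o_def)
    also have "\<dots> = (\<Sum>e\<in>M0. a e * (\<Prod>i\<in>I. v i ^ e i))"
    proof (intro sum.cong refl)
      fix e assume "e \<in> M0"
      then have "e(i0 := d) = e" by (auto simp: M0_def)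
      moreover have "(\<Prod>i\<in>I. v i ^ (e(i0 := 0)) i) = (\<Prod>i\<in>I. v i ^ e i)"
        using insert.hyps by (intro prod.cong) auto
      ultimately show "a' (e(i0 := 0)) * (\<Prod>i\<in>I. v i ^ (e(i0 := 0)) i) = a e * (\<Prod>i\<in>I. v i ^ e i)"
        by (simp add: a'_def)
    qed
    finally show ?thesis using zero by simp
  qed
  moreover have "finite M'" using insert.prems(1) by (simp add: M'_def M0_def)
  moreover have "\<forall>e\<in>M'. \<forall>i. i \<notin> I \<longrightarrow> e i = 0" using insert.prems(2) by (auto simp: M'_def M0_def)
  moreover have "e0(i0 := 0) \<in> M'" using insert.prems(4) by (auto simp: M'_def M0_def d_def)
  ultimately have "a' (e0(i0 := 0)) = 0" using insert.IH[of M' a'] by blast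
  then show ?case by (simp add: a'_def d_def)
qed

lemma monomials_independent:
  fixes a :: "('n::finite \<Rightarrow> nat) \<Rightarrow> complex"
  assumes "finite M" "\<And>v. (\<Sum>e\<in>M. a e * monomial_at e v) = 0" "e0 \<in> M"
  shows "a e0 = 0"
proof (rule power_products_independent[of "UNIV :: 'n set" M])
  show "\<forall>v. (\<Sum>e\<in>M. a e * (\<Prod>i\<in>UNIV. v i ^ e i)) = 0"
  proof
    fix v :: "'n \<Rightarrow> complex"
    show "(\<Sum>e\<in>M. a e * (\<Prod>i\<in>UNIV. v i ^ e i)) = 0"
      using assms(2)[of "\<chi> i. v i"] by (simp add: monomial_at_def)
  qed
qed (use assms in auto)

definition monomial_sum :: "(complex ^ 'n::finite \<Rightarrow> complex) \<Rightarrow> bool" where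
  "monomial_sum f \<longleftrightarrow> (\<exists>M a. finite M \<and> f = (\<lambda>v. \<Sum>e\<in>M. a e * monomial_at e v))"

lemma monomial_sum_monomial: "monomial_sum (\<lambda>v. c * monomial_at e v)"
  unfolding monomial_sum_def by (intro exI[of _ "{e}"] exI[of _ "\<lambda>_. c"]) simp

lemma monomial_sum_add:
  assumes "monomial_sum f" "monomial_sum g"
  shows "monomial_sum (\<lambda>v. f v + g v)"
proof -
  obtain M a N b where f: "finite M" "f = (\<lambda>v. \<Sum>e\<in>M. a e * monomial_at e v)"
    and g: "finite N" "g = (\<lambda>v. \<Sum>e\<in>N. b e * monomial_at e v)"
    using assms unfolding monomial_sum_def by auto
  have "f v = (\<Sum>e\<in>M \<union> N. (if e \<in> M then a e else 0) * monomial_at e v)" for v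
    unfolding f by (rule sum.mono_neutral_cong_left) (use f g in auto)
  moreover have "g v = (\<Sum>e\<in>M \<union> N. (if e \<in> N then b e else 0) * monomial_at e v)" for v
    unfolding g by (rule sum.mono_neutral_cong_left) (use f g in auto)
  ultimately show ?thesis unfolding monomial_sum_def
    by (intro exI[of _ "M \<union> N"] exI[of _ "\<lambda>e. (if e \<in> M then a e else 0) + (if e \<in> N then b e else 0)"])
      (auto simp: f g sum.distrib distrib_right)
qed

lemma monomial_sum_0: "monomial_sum (\<lambda>v. 0)"
  unfolding monomial_sum_def by (intro exI[of _ "{}"]) simp

lemma monomial_sum_sum: "(\<And>i. i \<in> A \<Longrightarrow> monomial_sum (f i)) \<Longrightarrow> monomial_sum (\<lambda>v. \<Sum>i\<in>A. f i v)"
  by (induction A rule: infinite_finite_induct) (auto intro: monomial_sum_add monomial_sum_0)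

lemma polynomial_function_monomial_sum:
  fixes f :: "complex ^ 'n::finite \<Rightarrow> complex"
  assumes "f \<in> polynomial_functions" shows "monomial_sum f"
  using assms
proof induction
  case (palg_const c)
  show ?case unfolding monomial_sum_def
    by (intro exI[of _ "{\<lambda>_. 0}"] exI[of _ "\<lambda>_. c"]) (simp add: monomial_at_def)
next
  case (palg_gen g)
  then obtain i where g: "g = (\<lambda>v. v $ i)" by blast
  have "monomial_at (\<lambda>j. if j = i then 1 else 0) v = v $ i" for v :: "complex ^ 'n"
    by (simp add: monomial_at_def if_distrib cong: if_cong)
  then show ?case using monomial_sum_monomial[of 1 "\<lambda>j. if j = i then 1 else 0"] g by simp
next
  case (palg_add f g)
  then show ?case by (intro monomial_sum_add)
next
  case (palg_mult f g)
  then obtain M a N b where f: "finite M" "f = (\<lambda>v. \<Sum>e\<in>M. a e * monomial_at e v)"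
    and g: "finite N" "g = (\<lambda>v. \<Sum>e\<in>N. b e * monomial_at e v)"
    unfolding monomial_sum_def by auto
  have "f v * g v = (\<Sum>e\<in>M. \<Sum>e'\<in>N. (a e * b e') * monomial_at (\<lambda>i. e i + e' i) v)" for v
    by (simp add: f g sum_product monomial_at_def power_add prod.distrib mult_ac)
  then show ?case by (simp add: monomial_sum_sum monomial_sum_monomial)
qed

section \<open>Polynomials on projective points and Zariski closures\<close>

lemma line_of_scale: "v \<in> line_of p \<Longrightarrow> c *s v \<in> line_of p"
  using line_of[of p] by (auto intro: vec.subspace_scale)

text \<open>A polynomial vanishing on a cone has all its homogeneous components vanishing on it.\<close>

lemma polynomial_vanishes_on_closure:
  fixes f :: "complex ^ 'a::finite \<Rightarrow> complex"
  assumes f: "f \<in> polynomial_functions" and S: "\<And>p v. p \<in> S \<Longrightarrow> v \<in> line_of p \<Longrightarrow> f v = 0"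
    and p: "p \<in> zariski_closure S" and v: "v \<in> line_of p"
  shows "f v = 0"
proof -
  obtain M a where M: "finite M" "f = (\<lambda>v. \<Sum>e\<in>M. a e * monomial_at e v)"
    using polynomial_function_monomial_sum[OF f] unfolding monomial_sum_def by auto
  define deg where "deg e = (\<Sum>i\<in>UNIV. e i)" for e :: "'a \<Rightarrow> nat"
  define comp where "comp d v = (\<Sum>e\<in>{e \<in> M. deg e = d}. a e * monomial_at e v)" for d and v :: "complex ^ 'a"
  have form: "is_form d (comp d)" for d
    unfolding is_form_def comp_def[abs_def]
    by (intro exI[of _ "{e \<in> M. deg e = d}"] exI[of _ a]) (use M in \<open>auto simp: deg_def\<close>)
  have comp0: "comp d v = 0" if "p \<in> S" "v \<in> line_of p" for d p v
  proof -
    \<comment> \<open>\<open>f (c *s v)\<close> as a polynomial in \<open>c\<close>: it vanishes for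
      all \<open>c\<close>, and its coefficients are the homogeneous components of \<open>f\<close>
      at \<open>v\<close>.\<close>
    define q where "q = (\<Sum>e\<in>M. monom (a e * monomial_at e v) (deg e))"
    have "poly q c = f (c *s v)" for c
      by (simp add: q_def M poly_sum poly_monom monomial_at_def deg_def power_mult_distrib prod.distrib
          power_sum mult_ac)
    then have "poly q c = 0" for c using S[OF that(1) line_of_scale[OF that(2)]] by simp
    then have "q = 0" using poly_all_0_iff_0 by blast
    then have "0 = coeff q d" by simp
    also have "\<dots> = comp d v"
      using M(1) by (simp add: q_def comp_def coeff_sum sum.inter_filter)
    finally show ?thesis by simp
  qed
  have "zariski_closed {p. \<forall>f\<in>range comp. \<forall>v\<in>line_of p. f v = 0}"
    unfolding zariski_closed_def by (intro exI[of _ "range comp"]) (use form in auto)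
  moreover have "S \<subseteq> {p. \<forall>f\<in>range comp. \<forall>v\<in>line_of p. f v = 0}" using comp0 by auto
  ultimately have "zariski_closure S \<subseteq> {p. \<forall>f\<in>range comp. \<forall>v\<in>line_of p. f v = 0}"
    by (rule hull_minimal[rotated])
  then have "comp d v = 0" for d using p v by auto
  moreover have "f v = (\<Sum>d\<in>deg ` M. comp d v)"
    unfolding comp_def M by (rule sum.group[symmetric]) (use M in auto)
  ultimately show ?thesis by simp
qed

lemma form_polynomial: "is_form d f \<Longrightarrow> f \<in> polynomial_functions"
  unfolding is_form_def
  by (auto intro!: palg_sum palg_mult palg_const monomial_at_polynomial)

lemma exists_line_of_nonzero: "\<exists>v\<in>line_of p. v \<noteq> 0"
proof (rule ccontr)
  assume "\<not> ?thesis"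
  then have "line_of p \<subseteq> {0}" by blast
  then have "vec.dim (line_of p) = 0" by (metis vec.dim_eq_0)
  moreover have "vec.dim (line_of p) = 1" using line_of[of p] by blast
  ultimately show False by linarith
qed

lemma line_of_eq_span:
  assumes "v \<in> line_of p" "v \<noteq> 0" shows "line_of p = vec.span {v}"
proof -
  have p: "vec.subspace (line_of p)" "vec.dim (line_of p) = 1" using line_of[of p] by auto
  have "vec.independent {v}" using assms by simp
  then have "line_of p \<subseteq> vec.span {v}"
    using assms p vec.card_ge_dim_independent[of "{v}" "line_of p"] by simp
  moreover have "vec.span {v} \<subseteq> line_of p" using assms p by (intro vec.span_minimal) auto
  ultimately show ?thesis by blast
qed

text \<open>Meaningful for \<open>v \<noteq> 0\<close> only; at 0 the value of \<open>Proj\<close>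
  is unspecified.\<close>

definition point :: "complex ^ 'n::finite \<Rightarrow> 'n proj" where
  "point v = Proj (vec.span {v})"

lemma line_of_point: "v \<noteq> 0 \<Longrightarrow> line_of (point v) = vec.span {v}"
  unfolding point_def
  by (rule Proj_inverse) (metis (mono_tags) mem_Collect_eq vec.dim_singleton vec.dim_span vec.subspace_span)

lemma point_eqI: "v \<in> line_of p \<Longrightarrow> v \<noteq> 0 \<Longrightarrow> p = point v"
  by (metis line_of_eq_span line_of_inject line_of_point)

text \<open>A form that vanishes on a closed set containing \<open>S\<close> but not everywhere
  would be nonzero at a common point with \<open>G\<close>. By \<open>G 0 = 0\<close> that point is
  a nonzero vector, as \<open>point\<close> requires.\<close>

lemma zariski_closure_UNIV:
  assumes G: "G \<in> polynomial_functions" "G u \<noteq> 0" "G 0 = 0"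
    and S: "\<And>v. G v \<noteq> 0 \<Longrightarrow> point v \<in> S"
  shows "zariski_closure S = UNIV"
proof -
  have "Z = UNIV" if "zariski_closed Z" "S \<subseteq> Z" for Z
  proof -
    obtain F where F: "\<And>f. f \<in> F \<Longrightarrow> \<exists>d. is_form d f" "Z = {p. \<forall>f\<in>F. \<forall>v\<in>line_of p. f v = 0}"
      using \<open>zariski_closed Z\<close> unfolding zariski_closed_def by blast
    have "f w = 0" if fF: "f \<in> F" for f w
    proof (rule ccontr)
      assume w: "f w \<noteq> 0"
      obtain d where "is_form d f" using F(1)[OF fF] by blast
      from polynomial_functions_common_nonzero[OF form_polynomial[OF this] w G(1,2)]
      obtain x where x: "f x \<noteq> 0" "G x \<noteq> 0" by blast
      then have "x \<noteq> 0" using G(3) by auto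
      have "point x \<in> Z" using S x \<open>S \<subseteq> Z\<close> by blast
      moreover have "x \<in> line_of (point x)" using \<open>x \<noteq> 0\<close> by (simp add: line_of_point vec.span_base)
      ultimately show False using F(2) fF x by blast
    qed
    then show ?thesis using F(2) by auto
  qed
  then show ?thesis by (auto simp: hull_def)
qed

section \<open>Quartics as tensors\<close>

definition exps :: "3 \<Rightarrow> 3 \<Rightarrow> 3 \<Rightarrow> 3 \<Rightarrow> quartic_exponent" where
  "exps i j k l = Quartic_Exponent (\<lambda>m. of_bool (m = i) + of_bool (m = j) + of_bool (m = k) + of_bool (m = l))"

text \<open>No multinomial factors occur: the Veronese coordinates are bare monomials, so the image
  of \<open>v\<close> becomes the plain fourth tensor power of \<open>v\<close>.\<close>

definition tens :: "complex ^ quartic_exponent \<Rightarrow> tensor4" where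
  "tens w i j k l = w $ exps i j k l"

lemma exponent_exps:
  "exponent (exps i j k l) = (\<lambda>m. of_bool (m = i) + of_bool (m = j) + of_bool (m = k) + of_bool (m = l))"
  unfolding exps_def by (rule Quartic_Exponent_inverse) (simp add: sum.distrib of_bool_def)

lemma sym4_tens: "sym4 (tens w)"
  by (simp add: sym4_def tens_def exps_def add_ac)

lemma tens_quartic_monomials: "tens (quartic_monomials v) = pow4 v"
proof (intro ext)
  have 1: "(\<Prod>m\<in>UNIV. v $ m ^ of_bool (m = i)) = v $ i" for i
    by (simp add: of_bool_def if_distrib cong: if_cong)
  show "tens (quartic_monomials v) i j k l = pow4 v i j k l" for i j k l
    by (simp add: tens_def quartic_monomials_def monomial_at_def exponent_exps power_add prod.distrib 1 pow4_def)
qed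

lemma exps_surj: "\<exists>i j k l. e = exps i j k l"
proof -
  have step: "\<exists>i g. f = (\<lambda>m. g m + of_bool (m = i)) \<and> (\<Sum>m\<in>UNIV. g m) = n"
    if "(\<Sum>m\<in>UNIV. f m) = Suc n" for f :: "3 \<Rightarrow> nat" and n
  proof -
    have "\<exists>i. f i \<noteq> 0"
    proof (rule ccontr)
      assume "\<not> ?thesis"
      then show False using that by simp
    qed
    then obtain i where i: "f i \<noteq> 0" by blast
    define g where "g = (\<lambda>m. f m - of_bool (m = i))"
    have fg: "f = (\<lambda>m. g m + of_bool (m = i))" using i by (auto simp: g_def of_bool_def)
    have "(\<Sum>m\<in>UNIV. f m) = (\<Sum>m\<in>UNIV. g m) + 1"
      by (subst fg) (simp add: sum.distrib of_bool_def)
    then show ?thesis using fg that by (intro exI[of _ i] exI[of _ g]) auto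
  qed
  have "(\<Sum>m\<in>UNIV. exponent e m) = Suc 3" using exponent[of e] by simp
  from step[OF this] obtain l f1 where 1: "exponent e = (\<lambda>m. f1 m + of_bool (m = l))" "sum f1 UNIV = Suc 2"
    by auto
  from step[OF 1(2)] obtain k f2 where 2: "f1 = (\<lambda>m. f2 m + of_bool (m = k))" "sum f2 UNIV = Suc 1"
    by auto
  from step[OF 2(2)] obtain j f3 where 3: "f2 = (\<lambda>m. f3 m + of_bool (m = j))" "sum f3 UNIV = Suc 0"
    by auto
  from step[OF 3(2)] obtain i f4 where 4: "f3 = (\<lambda>m. f4 m + of_bool (m = i))" "sum f4 UNIV = 0"
    by auto
  have "f4 = (\<lambda>_. 0)" using 4(2) by auto
  then have "exponent e = exponent (exps i j k l)"
    unfolding 1(1) 2(1) 3(1) 4(1) exponent_exps by simp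
  then show ?thesis by (metis exponent_inject)
qed

lemma tens_eqD: "tens w = tens w' \<Longrightarrow> w = w'"
  by (metis exps_surj tens_def vec_eq_iff)

lemma tens_add: "tens (v + w) i j k l = tens v i j k l + tens w i j k l"
  by (simp add: tens_def)

lemma tens_scale: "tens (c *s w) i j k l = c * tens w i j k l"
  by (simp add: tens_def)

lemma tens_0: "tens 0 i j k l = 0" by (simp add: tens_def)

lemma tens_sum: "tens (sum f A) i j k l = (\<Sum>x\<in>A. tens (f x) i j k l)"
  by (simp add: tens_def)

text \<open>Otherwise the polynomial \<open>conic_at (D v) v\<close>, with \<open>D v\<close> the conic dual to \<open>v\<close>, has zero
  coefficients; pairing them with the quartic itself would give the trace of the identity on the
  six-dimensional space of conics.\<close>

lemma nondeg_dual_conic: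
  assumes T: "nondeg (tens w)"
  shows "\<exists>v q. symmat q \<and> contr (tens w) q = (\<chi> k l. v $ k * v $ l) \<and> conic_at q v \<noteq> 0"
proof (rule ccontr)
  assume no: "\<not> ?thesis"
  have "\<forall>i j. \<exists>q. symmat q \<and> contr (tens w) q = line_pair (axis i 1) (axis j 1)"
    using nondeg_solve[OF sym4_tens T symmat_line_pair] by metis
  then obtain D where D: "\<And>i j. symmat (D i j)"
    "\<And>i j. contr (tens w) (D i j) = line_pair (axis i 1) (axis j 1)" by metis
  define f where "f x = (case x of (i, j, k, l) \<Rightarrow> D i j $ k $ l)" for x
  define ex where "ex x = (case x of (i, j, k, l) \<Rightarrow> exps i j k l)" for x
  have zero: "(\<Sum>x\<in>UNIV. f x * (case x of (i, j, k, l) \<Rightarrow> pow4 v i j k l)) = 0" for v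
  proof -
    \<comment> \<open>The dual conic of \<open>v\<close>, assembled linearly from the conics dual to
      products of unit vectors.\<close>
    define q where "q = (\<chi> k l. \<Sum>i\<in>UNIV. \<Sum>j\<in>UNIV. v $ i * v $ j * D i j $ k $ l)"
    have "symmat q" using D(1) by (simp add: q_def symmat_def)
    moreover have "contr (tens w) q = (\<chi> k l. \<Sum>i\<in>UNIV. \<Sum>j\<in>UNIV. v $ i * v $ j * contr (tens w) (D i j) $ k $ l)"
      by (simp add: contr_def q_def sum_3 vec_eq_iff algebra_simps)
    then have "contr (tens w) q = (\<chi> k l. v $ k * v $ l)"
      by (simp add: D(2) line_pair_def axis_def mat3_eq_iff forall_3 sum_3)
    ultimately have "conic_at q v = 0" using no by blast
    moreover have "conic_at q v = (\<Sum>i\<in>UNIV. \<Sum>j\<in>UNIV. \<Sum>k\<in>UNIV. \<Sum>l\<in>UNIV. D i j $ k $ l * pow4 v i j k l)"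
      by (simp add: conic_at_def q_def pow4_def sum_3 algebra_simps)
    ultimately show ?thesis by (simp add: f_def sum.cartesian_product split_def)
  qed
  define b where "b e = (\<Sum>x\<in>{x. exponent (ex x) = e}. f x)" for e
  have "(\<Sum>e\<in>range (exponent \<circ> ex). b e * monomial_at e v) = 0" for v
  proof -
    have "(\<Sum>e\<in>range (exponent \<circ> ex). b e * monomial_at e v)
        = (\<Sum>e\<in>range (exponent \<circ> ex). \<Sum>x\<in>{x \<in> UNIV. (exponent \<circ> ex) x = e}. f x * monomial_at ((exponent \<circ> ex) x) v)"
      by (intro sum.cong refl) (auto simp: b_def sum_distrib_right intro: sum.cong)
    also have "\<dots> = (\<Sum>x\<in>UNIV. f x * monomial_at ((exponent \<circ> ex) x) v)"
      by (rule sum.group) auto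
    also have "\<dots> = (\<Sum>x\<in>UNIV. f x * (case x of (i, j, k, l) \<Rightarrow> pow4 v i j k l))"
      by (intro sum.cong refl)
        (auto simp: ex_def tens_quartic_monomials[symmetric] tens_def quartic_monomials_def)
    finally show ?thesis using zero by simp
  qed
  then have b0: "b e = 0" if "e \<in> range (exponent \<circ> ex)" for e
    using monomials_independent[of "range (exponent \<circ> ex)" b e] that by simp
  have "(\<Sum>x\<in>UNIV. f x * w $ ex x)
      = (\<Sum>e\<in>range (exponent \<circ> ex). \<Sum>x\<in>{x \<in> UNIV. (exponent \<circ> ex) x = e}. f x * w $ ex x)"
    by (rule sum.group[symmetric]) auto
  also have "\<dots> = (\<Sum>e\<in>range (exponent \<circ> ex). b e * w $ Quartic_Exponent e)"
  proof (rule sum.cong[OF refl])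
    fix e
    show "(\<Sum>x\<in>{x \<in> UNIV. (exponent \<circ> ex) x = e}. f x * w $ ex x) = b e * w $ Quartic_Exponent e"
      unfolding b_def sum_distrib_right by (rule sum.cong) (auto simp: exponent_inverse)
  qed
  also have "\<dots> = 0" using b0 by simp
  finally have "(\<Sum>x\<in>UNIV. f x * w $ ex x) = 0" .
  moreover have "(\<Sum>x\<in>UNIV. f x * w $ ex x)
      = (\<Sum>i\<in>UNIV. \<Sum>j\<in>UNIV. \<Sum>k\<in>UNIV. \<Sum>l\<in>UNIV. D i j $ k $ l * tens w i j k l)"
    by (simp add: f_def ex_def tens_def sum.cartesian_product split_def)
  moreover have "\<dots> = (\<Sum>i\<in>UNIV. \<Sum>j\<in>UNIV. contr (tens w) (D i j) $ i $ j)"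
  proof -
    have "tens w i j k l = tens w k l i j" for i j k l
      using sym4_tens[of w] unfolding sym4_def by metis
    then show ?thesis by (simp add: contr_def)
  qed
  \<comment> \<open>The three diagonal index pairs contribute 1 each, the six others 1/2
    each.\<close>
  moreover have "\<dots> = 6" by (simp add: D(2) line_pair_def axis_def sum_3)
  ultimately show False by simp
qed

text \<open>If no third row fits, \<open>a\<close> and \<open>b\<close> are parallel: either
  \<open>a = 0\<close> or \<open>b\<close> is \<open>s^2\<close> times \<open>a\<close>, and in both
  cases the product is a square.\<close>

lemma invertible_with_rows:
  assumes nsq: "\<And>d. line_pair a b \<noteq> line_pair d d"
  shows "\<exists>c. invertible (vector [a, b, c] :: complex ^ 3 ^ 3)"
proof (rule ccontr)
  assume "\<not> ?thesis"
  then have "det (vector [a, b, axis i 1] :: complex ^ 3 ^ 3) = 0" for i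
    by (auto simp: invertible_det_nz)
  from this[of 1] this[of 2] this[of 3]
  have "\<forall>i j. a $ i * b $ j = a $ j * b $ i"
    by (simp add: det_3 axis_def forall_3 algebra_simps)
  then have par: "a $ i * b $ j = a $ j * b $ i" for i j by blast
  show False
  proof (cases "a = 0")
    case True
    then have "line_pair a b = line_pair 0 0" by (simp add: line_pair_def)
    then show False using nsq by blast
  next
    case False
    then obtain i where i: "a $ i \<noteq> 0" by (auto simp: vec_eq_iff)
    obtain s where s: "s\<^sup>2 = b $ i / a $ i" using complex_sqrt_exists by blast
    have b: "b $ j = s\<^sup>2 * a $ j" for j using par[of i j] i by (simp add: s field_simps)
    have "line_pair a b = line_pair (\<chi> j. s * a $ j) (\<chi> j. s * a $ j)"
      by (simp add: line_pair_def vec_eq_iff b power2_eq_square algebra_simps)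
    then show False using nsq by blast
  qed
qed

section \<open>Rank at most six outside the overdegenerate quartics, rank at least six for
  nondegenerate ones\<close>

definition overdegenerate :: "tensor4 \<Rightarrow> bool" where
  "overdegenerate T \<longleftrightarrow> (\<exists>p q. symmat p \<and> symmat q \<and> contr T p = 0 \<and> contr T q = 0
      \<and> (\<forall>a b. (\<chi> i j. a * p $ i $ j + b * q $ i $ j) = (0 :: complex ^ 3 ^ 3) \<longrightarrow> a = 0 \<and> b = 0))
    \<or> (\<exists>a. a \<noteq> 0 \<and> contr T (line_pair a a) = 0)"

lemma rank_le_6_or_overdegenerate: "rank_le 6 (tens w) \<or> overdegenerate (tens w)"
proof (cases "nondeg (tens w)")
  case True
  then show ?thesis using nondeg_dual_conic rank_le_nondeg sym4_tens by metis
next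
  case False
  then obtain q where q: "symmat q" "contr (tens w) q = 0" "q \<noteq> 0" by (auto simp: nondeg_def)
  show ?thesis
  proof (cases "kernel_spanned_by (tens w) q")
    case False
    then obtain p where p: "symmat p" "contr (tens w) p = 0" "\<And>c. p \<noteq> (\<chi> i j. c * q $ i $ j)"
      using q by (auto simp: kernel_spanned_by_def)
    have "a = 0 \<and> b = 0" if "(\<chi> i j. a * p $ i $ j + b * q $ i $ j) = (0 :: complex ^ 3 ^ 3)" for a b
    proof -
      have e: "a * p $ i $ j + b * q $ i $ j = 0" for i j using that by (simp add: mat3_eq_iff)
      have "a = 0"
      proof (rule ccontr)
        assume a: "a \<noteq> 0"
        have "p $ i $ j = (- b / a) * q $ i $ j" for i j
          using e[of i j] a by (simp add: field_simps eq_neg_iff_add_eq_0)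
        then have "p = (\<chi> i j. (- b / a) * q $ i $ j)" by (simp add: mat3_eq_iff)
        then show False using p(3) by blast
      qed
      moreover from this have "b = 0" using e q(3) by (auto simp: mat3_eq_iff)
      ultimately show ?thesis by blast
    qed
    then show ?thesis unfolding overdegenerate_def using p q by blast
  next
    case True
    show ?thesis
    proof (cases "\<exists>d. q = line_pair d d")
      case True
      then obtain d where d: "q = line_pair d d" by blast
      then have "d \<noteq> 0" using q(3) by (auto simp: line_pair_def vec_eq_iff)
      then show ?thesis using d q(2) by (auto simp: overdegenerate_def)
    next
      case nsq: False
      from conic_normal_form[OF q(1)] show ?thesis
      proof (elim disjE exE conjE)
        fix P assume P: "invertible P" "q = transpose P ** smooth_conic ** P"
        have "rank_le 5 (act P (tens w))"
          by (rule rank_le_smooth_conic[OF sym4_act[OF sym4_tens] kernel_spanned_by_act[OF P True]])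
        then have "rank_le 5 (tens w)" by (simp add: rank_le_act_iff[OF P(1)])
        then show ?thesis using rank_le_mono by fastforce
      next
        fix a b assume ab: "q = line_pair a b"
        then obtain c where P: "invertible (vector [a, b, c] :: complex ^ 3 ^ 3)"
          using invertible_with_rows nsq by blast
        define P where "P = (vector [a, b, c] :: complex ^ 3 ^ 3)"
        have "q = transpose P ** nodal_conic ** P"
          by (simp add: ab mat3_eq_iff matrix_matrix_mult_def transpose_def sum_3 P_def nodal_conic_def
              line_pair_def field_simps)
        then have "rank_le 6 (act P (tens w))"
          using rank_le_nodal_conic[OF sym4_act[OF sym4_tens] kernel_spanned_by_act[OF _ _ True]] P
          by (simp add: P_def)
        then show ?thesis using rank_le_act_iff P by (simp add: P_def)
      qed
    qed
  qed
qed

lemma rank_le_5_not_nondeg: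
  assumes "rank_le 5 T" shows "\<not> nondeg T"
proof -
  obtain xs where xs: "length xs \<le> 5" "\<And>i j k l. T i j k l = (\<Sum>(c, v)\<leftarrow>xs. c * pow4 v i j k l)"
    using assms by (auto simp: rank_le_def)
  define m where "m v n = [v $ 1 * v $ 1, v $ 1 * v $ 2, v $ 1 * v $ 3, v $ 2 * v $ 2, v $ 2 * v $ 3, v $ 3 * v $ 3] ! n"
    for v :: "complex ^ 3" and n
  have sum6: "(\<Sum>n<6. g n) = g 0 + g 1 + g 2 + g 3 + g 4 + g (5::nat)" for g :: "nat \<Rightarrow> complex"
    by (simp add: eval_nat_numeral)
  have "card {..<length xs} < card {..<6::nat}" using xs(1) by simp
  then obtain x where x: "\<exists>n\<in>{..<6}. x n \<noteq> 0" "\<forall>t\<in>{..<length xs}. (\<Sum>n\<in>{..<6}. m (snd (xs ! t)) n * x n) = 0"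
    using homogeneous_system_nontrivial_solution[of "{..<length xs}" "{..<6}" "\<lambda>t n. m (snd (xs ! t)) n"] by auto
  define q :: "complex ^ 3 ^ 3" where "q = vector [vector [x 0, x 1 / 2, x 2 / 2],
    vector [x 1 / 2, x 3, x 4 / 2], vector [x 2 / 2, x 4 / 2, x 5]]"
  have "conic_at q v = (\<Sum>n<6. m v n * x n)" for v
    by (simp add: conic_at_def q_def sum_3 sum6 m_def algebra_simps)
  then have on: "conic_at q v = 0" if "(c, v) \<in> set xs" for c v
    using x(2) that by (metis in_set_conv_nth lessThan_iff snd_conv)
  have "contr T q = 0"
  proof -
    have "T = (\<lambda>i j k l. \<Sum>(c, v)\<leftarrow>xs. c * pow4 v i j k l)" using xs(2) by (intro ext)
    moreover have "contr (\<lambda>i j k l. \<Sum>(c, v)\<leftarrow>xs. c * pow4 v i j k l) q = 0" using on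
    proof (induction xs)
      case Nil
      then show ?case by (simp add: contr_def vec_eq_iff)
    next
      case (Cons y ys)
      obtain c v where y: "y = (c, v)" by (cases y)
      have "contr (\<lambda>i j k l. \<Sum>(c, v)\<leftarrow>ys. c * pow4 v i j k l) q = 0" by (rule Cons.IH) (use Cons.prems in auto)
      moreover have "contr (\<lambda>i j k l. \<Sum>(c, v)\<leftarrow>y # ys. c * pow4 v i j k l) q
          = (\<chi> k l. contr (\<lambda>i j k l. \<Sum>(c, v)\<leftarrow>ys. c * pow4 v i j k l) q $ k $ l + c * contr (pow4 v) q $ k $ l)"
        by (simp add: contr_def vec_eq_iff y sum_3 algebra_simps)
      moreover have "conic_at q v = 0" using Cons.prems[of c v] y by simp
      ultimately show ?case by (simp add: contr_pow4 vec_eq_iff)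
    qed
    ultimately show ?thesis by simp
  qed
  moreover have "symmat q" by (simp add: symmat_def forall_3 q_def)
  moreover have "q \<noteq> 0"
  proof
    assume "q = 0"
    then have "q $ i $ j = 0" for i j by simp
    from this[of 1 1] this[of 1 2] this[of 1 3] this[of 2 2] this[of 2 3] this[of 3 3]
    have "x 0 = 0" "x 1 = 0" "x 2 = 0" "x 3 = 0" "x 4 = 0" "x 5 = 0" by (simp_all add: q_def)
    moreover obtain n where "n < 6" "x n \<noteq> 0" using x(1) by auto
    moreover have "n = 0 \<or> n = 1 \<or> n = 2 \<or> n = 3 \<or> n = 4 \<or> n = 5" using \<open>n < 6\<close> by linarith
    ultimately show False by auto
  qed
  ultimately show ?thesis by (auto simp: nondeg_def)
qed

section \<open>Algebraic dependence\<close>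

definition gen_monomial :: "('x \<Rightarrow> complex) set \<Rightarrow> (('x \<Rightarrow> complex) \<Rightarrow> nat) \<Rightarrow> 'x \<Rightarrow> complex" where
  "gen_monomial G e x = (\<Prod>g\<in>G. g x ^ e g)"

text \<open>Each exponent is bounded separately, not the total degree: the count is then a pure
  power, and bounds still add under multiplication. Extensional functions make the set
  finite.\<close>

definition bounded_exponents :: "('x \<Rightarrow> complex) set \<Rightarrow> nat \<Rightarrow> (('x \<Rightarrow> complex) \<Rightarrow> nat) set" where
  "bounded_exponents G K = (\<Pi>\<^sub>E g\<in>G. {..K})"

definition palg_le :: "('x \<Rightarrow> complex) set \<Rightarrow> nat \<Rightarrow> ('x \<Rightarrow> complex) set" where
  "palg_le G K = {f. \<exists>c. f = (\<lambda>x. \<Sum>e\<in>bounded_exponents G K. c e * gen_monomial G e x)}"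

lemma finite_bounded_exponents: "finite G \<Longrightarrow> finite (bounded_exponents G K)"
  unfolding bounded_exponents_def by (rule finite_PiE) auto

lemma card_bounded_exponents: "finite G \<Longrightarrow> card (bounded_exponents G K) = Suc K ^ card G"
  unfolding bounded_exponents_def by (simp add: card_PiE)

lemma palg_le_add:
  assumes "f \<in> palg_le G K" "g \<in> palg_le G K"
  shows "(\<lambda>x. f x + g x) \<in> palg_le G K"
proof -
  obtain c d where "f = (\<lambda>x. \<Sum>e\<in>bounded_exponents G K. c e * gen_monomial G e x)"
    "g = (\<lambda>x. \<Sum>e\<in>bounded_exponents G K. d e * gen_monomial G e x)"
    using assms by (auto simp: palg_le_def)
  then show ?thesis unfolding palg_le_def
    by (auto intro!: exI[of _ "\<lambda>e. c e + d e"] simp: sum.distrib distrib_right)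
qed

lemma palg_le_scale:
  assumes "f \<in> palg_le G K"
  shows "(\<lambda>x. a * f x) \<in> palg_le G K"
proof -
  obtain c where "f = (\<lambda>x. \<Sum>e\<in>bounded_exponents G K. c e * gen_monomial G e x)"
    using assms by (auto simp: palg_le_def)
  then show ?thesis unfolding palg_le_def
    by (auto intro!: exI[of _ "\<lambda>e. a * c e"] simp: sum_distrib_left mult.assoc)
qed

lemma palg_le_0: "(\<lambda>x. 0) \<in> palg_le G K"
  unfolding palg_le_def by (auto intro!: exI[of _ "\<lambda>e. 0"])

lemma palg_le_sum:
  "(\<And>i. i \<in> A \<Longrightarrow> f i \<in> palg_le G K) \<Longrightarrow> (\<lambda>x. \<Sum>i\<in>A. f i x) \<in> palg_le G K"
  by (induction A rule: infinite_finite_induct) (auto intro: palg_le_add palg_le_0)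

lemma gen_monomial_palg_le:
  assumes "finite G" "\<And>g. g \<in> G \<Longrightarrow> e g \<le> K"
  shows "gen_monomial G e \<in> palg_le G K"
proof -
  define e' where "e' = restrict e G"
  have e': "e' \<in> bounded_exponents G K" using assms(2) by (auto simp: e'_def bounded_exponents_def)
  have "gen_monomial G e x = (\<Sum>d\<in>bounded_exponents G K. (if d = e' then 1 else 0) * gen_monomial G d x)" for x
  proof -
    have "(\<Sum>d\<in>bounded_exponents G K. (if d = e' then 1 else 0) * gen_monomial G d x)
        = (\<Sum>d\<in>bounded_exponents G K. if d = e' then gen_monomial G d x else 0)"
      by (intro sum.cong) auto
    also have "\<dots> = gen_monomial G e' x" using e' finite_bounded_exponents[OF assms(1)] by simp
    also have "\<dots> = gen_monomial G e x" unfolding gen_monomial_def e'_def by (intro prod.cong) auto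
    finally show ?thesis by simp
  qed
  then show ?thesis unfolding palg_le_def by (intro CollectI exI[of _ "\<lambda>d. if d = e' then 1 else 0"]) auto
qed

lemma palg_le_mono:
  assumes "finite G" "K \<le> L" "f \<in> palg_le G K" shows "f \<in> palg_le G L"
proof -
  obtain c where f: "f = (\<lambda>x. \<Sum>e\<in>bounded_exponents G K. c e * gen_monomial G e x)"
    using assms(3) by (auto simp: palg_le_def)
  have "gen_monomial G e \<in> palg_le G L" if "e \<in> bounded_exponents G K" for e
    by (rule gen_monomial_palg_le[OF assms(1)]) (use that assms(2) in \<open>force simp: bounded_exponents_def dest: PiE_mem\<close>)
  then show ?thesis unfolding f by (intro palg_le_sum palg_le_scale)
qed

lemma palg_le_mult:
  assumes G: "finite G" and "f \<in> palg_le G K" "g \<in> palg_le G L"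
  shows "(\<lambda>x. f x * g x) \<in> palg_le G (K + L)"
proof -
  obtain c d where fg: "f = (\<lambda>x. \<Sum>e\<in>bounded_exponents G K. c e * gen_monomial G e x)"
    "g = (\<lambda>x. \<Sum>e\<in>bounded_exponents G L. d e * gen_monomial G e x)"
    using assms by (auto simp: palg_le_def)
  have "f x * g x = (\<Sum>e\<in>bounded_exponents G K. \<Sum>e'\<in>bounded_exponents G L.
      (c e * d e') * gen_monomial G (\<lambda>h. e h + e' h) x)" for x
    by (simp add: fg sum_product gen_monomial_def power_add prod.distrib mult_ac)
  moreover have "gen_monomial G (\<lambda>h. e h + e' h) \<in> palg_le G (K + L)"
    if "e \<in> bounded_exponents G K" "e' \<in> bounded_exponents G L" for e e'
    by (rule gen_monomial_palg_le[OF G]) (use that in \<open>fastforce simp: bounded_exponents_def intro: add_mono\<close>)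
  ultimately show ?thesis by (simp add: palg_le_sum palg_le_scale)
qed

lemma palg_le_const: "finite G \<Longrightarrow> (\<lambda>x. c) \<in> palg_le G 0"
  using palg_le_scale[OF gen_monomial_palg_le[of G "\<lambda>_. 0" 0], of c] by (simp add: gen_monomial_def)

lemma palg_le_power:
  assumes "finite G" "f \<in> palg_le G K" shows "(\<lambda>x. f x ^ n) \<in> palg_le G (n * K)"
  by (induction n) (use assms in \<open>auto intro: palg_le_const palg_le_mult\<close>)

lemma palg_le_prod:
  assumes "finite G" "finite A" "\<And>i. i \<in> A \<Longrightarrow> f i \<in> palg_le G (k i)"
  shows "(\<lambda>x. \<Prod>i\<in>A. f i x) \<in> palg_le G (\<Sum>i\<in>A. k i)"
  using assms(2,3) by (induction A rule: finite_induct) (use assms(1) in \<open>auto intro: palg_le_const palg_le_mult\<close>)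

lemma palg_bounded:
  assumes G: "finite G" and "f \<in> palg G" shows "\<exists>K. f \<in> palg_le G K"
  using assms(2)
proof induction
  case (palg_const c)
  then show ?case using palg_le_const[OF G] by blast
next
  case (palg_gen g)
  have "(\<Prod>h\<in>G. h x ^ (if h = g then 1 else 0)) = g x" for x
  proof -
    have "(\<Prod>h\<in>G. h x ^ (if h = g then 1 else 0)) = (\<Prod>h\<in>G. if h = g then h x else 1)"
      by (intro prod.cong) auto
    then show ?thesis using G palg_gen by simp
  qed
  then have "gen_monomial G (\<lambda>h. if h = g then 1 else 0) = g" by (intro ext) (simp add: gen_monomial_def)
  moreover have "gen_monomial G (\<lambda>h. if h = g then 1 else 0) \<in> palg_le G 1"
    by (rule gen_monomial_palg_le[OF G]) simp
  ultimately show ?case by auto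
next
  case (palg_add f g)
  then obtain K L where "f \<in> palg_le G K" "g \<in> palg_le G L" by blast
  then have "f \<in> palg_le G (max K L)" "g \<in> palg_le G (max K L)" using palg_le_mono[OF G] by (meson max.cobounded1 max.cobounded2)+
  then show ?case using palg_le_add by blast
next
  case (palg_mult f g)
  then show ?case using palg_le_mult[OF G] by blast
qed

text \<open>Counting: the \<open>N ^ n\<close> power products of the \<open>n\<close> functions with exponents below \<open>N\<close> lie in a
  space of dimension \<open>O(N ^ (n - 1))\<close>.\<close>

lemma algebraic_dependence:
  fixes F :: "'n::finite \<Rightarrow> 'x \<Rightarrow> complex"
  assumes G: "finite G" "card G < CARD('n)" and F: "\<And>i. F i \<in> palg G"
  shows "\<exists>R \<in> polynomial_functions. (\<exists>v. R v \<noteq> 0) \<and> (\<forall>x. R (\<chi> i. F i x) = 0)"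
proof -
  obtain k where k: "\<And>i. F i \<in> palg_le G (k i)" using palg_bounded[OF G(1) F] by metis
  define K where "K = Max (range k)"
  have FK: "F i \<in> palg_le G K" for i
    using palg_le_mono[OF G(1) _ k] by (simp add: K_def)
  define n where "n = CARD('n)"
  \<comment> \<open>Any \<open>N\<close> above \<open>(n K + 1) ^ (n - 1)\<close> works: then
    \<open>(N (n K + 1)) ^ (n - 1)\<close>, a bound for the number of power products of generators,
    is below \<open>N ^ n\<close>.\<close>
  define N where "N = Suc (Suc (n * K) ^ (n - 1))"
  define L where "L = n * (N * K)"
  define EN where "EN = {e :: 'n \<Rightarrow> nat. \<forall>i. e i < N}"
  have EN: "EN = (\<Pi>\<^sub>E i\<in>UNIV. {..<N})" by (auto simp: EN_def PiE_def)
  have finEN: "finite EN" and cardEN: "card EN = N ^ n"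
    unfolding EN by (auto intro!: finite_PiE simp: card_PiE n_def)
  have npos: "0 < n" by (simp add: n_def)
  have prod: "(\<lambda>x. \<Prod>i\<in>UNIV. F i x ^ e i) \<in> palg_le G L" if "e \<in> EN" for e
  proof -
    have "(\<lambda>x. \<Prod>i\<in>UNIV. F i x ^ e i) \<in> palg_le G (\<Sum>i\<in>UNIV. e i * K)"
      by (intro palg_le_prod palg_le_power G FK) simp
    moreover have "(\<Sum>i\<in>UNIV. e i * K) \<le> (\<Sum>i\<in>(UNIV :: 'n set). N * K)"
      by (intro sum_mono mult_right_mono) (use that in \<open>auto simp: EN_def less_imp_le\<close>)
    ultimately show ?thesis using palg_le_mono[OF G(1)] by (simp add: L_def n_def)
  qed
  then obtain c where c: "\<And>e x. e \<in> EN \<Longrightarrow>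
      (\<Prod>i\<in>UNIV. F i x ^ e i) = (\<Sum>d\<in>bounded_exponents G L. c e d * gen_monomial G d x)"
  proof -
    have "\<forall>e. \<exists>c. e \<in> EN \<longrightarrow> (\<lambda>x. \<Prod>i\<in>UNIV. F i x ^ e i) = (\<lambda>x. \<Sum>d\<in>bounded_exponents G L. c d * gen_monomial G d x)"
      using prod unfolding palg_le_def by blast
    then obtain c where "\<forall>e. e \<in> EN \<longrightarrow> (\<lambda>x. \<Prod>i\<in>UNIV. F i x ^ e i)
        = (\<lambda>x. \<Sum>d\<in>bounded_exponents G L. c e d * gen_monomial G d x)" by metis
    then show ?thesis using that[of c] by (metis (no_types, lifting))
  qed
  have "card (bounded_exponents G L) < card EN"
  proof -
    have "N * Suc (n * K) = N + L" by (simp add: L_def algebra_simps)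
    moreover have "1 \<le> N" by (simp add: N_def)
    ultimately have "Suc L \<le> N * Suc (n * K)" by linarith
    then have "Suc L ^ card G \<le> (N * Suc (n * K)) ^ card G" by (rule power_mono) simp
    also have "\<dots> \<le> (N * Suc (n * K)) ^ (n - 1)"
      using G(2) by (intro power_increasing) (auto simp: N_def n_def)
    also have "\<dots> = N ^ (n - 1) * Suc (n * K) ^ (n - 1)" by (rule power_mult_distrib)
    also have "\<dots> < N ^ (n - 1) * N" by (intro mult_strict_left_mono) (auto simp: N_def)
    also have "\<dots> = N ^ n" using npos by (simp add: power_eq_if mult.commute)
    finally show ?thesis using G(1) by (simp add: card_bounded_exponents cardEN)
  qed
  then obtain x where x: "\<exists>e\<in>EN. x e \<noteq> 0" "\<forall>d\<in>bounded_exponents G L. (\<Sum>e\<in>EN. c e d * x e) = 0"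
    using homogeneous_system_nontrivial_solution[OF finite_bounded_exponents[OF G(1)] finEN, of L "\<lambda>d e. c e d"] by auto
  define R where "R v = (\<Sum>e\<in>EN. x e * monomial_at e v)" for v :: "complex ^ 'n"
  have "R \<in> polynomial_functions" unfolding R_def[abs_def]
    by (intro palg_sum palg_mult palg_const monomial_at_polynomial)
  moreover have "\<exists>v. R v \<noteq> 0"
    using monomials_independent[OF finEN, of x] x(1) by (auto simp: R_def)
  moreover have "R (\<chi> i. F i y) = 0" for y
  proof -
    have "R (\<chi> i. F i y) = (\<Sum>e\<in>EN. x e * (\<Sum>d\<in>bounded_exponents G L. c e d * gen_monomial G d y))"
      by (simp add: R_def monomial_at_def c)
    also have "\<dots> = (\<Sum>e\<in>EN. \<Sum>d\<in>bounded_exponents G L. c e d * x e * gen_monomial G d y)"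
      by (simp add: sum_distrib_left mult_ac)
    also have "\<dots> = (\<Sum>d\<in>bounded_exponents G L. (\<Sum>e\<in>EN. c e d * x e) * gen_monomial G d y)"
      by (subst sum.swap) (simp add: sum_distrib_right)
    also have "\<dots> = 0" using x(2) by simp
    finally show ?thesis .
  qed
  ultimately show ?thesis by blast
qed

section \<open>Quartics apolar to a double line\<close>

type_synonym double_line_params = "tensor4 \<times> (complex ^ 3) \<times> complex \<times> complex"

text \<open>The nine entries that survive when all \<open>T 1 1 k l\<close> vanish, three
  coordinates of the added power and two of the line: fourteen, one fewer than a quartic
  has.\<close>

definition double_line_coordinates :: "(double_line_params \<Rightarrow> complex) list" where
  "double_line_coordinates = [\<lambda>(T, l, a, b). T 1 2 2 2, \<lambda>(T, l, a, b). T 1 2 2 3, \<lambda>(T, l, a, b). T 1 2 3 3,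
     \<lambda>(T, l, a, b). T 1 3 3 3, \<lambda>(T, l, a, b). T 2 2 2 2, \<lambda>(T, l, a, b). T 2 2 2 3,
     \<lambda>(T, l, a, b). T 2 2 3 3, \<lambda>(T, l, a, b). T 2 3 3 3, \<lambda>(T, l, a, b). T 3 3 3 3,
     \<lambda>(T, l, a, b). l $ 1, \<lambda>(T, l, a, b). l $ 2, \<lambda>(T, l, a, b). l $ 3,
     \<lambda>(T, l, a, b). a, \<lambda>(T, l, a, b). b]"

text \<open>Rebuilds a whole tensor from those nine entries, so that every entry is one of the
  fourteen coordinates or zero, even where \<open>T\<close> is not symmetric.\<close>

definition double_line_part :: "tensor4 \<Rightarrow> tensor4" where
  "double_line_part T i j k l =
    (let n = length (filter (\<lambda>m. m = 1) [i, j, k, l]); r = length (filter (\<lambda>m. m = 3) [i, j, k, l])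
     in if n = 0 then [T 2 2 2 2, T 2 2 2 3, T 2 2 3 3, T 2 3 3 3, T 3 3 3 3] ! r
        else if n = 1 then [T 1 2 2 2, T 1 2 2 3, T 1 2 3 3, T 1 3 3 3] ! r else 0)"

lemma double_line_part_eq:
  assumes T: "sym4 T" and 0: "\<And>k l. T 1 1 k l = 0"
  shows "double_line_part T = T"
proof -
  have "\<forall>i j k l. double_line_part T i j k l = T i j k l"
    by (simp add: forall_3 double_line_part_def sym4_sort[OF T] 0)
  then show ?thesis by (intro ext) blast
qed

lemma double_line_part_palg:
  "(\<lambda>x. double_line_part (fst x) i j k l) \<in> palg (set double_line_coordinates)"
proof -
  have gen: "(\<lambda>x. g (fst x)) \<in> palg (set double_line_coordinates)"
    if "(\<lambda>(T, l, a, b). g T) \<in> set double_line_coordinates" for g :: "tensor4 \<Rightarrow> complex"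
  proof -
    have "(\<lambda>x. g (fst x)) = (\<lambda>(T, l :: complex ^ 3, a :: complex, b :: complex). g T)" by auto
    then show ?thesis using that palg_gen by metis
  qed
  have "\<forall>i j k l. (\<lambda>x. double_line_part (fst x) i j k l) \<in> palg (set double_line_coordinates)"
    by (simp add: forall_3 double_line_part_def palg_const)
      (intro conjI; rule gen; simp add: double_line_coordinates_def)
  then show ?thesis by blast
qed

text \<open>Inverse of the coordinate change whose rows are a form \<open>x\<close> with \<open>x $ p = 1\<close>, \<open>x $ r = - a\<close>,
  \<open>x $ s = - b\<close> and the coordinates \<open>r\<close> and \<open>s\<close>.\<close>

definition pivot_inverse :: "3 \<Rightarrow> 3 \<Rightarrow> complex \<Rightarrow> complex \<Rightarrow> complex ^ 3 ^ 3" where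
  "pivot_inverse p r a b = (\<chi> i. if i = p then vector [1, a, b]
     else if i = r then vector [0, 1, 0] else vector [0, 0, 1])"

text \<open>On the chart \<open>a $ p \<noteq> 0\<close> the line is scaled to have coefficient 1 at
  \<open>p\<close>; the change of coordinates back from the first coordinate line is then polynomial
  in the two remaining coefficients. So the fifteen coordinates of \<open>w\<close> plus a power are
  polynomials in fourteen functions and satisfy a relation.\<close>

lemma double_line_relation:
  fixes p r s :: 3
  assumes prs: "(p, r, s) \<in> {(1, 2, 3), (2, 1, 3), (3, 1, 2)}"
  shows "\<exists>R \<in> polynomial_functions. (\<exists>v. R v \<noteq> 0) \<and>
    (\<forall>w l a. a $ p \<noteq> 0 \<longrightarrow> contr (tens w) (line_pair a a) = 0 \<longrightarrow> R (w + quartic_monomials l) = 0)"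
proof -
  let ?G = "set double_line_coordinates"
  obtain idx where idx: "\<And>e. e = (case idx e of (i, j, k, l) \<Rightarrow> exps i j k l)"
  proof -
    have "\<forall>e. \<exists>x. e = (case x of (i, j, k, l) \<Rightarrow> exps i j k l)"
      using exps_surj by (metis case_prod_conv)
    then show ?thesis using that by metis
  qed
  define F :: "quartic_exponent \<Rightarrow> double_line_params \<Rightarrow> complex" where
    "F e x = (case idx e of (i, j, k, l) \<Rightarrow>
      act (pivot_inverse p r (fst (snd (snd x))) (snd (snd (snd x)))) (double_line_part (fst x)) i j k l
      + pow4 (fst (snd x)) i j k l)" for e x
  have ent: "(\<lambda>x. pivot_inverse p r (fst (snd (snd x))) (snd (snd (snd x))) $ i $ j) \<in> palg ?G" for i j
  proof -
    have "(\<lambda>x. fst (snd (snd x))) \<in> ?G" "(\<lambda>x. snd (snd (snd x))) \<in> ?G"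
      by (auto simp: double_line_coordinates_def fun_eq_iff)
    then have "(\<lambda>x. fst (snd (snd x))) \<in> palg ?G" "(\<lambda>x. snd (snd (snd x))) \<in> palg ?G"
      by (auto intro: palg_gen)
    then show ?thesis using exhaust_3[of j]
      by (cases "i = p"; cases "i = r") (auto simp: pivot_inverse_def palg_const)
  qed
  have lin: "(\<lambda>x. fst (snd x) $ i) \<in> palg ?G" for i
  proof -
    have "(\<lambda>x. fst (snd x) $ i) \<in> ?G"
      using exhaust_3[of i] by (auto simp: double_line_coordinates_def fun_eq_iff)
    then show ?thesis by (rule palg_gen)
  qed
  have "F e \<in> palg ?G" for e
  proof -
    obtain i j k l where "idx e = (i, j, k, l)" by (cases "idx e") auto
    then show ?thesis unfolding F_def[abs_def] act_def app_def pow4_def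
      by (simp only: prod.case) (intro palg_add palg_sum palg_mult ent lin double_line_part_palg)
  qed
  moreover have "card ?G < CARD(quartic_exponent)"
  proof -
    have "card ?G \<le> length double_line_coordinates" by (rule card_length)
    then show ?thesis by (simp add: double_line_coordinates_def card_quartic_exponent)
  qed
  ultimately obtain R where R: "R \<in> polynomial_functions" "\<exists>v. R v \<noteq> 0" "\<And>x. R (\<chi> e. F e x) = 0"
    using algebraic_dependence[of ?G F] by auto
  have "R (w + quartic_monomials l) = 0"
    if a: "a $ p \<noteq> 0" and c: "contr (tens w) (line_pair a a) = 0" for w l a
  proof -
    define x where "x = (\<chi> i. a $ i / a $ p)"
    have xx: "line_pair x x = (\<chi> i j. (1 / (a $ p)\<^sup>2) * line_pair a a $ i $ j + 0 * line_pair a a $ i $ j)"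
      using a by (simp add: x_def line_pair_def vec_eq_iff power2_eq_square)
    have cx: "contr (tens w) (line_pair x x) = 0"
      unfolding xx contr_linear c by (simp add: vec_eq_iff)
    have xp: "x $ p = 1" using a by (simp add: x_def)
    define P :: "complex ^ 3 ^ 3" where "P = vector [x, axis r 1, axis s 1]"
    define Q where "Q = pivot_inverse p r (- x $ r) (- x $ s)"
    have QP: "Q ** P = mat 1"
      using prs xp by (auto simp: mat3_eq_iff forall_3 matrix_matrix_mult_def sum_3 P_def Q_def
          pivot_inverse_def mat_def axis_def)
    define T where "T = act P (tens w)"
    have "transpose P ** (\<chi> i j. if i = 1 \<and> j = 1 then 1 else 0) ** P = line_pair x x"
      by (simp add: mat3_eq_iff matrix_matrix_mult_def transpose_def sum_3 P_def line_pair_def)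
    then have "contr T (\<chi> i j. if i = 1 \<and> j = 1 then 1 else 0) = P ** 0 ** transpose P"
      unfolding T_def contr_act by (simp only: cx)
    then have cT: "contr T (\<chi> i j. if i = 1 \<and> j = 1 then 1 else 0) = 0"
      by (simp add: matrix_matrix_mult_def vec_eq_iff)
    have "T 1 1 k m = 0" for k m
    proof -
      have "contr T (\<chi> i j. if i = 1 \<and> j = 1 then 1 else 0) $ k $ m = 0" by (simp add: cT)
      then show ?thesis by (simp add: contr_def sum_3)
    qed
    then have dT: "double_line_part T = T"
      using double_line_part_eq sym4_act[OF sym4_tens] by (simp add: T_def)
    have "act Q T = tens w" unfolding T_def by (simp add: act_act QP act_1)
    then have "F e (T, l, - x $ r, - x $ s) = (w + quartic_monomials l) $ e" for e
    proof -
      assume aQ: "act Q T = tens w"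
      obtain i j k m where "idx e = (i, j, k, m)" by (cases "idx e") auto
      moreover from this have "e = exps i j k m" using idx[of e] by simp
      moreover have "pow4 l i j k m = quartic_monomials l $ exps i j k m"
        by (simp add: tens_quartic_monomials[symmetric] tens_def)
      ultimately show ?thesis by (simp add: F_def dT Q_def[symmetric] aQ) (simp add: tens_def)
    qed
    then have "(\<chi> e. F e (T, l, - x $ r, - x $ s)) = w + quartic_monomials l" by (simp add: vec_eq_iff)
    then show ?thesis using R(3) by metis
  qed
  then show ?thesis using R(1,2) by blast
qed

text \<open>Three charts cover all lines; the product of their relations serves every one of
  them.\<close>

lemma double_line_polynomial:
  "\<exists>R \<in> polynomial_functions. (\<exists>v. R v \<noteq> 0) \<and>
    (\<forall>w l a. a \<noteq> 0 \<longrightarrow> contr (tens w) (line_pair a a) = 0 \<longrightarrow> R (w + quartic_monomials l) = 0)"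
proof -
  obtain R1 where R1: "R1 \<in> polynomial_functions" "\<exists>v. R1 v \<noteq> 0"
    "\<And>w l a. a $ 1 \<noteq> 0 \<Longrightarrow> contr (tens w) (line_pair a a) = 0 \<Longrightarrow> R1 (w + quartic_monomials l) = 0"
    using double_line_relation[of 1 2 3] by auto
  obtain R2 where R2: "R2 \<in> polynomial_functions" "\<exists>v. R2 v \<noteq> 0"
    "\<And>w l a. a $ 2 \<noteq> 0 \<Longrightarrow> contr (tens w) (line_pair a a) = 0 \<Longrightarrow> R2 (w + quartic_monomials l) = 0"
    using double_line_relation[of 2 1 3] by auto
  obtain R3 where R3: "R3 \<in> polynomial_functions" "\<exists>v. R3 v \<noteq> 0"
    "\<And>w l a. a $ 3 \<noteq> 0 \<Longrightarrow> contr (tens w) (line_pair a a) = 0 \<Longrightarrow> R3 (w + quartic_monomials l) = 0"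
    using double_line_relation[of 3 1 2] by auto
  have "\<exists>v. R1 v * R2 v \<noteq> 0"
    using polynomial_functions_common_nonzero R1(1,2) R2(1,2) by (metis mult_eq_0_iff)
  then have "\<exists>v. R1 v * R2 v * R3 v \<noteq> 0"
    using polynomial_functions_common_nonzero[OF palg_mult[OF R1(1) R2(1)]] R3(1,2) by (metis mult_eq_0_iff)
  moreover have "(\<lambda>v. R1 v * R2 v * R3 v) \<in> polynomial_functions"
    by (intro palg_mult R1 R2 R3)
  moreover have "R1 (w + quartic_monomials l) * R2 (w + quartic_monomials l) * R3 (w + quartic_monomials l) = 0"
    if "a \<noteq> 0" "contr (tens w) (line_pair a a) = 0" for w l a
  proof -
    have "a $ 1 \<noteq> 0 \<or> a $ 2 \<noteq> 0 \<or> a $ 3 \<noteq> 0" using that(1) by (auto simp: vec_eq_iff forall_3)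
    then show ?thesis using R1(3) R2(3) R3(3) that(2) by auto
  qed
  ultimately show ?thesis by (intro bexI[of _ "\<lambda>v. R1 v * R2 v * R3 v"]) auto
qed

section \<open>Ranks of points\<close>

lemma rank_le_imp_points:
  assumes "rank_le n (tens w)"
  shows "\<exists>ps. length ps = n \<and> set ps \<subseteq> veronese_surface \<and> w \<in> vec.span (\<Union>p\<in>set ps. line_of p)"
proof -
  have ver: "point (quartic_monomials v) \<in> veronese_surface" if "v \<noteq> 0" for v
  proof -
    have "line_of (veronese4 (point v)) = vec.span {quartic_monomials v}"
      using that by (simp add: veronese4.rep_eq line_of_point span_quartic_monomials_line)
    then have "quartic_monomials v \<in> line_of (veronese4 (point v))" by (simp add: vec.span_base)
    then have "veronese4 (point v) = point (quartic_monomials v)"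
      using point_eqI quartic_monomials_nonzero[OF that] by blast
    then show ?thesis unfolding veronese_surface_def by (metis rangeI)
  qed
  obtain xs where xs: "length xs \<le> n" "\<And>i j k l. tens w i j k l = (\<Sum>(c, v)\<leftarrow>xs. c * pow4 v i j k l)"
    using assms by (auto simp: rank_le_def)
  have "tens (\<Sum>(c, v)\<leftarrow>xs. c *s quartic_monomials v) i j k l = (\<Sum>(c, v)\<leftarrow>xs. c * pow4 v i j k l)" for i j k l
    by (induction xs) (auto simp: tens_0 tens_add tens_scale tens_quartic_monomials)
  then have w: "w = (\<Sum>(c, v)\<leftarrow>xs. c *s quartic_monomials v)"
    using xs(2) by (intro tens_eqD ext) simp
  \<comment> \<open>Zero vectors contribute nothing and define no point, so they are
    dropped.\<close>
  define ps0 where "ps0 = map (\<lambda>(c, v). point (quartic_monomials v)) (filter (\<lambda>(c, v). v \<noteq> 0) xs)"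
  define x0 :: "quartic_exponent proj" where "x0 = point (quartic_monomials (axis 1 1))"
  \<comment> \<open>\<open>X_rank\<close> and the secant variety use lists of exact length; an
    arbitrary point of the surface fills the gap.\<close>
  define ps where "ps = ps0 @ replicate (n - length ps0) x0"
  have "length ps0 \<le> length xs" by (simp add: ps0_def)
  then have "length ps0 \<le> n" using xs(1) by simp
  then have "length ps = n" by (simp add: ps_def)
  moreover have "set ps \<subseteq> veronese_surface"
    using ver by (auto simp: ps_def ps0_def x0_def axis_eq_0_iff split: if_splits)
  moreover have "w \<in> vec.span (\<Union>p\<in>set ps. line_of p)"
  proof -
    have "quartic_monomials v \<in> vec.span (\<Union>p\<in>set ps. line_of p)" if "(c, v) \<in> set xs" for c v
    proof (cases "v = 0")
      case True
      then have "quartic_monomials v = 0 *s quartic_monomials v"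
        using quartic_monomials_scale[of 0 v] by simp
      then show ?thesis by (metis vec.span_zero vector_smult_lzero)
    next
      case False
      then have "point (quartic_monomials v) \<in> set ps" using that by (force simp: ps_def ps0_def)
      moreover have "quartic_monomials v \<in> line_of (point (quartic_monomials v))"
        using quartic_monomials_nonzero[OF False] by (simp add: line_of_point vec.span_base)
      ultimately show ?thesis by (intro vec.span_base) blast
    qed
    then show ?thesis unfolding w
      by (induction xs) (auto intro!: vec.span_add vec.span_scale vec.span_zero)
  qed
  ultimately show ?thesis by blast
qed

lemma veronese_line:
  assumes "p \<in> veronese_surface" shows "\<exists>v. line_of p = vec.span {quartic_monomials v}"
proof -
  obtain L where L: "p = veronese4 L" using assms by (auto simp: veronese_surface_def)
  obtain v where v: "v \<in> line_of L" "v \<noteq> 0" using exists_line_of_nonzero by blast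
  have "line_of p = vec.span (quartic_monomials ` line_of L)" by (simp add: L veronese4.rep_eq)
  then show ?thesis using span_quartic_monomials_line[OF v(2)] line_of_eq_span[OF v] by metis
qed

lemma points_imp_rank_le:
  assumes ps: "set ps \<subseteq> veronese_surface" and w: "w \<in> vec.span (\<Union>p\<in>set ps. line_of p)"
  shows "rank_le (length ps) (tens w)"
proof -
  obtain v where v: "\<And>p. p \<in> veronese_surface \<Longrightarrow> line_of p = vec.span {quartic_monomials (v p)}"
    using veronese_line by metis
  define U where "U = (\<lambda>p. quartic_monomials (v p)) ` set ps"
  have "(\<Union>p\<in>set ps. line_of p) \<subseteq> vec.span U"
  proof
    fix x assume "x \<in> (\<Union>p\<in>set ps. line_of p)"
    then obtain p where p: "p \<in> set ps" "x \<in> line_of p" by blast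
    then have "x \<in> vec.span {quartic_monomials (v p)}" using v ps by auto
    moreover have "{quartic_monomials (v p)} \<subseteq> U" using p by (auto simp: U_def)
    ultimately show "x \<in> vec.span U" using vec.span_mono by blast
  qed
  then have "w \<in> vec.span U" using w vec.span_minimal vec.subspace_span by blast
  moreover have finU: "finite U" by (simp add: U_def)
  ultimately obtain c where c: "w = (\<Sum>u\<in>U. c u *s u)" by (auto simp: vec.span_finite)
  have "\<forall>u\<in>U. \<exists>x. u = quartic_monomials x" by (auto simp: U_def)
  then obtain g where g: "\<And>u. u \<in> U \<Longrightarrow> u = quartic_monomials (g u)" by metis
  have "tens w i j k l = (\<Sum>u\<in>U. c u * pow4 (g u) i j k l)" for i j k l
    unfolding c tens_sum using g by (intro sum.cong refl) (metis tens_quartic_monomials tens_scale)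
  then have "rank_le (card U) (tens w)" by (rule rank_le_sum[OF finU])
  moreover have "card U \<le> length ps" unfolding U_def
    by (meson card_image_le card_length finite_set order.trans)
  ultimately show ?thesis using rank_le_mono by blast
qed

lemma in_lin_span_iff:
  assumes "w \<in> line_of p" "w \<noteq> 0"
  shows "p \<in> lin_span S \<longleftrightarrow> w \<in> vec.span (\<Union>p\<in>S. line_of p)"
proof -
  have "line_of p = vec.span {w}" by (rule line_of_eq_span[OF assms])
  moreover have "vec.span {w} \<subseteq> vec.span B \<longleftrightarrow> w \<in> vec.span B" for B
    using vec.span_minimal[of "{w}" "vec.span B"] vec.span_base[of w "{w}"] by auto
  ultimately show ?thesis by (simp add: lin_span_def)
qed

lemma spanned_by_points_iff_rank_le:
  assumes "w \<in> line_of p" "w \<noteq> 0"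
  shows "(\<exists>ps. length ps = r \<and> set ps \<subseteq> veronese_surface \<and> p \<in> lin_span (set ps)) \<longleftrightarrow> rank_le r (tens w)"
  using rank_le_imp_points[of r w] points_imp_rank_le in_lin_span_iff[OF assms] by blast

lemma X_rank_veronese:
  assumes "w \<in> line_of p" "w \<noteq> 0"
  shows "X_rank veronese_surface p = (LEAST r. rank_le r (tens w))"
  unfolding X_rank_def spanned_by_points_iff_rank_le[OF assms] ..

text \<open>A 9 by 9 determinant. The matrix acts on symmetric matrices as the contraction and on
  antisymmetric ones as twice the identity, so this is the classical 6 by 6 catalecticant
  determinant up to a constant factor.\<close>

definition catalecticant :: "complex ^ quartic_exponent \<Rightarrow> complex" where
  "catalecticant w = det (cat_matrix (tens w))"

lemma catalecticant_polynomial: "catalecticant \<in> polynomial_functions"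
proof -
  have "(\<lambda>w. cat_matrix (tens w) $ a $ b) \<in> polynomial_functions" for a b
  proof -
    have "(\<lambda>w. cat_matrix (tens w) $ a $ b) = (\<lambda>w :: complex ^ quartic_exponent.
        w $ exps (fst b) (snd b) (fst a) (snd a) + ((if a = b then 1 else 0) - (if a = prod.swap b then 1 else 0)))"
      by (simp add: cat_matrix_def tens_def)
    moreover have "\<dots> \<in> polynomial_functions" by (intro palg_add palg_const palg_gen) auto
    ultimately show ?thesis by simp
  qed
  then show ?thesis unfolding catalecticant_def[abs_def] det_def
    by (intro palg_sum palg_mult palg_const palg_prod)
qed

lemma catalecticant_iff: "catalecticant w \<noteq> 0 \<longleftrightarrow> nondeg (tens w)"
  unfolding catalecticant_def by (rule det_cat_matrix_iff_nondeg[OF sym4_tens])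

lemma nondeg_not_overdegenerate:
  assumes "overdegenerate T" "nondeg T" shows False
proof -
  consider p q where "symmat p" "contr T p = 0"
      "\<And>a b. (\<chi> i j. a * p $ i $ j + b * q $ i $ j) = (0 :: complex ^ 3 ^ 3) \<Longrightarrow> a = 0 \<and> b = 0"
    | a where "a \<noteq> 0" "contr T (line_pair a a) = 0"
    using assms(1) unfolding overdegenerate_def by blast
  then show False
  proof cases
    case 1
    then have "p = 0" using assms(2) by (simp add: nondeg_def)
    then show False using 1(3)[of 1 0] by (simp add: vec_eq_iff)
  next
    case 2
    then have "line_pair a a = 0" using assms(2) symmat_line_pair by (auto simp: nondeg_def)
    then have "line_pair a a $ i $ i = 0" for i by simp
    then have "a $ i = 0" for i by (simp add: line_pair_def)
    then show False using 2(1) by (simp add: vec_eq_iff)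
  qed
qed

lemma catalecticant_exists_nonzero: "\<exists>w. catalecticant w \<noteq> 0"
proof -
  \<comment> \<open>Up to a factor, the square of \<open>x1^2 + x2^2 + x3^2\<close>; it contracts
    \<open>q\<close> to \<open>2 q\<close> plus the trace of \<open>q\<close> times the identity,
    which is injective.\<close>
  define w :: "complex ^ quartic_exponent" where
    "w = (\<chi> e. if \<forall>i. even (exponent e i) then (if \<exists>i. exponent e i = 4 then 3 else 1) else 0)"
  have ev: "tens w i j k l = (if \<forall>m. even (exponent (exps i j k l) m) then
      (if \<exists>m. exponent (exps i j k l) m = 4 then 3 else 1) else 0)" for i j k l
    by (simp add: tens_def w_def)
  have ex3: "(\<exists>m :: 3. Q m) \<longleftrightarrow> Q 1 \<or> Q 2 \<or> Q 3" for Q by (metis exhaust_3)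
  have t: "tens w 1 1 1 1 = 3" "tens w 2 2 2 2 = 3" "tens w 3 3 3 3 = 3"
    "tens w 1 1 2 2 = 1" "tens w 1 1 3 3 = 1" "tens w 2 2 3 3 = 1"
    "tens w 1 1 1 2 = 0" "tens w 1 1 1 3 = 0" "tens w 1 1 2 3 = 0" "tens w 1 2 2 2 = 0" "tens w 1 2 2 3 = 0"
    "tens w 1 2 3 3 = 0" "tens w 1 3 3 3 = 0" "tens w 2 2 2 3 = 0" "tens w 2 3 3 3 = 0"
    by (simp_all add: ev exponent_exps forall_3 ex3)
  note sort = sym4_sort[OF sym4_tens[of w]]
  have "nondeg (tens w)" unfolding nondeg_def
  proof (intro allI impI)
    fix q assume q: "symmat q" "contr (tens w) q = 0"
    have s: "q $ 2 $ 1 = q $ 1 $ 2" "q $ 3 $ 1 = q $ 1 $ 3" "q $ 3 $ 2 = q $ 2 $ 3"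
      using q(1) by (auto simp: symmat_def)
    have "contr (tens w) q $ k $ l = 0" for k l using q(2) by simp
    from this[of 1 1] this[of 2 2] this[of 3 3] this[of 1 2] this[of 1 3] this[of 2 3]
    have e: "3 * q $ 1 $ 1 + q $ 2 $ 2 + q $ 3 $ 3 = 0" "q $ 1 $ 1 + 3 * q $ 2 $ 2 + q $ 3 $ 3 = 0"
      "q $ 1 $ 1 + q $ 2 $ 2 + 3 * q $ 3 $ 3 = 0" "q $ 1 $ 2 = 0" "q $ 1 $ 3 = 0" "q $ 2 $ 3 = 0"
      by (simp_all add: contr_def sum_3 sort t s add_ac mult_ac)
    have "10 * q $ 1 $ 1 = 4 * (3 * q $ 1 $ 1 + q $ 2 $ 2 + q $ 3 $ 3)
        - (q $ 1 $ 1 + 3 * q $ 2 $ 2 + q $ 3 $ 3) - (q $ 1 $ 1 + q $ 2 $ 2 + 3 * q $ 3 $ 3)"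
      by (simp add: algebra_simps)
    then have 1: "q $ 1 $ 1 = 0" unfolding e by simp
    have "8 * q $ 2 $ 2 = 3 * (q $ 1 $ 1 + 3 * q $ 2 $ 2 + q $ 3 $ 3)
        - (q $ 1 $ 1 + q $ 2 $ 2 + 3 * q $ 3 $ 3) - 2 * q $ 1 $ 1"
      by (simp add: algebra_simps)
    then have 2: "q $ 2 $ 2 = 0" unfolding e(2) e(3) by (simp add: 1)
    then have 3: "q $ 3 $ 3 = 0" using e(1) 1 by simp
    show "q = 0" by (simp add: mat3_eq_iff forall_3 s e 1 2 3)
  qed
  then show ?thesis using catalecticant_iff by blast
qed

lemma catalecticant_0: "catalecticant 0 = 0"
proof -
  have "contr (tens 0) q = 0" for q by (simp add: contr_def tens_0 vec_eq_iff)
  moreover have "symmat (mat 1)" "mat 1 \<noteq> (0 :: complex ^ 3 ^ 3)"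
    by (auto simp: symmat_def mat_def vec_eq_iff)
  ultimately have "\<not> nondeg (tens 0)" unfolding nondeg_def by blast
  then show ?thesis using catalecticant_iff by blast
qed

text \<open>A two-dimensional space of apolar conics contains one through \<open>l\<close>, and
  adding the fourth power of \<open>l\<close> leaves that conic apolar.\<close>

lemma catalecticant_plus_power:
  assumes "overdegenerate (tens w)"
  shows "catalecticant (w + quartic_monomials l) = 0 \<or> (\<exists>a. a \<noteq> 0 \<and> contr (tens w) (line_pair a a) = 0)"
proof (cases "\<exists>a. a \<noteq> 0 \<and> contr (tens w) (line_pair a a) = 0")
  case False
  then obtain p q where pq: "symmat p" "symmat q" "contr (tens w) p = 0" "contr (tens w) q = 0"
      "\<And>a b. (\<chi> i j. a * p $ i $ j + b * q $ i $ j) = (0 :: complex ^ 3 ^ 3) \<Longrightarrow> a = 0 \<and> b = 0"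
    using assms unfolding overdegenerate_def by blast
  \<comment> \<open>The conic \<open>q(l) p - p(l) q\<close> passes through \<open>l\<close>; when
    \<open>q(l) = 0\<close> it might be zero, and \<open>q\<close> itself is taken.\<close>
  define a b where "a = (if conic_at q l = 0 then 0 else conic_at q l)"
    and "b = (if conic_at q l = 0 then 1 else - conic_at p l)"
  define r :: "complex ^ 3 ^ 3" where "r = (\<chi> i j. a * p $ i $ j + b * q $ i $ j)"
  have "a \<noteq> 0 \<or> b \<noteq> 0" by (simp add: a_def b_def)
  then have "r \<noteq> 0" using pq(5)[of a b] unfolding r_def by blast
  moreover have "symmat r" using pq(1,2) by (simp add: r_def symmat_def)
  moreover have "contr (tens (w + quartic_monomials l)) r = 0"
  proof -
    have "contr (tens (w + quartic_monomials l)) r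
        = (\<chi> i j. contr (tens w) r $ i $ j + contr (pow4 l) r $ i $ j)"
      by (simp add: contr_def tens_add tens_quartic_monomials distrib_left sum.distrib vec_eq_iff)
    moreover have "contr (tens w) r = 0"
      unfolding r_def contr_linear pq by (simp add: vec_eq_iff)
    moreover have "conic_at r l = a * conic_at p l + b * conic_at q l"
      by (simp add: conic_at_def r_def sum_3 algebra_simps)
    then have "conic_at r l = 0" by (simp add: a_def b_def)
    ultimately show ?thesis by (simp add: contr_pow4 vec_eq_iff)
  qed
  ultimately have "\<not> nondeg (tens (w + quartic_monomials l))" unfolding nondeg_def by blast
  then show ?thesis using catalecticant_iff by blast
qed simp

lemma rank_6_of_catalecticant:
  assumes "catalecticant w \<noteq> 0"
  shows "X_rank veronese_surface (point w) = 6"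
proof -
  have w: "w \<noteq> 0" using assms catalecticant_0 by auto
  have nd: "nondeg (tens w)" using assms catalecticant_iff by blast
  have mem: "w \<in> line_of (point w)" using w by (simp add: line_of_point vec.span_base)
  have "rank_le 6 (tens w)" using rank_le_6_or_overdegenerate nondeg_not_overdegenerate nd by blast
  moreover have "6 \<le> r" if "rank_le r (tens w)" for r
  proof (rule ccontr)
    assume "\<not> 6 \<le> r"
    then have "rank_le 5 (tens w)" using rank_le_mono[OF that] by simp
    then show False using rank_le_5_not_nondeg nd by blast
  qed
  ultimately show ?thesis unfolding X_rank_veronese[OF mem w] by (intro Least_equality)
qed

lemma overdegenerate_of_rank_7:
  assumes "X_rank veronese_surface p = 7" "w \<in> line_of p"
  shows "overdegenerate (tens w)"
proof (cases "w = 0")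
  case True
  have "contr (tens 0) q = 0" for q by (simp add: contr_def tens_0 vec_eq_iff)
  then show ?thesis unfolding overdegenerate_def True
    by (intro disjI2 exI[of _ "axis 1 1"]) (simp add: axis_eq_0_iff)
next
  case False
  have "\<not> rank_le 6 (tens w)"
  proof
    assume "rank_le 6 (tens w)"
    then have "(LEAST r. rank_le r (tens w)) \<le> 6" by (rule Least_le)
    then show False using assms(1) X_rank_veronese[OF assms(2) False] by simp
  qed
  then show ?thesis using rank_le_6_or_overdegenerate by blast
qed

section \<open>The join with the rank seven locus and the theorem\<close>

lemma fourth_root_exists: "\<exists>s :: complex. s ^ 4 = c"
proof -
  have "(csqrt (csqrt c)) ^ 4 = ((csqrt (csqrt c))\<^sup>2)\<^sup>2" by (simp only: power_mult[symmetric]) simp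
  also have "\<dots> = c" by (simp only: power2_csqrt)
  finally show ?thesis by blast
qed

text \<open>One polynomial passes through both closures. For fixed \<open>l\<close>, the function
  \<open>H (w + quartic_monomials l)\<close> is a polynomial in \<open>w\<close> that vanishes on
  points of rank 7, hence on their closure; as \<open>l\<close> is arbitrary, \<open>H\<close>
  vanishes on all joining lines, hence on the join.\<close>

lemma join_rank_7_in_hypersurface:
  "\<exists>H \<in> polynomial_functions. (\<exists>v. H v \<noteq> 0) \<and> H 0 = 0 \<and>
    (\<forall>p \<in> join (rank_locus veronese_surface 7) veronese_surface. \<forall>v \<in> line_of p. H v = 0)"
proof -
  obtain R where R: "R \<in> polynomial_functions" "\<exists>v. R v \<noteq> 0"
    "\<And>w l a. a \<noteq> 0 \<Longrightarrow> contr (tens w) (line_pair a a) = 0 \<Longrightarrow> R (w + quartic_monomials l) = 0"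
    using double_line_polynomial by blast
  define H where "H v = catalecticant v * R v" for v
  have H: "H \<in> polynomial_functions"
    unfolding H_def[abs_def] by (intro palg_mult catalecticant_polynomial R(1))
  have nz: "\<exists>v. H v \<noteq> 0"
    using catalecticant_exists_nonzero R(1,2) polynomial_functions_common_nonzero[OF catalecticant_polynomial]
    by (metis H_def mult_eq_0_iff)
  have base: "H (w + quartic_monomials l) = 0" if "p \<in> {p. X_rank veronese_surface p = 7}" "w \<in> line_of p" for p w l
    using catalecticant_plus_power[OF overdegenerate_of_rank_7, of p w l] R(3) that by (auto simp: H_def)
  have locus: "H (w + quartic_monomials l) = 0" if "p \<in> rank_locus veronese_surface 7" "w \<in> line_of p" for p w l
  proof -
    have "(\<lambda>w. H (w + quartic_monomials l)) \<in> polynomial_functions"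
    proof (rule palg_comp[OF H])
      fix g :: "complex ^ quartic_exponent \<Rightarrow> complex" assume "g \<in> range (\<lambda>i v. v $ i)"
      then obtain i where "g = (\<lambda>v. v $ i)" by blast
      then show "(\<lambda>w. g (w + quartic_monomials l)) \<in> polynomial_functions"
        using palg_add[OF palg_gen[OF rangeI, of "\<lambda>i v. v $ i" i] palg_const] by simp
    qed
    moreover have "p \<in> zariski_closure {p. X_rank veronese_surface p = 7}"
      using that(1) by (simp only: rank_locus_def)
    moreover have "w \<in> line_of p" by (rule that(2))
    ultimately show ?thesis
      using polynomial_vanishes_on_closure[of "\<lambda>w. H (w + quartic_monomials l)"] base by meson
  qed
  define U where "U = (\<Union>w\<in>rank_locus veronese_surface 7. \<Union>x\<in>veronese_surface - {w}. lin_span {w, x})"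
  have lines: "H v = 0" if p: "p \<in> U" and v: "v \<in> line_of p" for p v
  proof -
    obtain w x where wx: "w \<in> rank_locus veronese_surface 7" "x \<in> veronese_surface" "p \<in> lin_span {w, x}"
      using p unfolding U_def by blast
    obtain l where l: "line_of x = vec.span {quartic_monomials l}" using veronese_line wx(2) by blast
    have "v \<in> vec.span (line_of w \<union> line_of x)" using wx(3) v by (auto simp: lin_span_def)
    then obtain y z where yz: "v = y + z" "y \<in> vec.span (line_of w)" "z \<in> vec.span (line_of x)"
      by (auto simp: vec.span_Un)
    have "y \<in> line_of w" using yz(2) line_of[of w] by (metis (no_types, lifting) mem_Collect_eq vec.span_eq_iff)
    moreover have "z \<in> vec.span {quartic_monomials l}" using yz(3) unfolding l vec.span_span .
    then obtain c where "z = c *s quartic_monomials l" by (auto simp: vec.span_singleton)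
    \<comment> \<open>The scalar is absorbed into the power, so that only sums
      \<open>w + quartic_monomials l\<close> have to be considered.\<close>
    moreover obtain s where "s ^ 4 = c" using fourth_root_exists by blast
    ultimately have "v = y + quartic_monomials (s *s l)" "y \<in> line_of w"
      using yz(1) by (auto simp: quartic_monomials_scale)
    then show ?thesis using locus[OF wx(1)] by blast
  qed
  have "\<forall>p \<in> join (rank_locus veronese_surface 7) veronese_surface. \<forall>v \<in> line_of p. H v = 0"
    unfolding join_def U_def[symmetric] using polynomial_vanishes_on_closure[OF H, of U] lines by meson
  then show ?thesis using H nz catalecticant_0 by (intro bexI[of _ H]) (auto simp: H_def)
qed

theorem theorem1p1:
  shows "join (rank_locus veronese_surface 7) veronese_surface \<subset> rank_locus veronese_surface 6
    \<and> rank_locus veronese_surface 6 = secant_variety 6 veronese_surface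
    \<and> secant_variety 6 veronese_surface = (UNIV :: quartic_exponent proj set)"
proof -
  obtain u where u: "catalecticant u \<noteq> 0" using catalecticant_exists_nonzero by blast
  have W6: "rank_locus veronese_surface 6 = UNIV"
    unfolding rank_locus_def
    by (rule zariski_closure_UNIV[OF catalecticant_polynomial u catalecticant_0])
      (simp add: rank_6_of_catalecticant)
  have sigma6: "secant_variety 6 veronese_surface = UNIV"
    unfolding secant_variety_def
  proof (rule zariski_closure_UNIV[OF catalecticant_polynomial u catalecticant_0])
    fix w assume c: "catalecticant w \<noteq> 0"
    then have w: "w \<noteq> 0" using catalecticant_0 by auto
    have "rank_le 6 (tens w)" using c catalecticant_iff rank_le_6_or_overdegenerate nondeg_not_overdegenerate by blast
    moreover have "w \<in> line_of (point w)" using w by (simp add: line_of_point vec.span_base)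
    ultimately show "point w \<in> (\<Union>ps\<in>{ps. length ps = 6 \<and> set ps \<subseteq> veronese_surface}. lin_span (set ps))"
      using spanned_by_points_iff_rank_le[of w "point w" 6] w by blast
  qed
  obtain H :: "complex ^ quartic_exponent \<Rightarrow> complex" and v where H: "H v \<noteq> 0" "H 0 = 0"
    "\<forall>p \<in> join (rank_locus veronese_surface 7) veronese_surface. \<forall>v \<in> line_of p. H v = 0"
    using join_rank_7_in_hypersurface by metis
  have "v \<noteq> 0" using H by auto
  then have "v \<in> line_of (point v)" by (simp add: line_of_point vec.span_base)
  then have "point v \<notin> join (rank_locus veronese_surface 7) veronese_surface" using H by blast
  then show ?thesis using W6 sigma6 by blast
qed

end
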